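(* Let $0<\alpha<n$ and $1<p\le q<\infty$, and suppose $$\min\Big(\frac{q}{p},\frac{p'}{q'}\Big)\Big(1-\frac{\alpha}{n}\Big)\ge 1.$$ Then for all sufficiently large $\delta>0$ (i.e. there is $\delta_0$, depending only on $\alpha,n,p,q$, such that for every $\delta>\delta_0$) the following holds with $$\Phi(t)=t^q\big(\log(e+t)\big)^{q-1}\big(\log\log(e^e+t)\big)^{q-1+\delta},$$ $$\Psi(t)=t^{p'}\big(\log(e+t)\big)^{p'-1}\big(\log\log(e^e+t)\big)^{p'-1+\delta}.$$ For every pair of weights $(u,\sigma)$ that satisfies $$\sup_Q|Q|^{\frac{\alpha}{n}+\frac1q-\frac1p}\,\|u^{\frac1q}\|_{\Phi,Q}\,\|\sigma^{\frac1{p'}}\|_{p',Q}<\infty$$ and $$\sup_Q|Q|^{\frac{\alpha}{n}+\frac1q-\frac1p}\,\|u^{\frac1q}\|_{q,Q}\,\|\sigma^{\frac1{p'}}\|_{\Psi,Q}<\infty,$$ there is a constant $C<\infty$ such that for all $f\in L^p(\sigma)$, $$\|I_\alpha(f\sigma)\|_{L^{q}(u)}\le C\,\|f\|_{L^p(\sigma)}.$$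
   Context: All functions are on $\mathbb{R}^n$; suprema are over all cubes $Q\subset\mathbb{R}^n$ with sides parallel to the axes. A weight is a non-negative locally integrable function. For $1<r<\infty$, $r'=r/(r-1)$. Riesz potential: $I_\alpha f(x)=\int_{\mathbb{R}^n}\frac{f(y)}{|x-y|^{n-\alpha}}\,dy$. Localized Luxemburg norm: $\|f\|_{\Phi,Q}=\inf\{\lambda>0:\frac1{|Q|}\int_Q\Phi(|f(x)|/\lambda)\,dx\le1\}$ (similarly for $\Psi$); for $1<r<\infty$, $\|f\|_{r,Q}=\big(\frac1{|Q|}\int_Q|f|^r\,dx\big)^{1/r}$. $\|f\|_{L^p(\sigma)}=(\int|f|^p\sigma\,dx)^{1/p}$ and $\|g\|_{L^q(u)}=(\int|g|^q u\,dx)^{1/q}$. *)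

theory Defs
  imports "HOL-Analysis.Analysis"
begin

definition conj_exp :: "real \<Rightarrow> real" where
  "conj_exp r = r / (r - 1)"

text \<open>Real powers of extended non-negative numbers; only used with \<open>r > 0\<close>, whence \<open>\<infinity>\<close>
  is mapped to \<open>\<infinity>\<close>.\<close>

definition enn_powr :: "ennreal \<Rightarrow> real \<Rightarrow> ennreal" where
  "enn_powr x r = (if x = \<infinity> then \<infinity> else ennreal (enn2real x powr r))"

definition cubes :: "(real ^ 'n) set set" where
  "cubes = {cbox a (a + (\<chi> i. l)) | a l. l > 0}"

definition weight :: "(real ^ 'n \<Rightarrow> real) \<Rightarrow> bool" where
  "weight w \<longleftrightarrow> (\<forall>x. 0 \<le> w x) \<and> (\<forall>K. compact K \<longrightarrow> set_integrable lebesgue K w)"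

text \<open>The infimum is taken in \<open>ennreal\<close>, so the norm is \<open>\<infinity>\<close> if no \<open>s\<close> is admissible.\<close>

definition luxemburg_norm :: "(real \<Rightarrow> real) \<Rightarrow> (real ^ 'n \<Rightarrow> real) \<Rightarrow> (real ^ 'n) set \<Rightarrow> ennreal" where
  "luxemburg_norm \<Phi> f Q = Inf {ennreal s | s. s > 0 \<and>
     (\<integral>\<^sup>+x\<in>Q. ennreal (\<Phi> (\<bar>f x\<bar> / s)) \<partial>lebesgue) / emeasure lebesgue Q \<le> 1}"

definition avg_norm :: "real \<Rightarrow> (real ^ 'n \<Rightarrow> real) \<Rightarrow> (real ^ 'n) set \<Rightarrow> ennreal" where
  "avg_norm r f Q =
     enn_powr ((\<integral>\<^sup>+x\<in>Q. ennreal (\<bar>f x\<bar> powr r) \<partial>lebesgue) / emeasure lebesgue Q) (1 / r)"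

text \<open>With \<open>r = q\<close> this is \<open>\<Phi>\<close>, and with \<open>r = p'\<close> it is \<open>\<Psi>\<close>.\<close>

definition loglog_bump :: "real \<Rightarrow> real \<Rightarrow> real \<Rightarrow> real" where
  "loglog_bump r \<delta> t =
     t powr r * ln (exp 1 + t) powr (r - 1) * ln (ln (exp (exp 1) + t)) powr (r - 1 + \<delta>)"

definition Lp_norm :: "real \<Rightarrow> (real ^ 'n \<Rightarrow> real) \<Rightarrow> (real ^ 'n \<Rightarrow> real) \<Rightarrow> ennreal" where
  "Lp_norm p w f = enn_powr (\<integral>\<^sup>+x. ennreal (\<bar>f x\<bar> powr p * w x) \<partial>lebesgue) (1 / p)"

definition Lp_space :: "real \<Rightarrow> (real ^ 'n \<Rightarrow> real) \<Rightarrow> (real ^ 'n \<Rightarrow> real) set" where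
  "Lp_space p w = {f \<in> borel_measurable lebesgue. Lp_norm p w f < \<infinity>}"

definition riesz_integrand :: "real \<Rightarrow> (real ^ 'n \<Rightarrow> real) \<Rightarrow> real ^ 'n \<Rightarrow> real ^ 'n \<Rightarrow> real" where
  "riesz_integrand \<alpha> g x y = g y / norm (x - y) powr (real CARD('n) - \<alpha>)"

text \<open>The Bochner integral is \<open>0\<close> by convention where the integrand is not integrable, so statements
  about the potential have to be accompanied by integrability of the integrand almost everywhere.\<close>

definition riesz_potential :: "real \<Rightarrow> (real ^ 'n \<Rightarrow> real) \<Rightarrow> real ^ 'n \<Rightarrow> real" where
  "riesz_potential \<alpha> g x = (\<integral>y. riesz_integrand \<alpha> g x y \<partial>lebesgue)"

end

theory Submission
  imports Defs
begin

text \<open>The hypothesis forces \<open>p < q\<close>. By translated dyadic grids the potential is dominated by dyadic operators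
  \<open>T f = \<Sum>Q. |Q| powr (- \<gamma>) * (\<integral>Q. f \<sigma>) * 1\<^sub>Q\<close> with \<open>\<gamma> = 1 - \<alpha> / n\<close>, for which the two-weight inequality follows
  from the testing conditions on both sides by a parallel corona decomposition.

  For testing, a Hedberg argument bounds \<open>\<Sum>Q\<subseteq>R. |Q| powr (- \<gamma>) * u(Q) * 1\<^sub>Q\<close> by
  \<open>u(R) powr \<theta> * V powr (1 - \<theta>)\<close>, where \<open>V\<close> is the maximal function \<open>sup |Q| powr (- \<tau>) * u(Q)\<close> and \<open>\<theta> > 0\<close> is small;
  \<open>p < q\<close> leaves room for it. The maximal function is a sum over the cubes that set a new record for its dyadic level.
  If half of the \<open>u\<close>-mass of a record \<open>P\<close> lies below \<open>d\<close> further generations of records, that mass sits on a set of measure at most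
  \<open>2 powr (1 - d) * |P|\<close>, and the logarithm in the bump gains a factor whose relevant power is summable in \<open>d\<close>
  because \<open>p < q\<close>. Each point has every depth at most once, so the masses of the records, weighted by the inverse of that factor, sum to at most a multiple of \<open>u(R)\<close>.\<close>

text \<open>The dyadic part works with finite families of cells and with bounds that do not depend
  on the family, so maxima and stopping cubes exist and sums need no convergence; monotone
  convergence then recovers the full grids.

  Both testing conditions are one statement, with exponent \<open>a\<close> for the bumped weight
  and \<open>b\<close> for the other one; \<open>(a, b)\<close> is \<open>(p', q)\<close> or
  \<open>(q, p')\<close>, and in both cases \<open>p < q\<close> says
  \<open>1 / a + 1 / b < 1\<close>. A bound on the product of \<open>|P| powr (- \<gamma>)\<close>,
  \<open>\<mu>(P) powr (1 / a)\<close> and \<open>\<nu>(P) powr (1 / b)\<close> alone cannot control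
  a sum over records, because nothing limits their number through a point. The logarithm to the
  power \<open>a - 1\<close> in the bump improves that bound by
  \<open>(1 + d) powr (- (1 - 1 / a))\<close>, whose power \<open>b\<close> is summable over
  \<open>d\<close> exactly when \<open>1 / a + 1 / b < 1\<close>. Since the inequality is strict, it
  also leaves an interval of exponents \<open>\<theta>\<close> to spend on the Hedberg
  estimate.\<close>

section \<open>Inequalities for sums and integrals\<close>

lemma Holder_nn_integral:
  fixes f g :: "'a \<Rightarrow> real"
  assumes p: "p > 1" "1 / p + 1 / q = 1"
    and meas: "f \<in> borel_measurable M" "g \<in> borel_measurable M"
    and nonneg: "\<And>x. 0 \<le> f x" "\<And>x. 0 \<le> g x"
    and X: "(\<integral>\<^sup>+x. ennreal (f x powr p) \<partial>M) \<le> ennreal X" "0 \<le> X"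
    and Y: "(\<integral>\<^sup>+x. ennreal (g x powr q) \<partial>M) \<le> ennreal Y" "0 \<le> Y"
  shows "(\<integral>\<^sup>+x. ennreal (f x * g x) \<partial>M) \<le> ennreal (X powr (1 / p) * Y powr (1 / q))"
proof -
  have q: "q > 1" "q \<noteq> 0"
  proof -
    have "1 / q = 1 - 1 / p" using p by simp
    moreover have "0 < 1 - 1 / p" "1 - 1 / p < 1" using p(1) by auto
    ultimately have "0 < 1 / q" "1 / q < 1" by auto
    then show "q > 1" by (simp add: field_simps)
    then show "q \<noteq> 0" by simp
  qed
  have [measurable]: "f \<in> borel_measurable M" "g \<in> borel_measurable M" by fact+
  show ?thesis
  proof (cases "X = 0 \<or> Y = 0")
    case True
    then have "AE x in M. f x * g x = 0"
    proof
      assume "X = 0"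
      then have "(\<integral>\<^sup>+x. ennreal (f x powr p) \<partial>M) = 0" using X by simp
      then have "AE x in M. ennreal (f x powr p) = 0"
        by (subst (asm) nn_integral_0_iff_AE) auto
      then show ?thesis by eventually_elim auto
    next
      assume "Y = 0"
      then have "(\<integral>\<^sup>+x. ennreal (g x powr q) \<partial>M) = 0" using Y by simp
      then have "AE x in M. ennreal (g x powr q) = 0"
        by (subst (asm) nn_integral_0_iff_AE) auto
      then show ?thesis by eventually_elim auto
    qed
    then have "AE x in M. ennreal (f x * g x) = 0" by eventually_elim auto
    then have "(\<integral>\<^sup>+x. ennreal (f x * g x) \<partial>M) = 0"
      by (subst nn_integral_0_iff_AE) auto
    then show ?thesis by simp
  next
    case False
    then have pos: "X > 0" "Y > 0" using X Y by auto
    let ?c = "X powr (1 / p) * Y powr (1 / q)"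
    have young: "f x * g x \<le> ?c * (f x powr p / (p * X) + g x powr q / (q * Y))" for x
    proof -
      have "f x / X powr (1 / p) * (g x / Y powr (1 / q))
          \<le> (f x / X powr (1 / p)) powr p / p + (g x / Y powr (1 / q)) powr q / q"
        by (rule Youngs_inequality) (use p q nonneg in auto)
      also have "\<dots> = f x powr p / (p * X) + g x powr q / (q * Y)"
        using p q pos by (simp add: powr_divide powr_powr mult.commute)
      finally show ?thesis using pos by (simp add: field_simps)
    qed
    have "(\<integral>\<^sup>+x. ennreal (f x * g x) \<partial>M)
        \<le> (\<integral>\<^sup>+x. ennreal (?c / (p * X)) * ennreal (f x powr p)
              + ennreal (?c / (q * Y)) * ennreal (g x powr q) \<partial>M)"
    proof (rule nn_integral_mono)
      fix x
      have "ennreal (f x * g x) \<le> ennreal (?c / (p * X) * f x powr p + ?c / (q * Y) * g x powr q)"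
        by (rule ennreal_leI, rule order_trans[OF young]) (simp add: field_simps)
      also have "\<dots> = ennreal (?c / (p * X)) * ennreal (f x powr p)
              + ennreal (?c / (q * Y)) * ennreal (g x powr q)"
        using p q pos by (subst ennreal_plus) (auto simp flip: ennreal_mult)
      finally show "ennreal (f x * g x) \<le> ennreal (?c / (p * X)) * ennreal (f x powr p)
              + ennreal (?c / (q * Y)) * ennreal (g x powr q)" .
    qed
    also have "\<dots> = ennreal (?c / (p * X)) * (\<integral>\<^sup>+x. ennreal (f x powr p) \<partial>M)
              + ennreal (?c / (q * Y)) * (\<integral>\<^sup>+x. ennreal (g x powr q) \<partial>M)"
      by (simp add: nn_integral_add nn_integral_cmult)
    also have "\<dots> \<le> ennreal (?c / (p * X)) * ennreal X + ennreal (?c / (q * Y)) * ennreal Y"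
      by (intro add_mono mult_left_mono X Y) auto
    also have "\<dots> = ennreal (?c / (p * X) * X + ?c / (q * Y) * Y)"
      using p q pos by (subst ennreal_plus) (auto simp flip: ennreal_mult)
    also have "?c / (p * X) * X + ?c / (q * Y) * Y = ?c * (1 / p + 1 / q)"
      using p q pos by (simp add: field_simps)
    finally show ?thesis using p by simp
  qed
qed

lemma Holder_sum:
  fixes a b :: "'i \<Rightarrow> real"
  assumes p: "p > 1" "1 / p + 1 / q = 1" and fin: "finite A"
    and nonneg: "\<And>x. 0 \<le> a x" "\<And>x. 0 \<le> b x"
  shows "(\<Sum>i\<in>A. a i * b i)
    \<le> (\<Sum>i\<in>A. a i powr p) powr (1 / p) * (\<Sum>i\<in>A. b i powr q) powr (1 / q)"
proof -
  have "(\<integral>\<^sup>+x. ennreal (a x * b x) \<partial>count_space A)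
      \<le> ennreal ((\<Sum>i\<in>A. a i powr p) powr (1 / p) * (\<Sum>i\<in>A. b i powr q) powr (1 / q))"
    by (rule Holder_nn_integral[OF p])
      (use fin nonneg in \<open>auto simp: nn_integral_count_space_finite sum_nonneg sum_ennreal\<close>)
  then show ?thesis
    using fin nonneg by (simp add: nn_integral_count_space_finite sum_ennreal)
qed

lemma sum_powr_le_powr_sum:
  fixes h :: "'i \<Rightarrow> real"
  assumes "finite A" "\<And>i. i \<in> A \<Longrightarrow> 0 \<le> h i" "1 \<le> r"
  shows "(\<Sum>i\<in>A. h i powr r) \<le> (\<Sum>i\<in>A. h i) powr r"
proof -
  let ?s = "\<Sum>i\<in>A. h i"
  have s: "0 \<le> ?s" "\<And>i. i \<in> A \<Longrightarrow> h i \<le> ?s"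
    using assms by (auto intro: sum_nonneg member_le_sum)
  have "(\<Sum>i\<in>A. h i powr r) = (\<Sum>i\<in>A. h i * h i powr (r - 1))"
    using assms by (intro sum.cong) (auto simp: powr_mult_base)
  also have "\<dots> \<le> (\<Sum>i\<in>A. h i * ?s powr (r - 1))"
    using assms s by (intro sum_mono mult_left_mono powr_mono2) auto
  also have "\<dots> = ?s * ?s powr (r - 1)" by (simp add: sum_distrib_right)
  also have "\<dots> = ?s powr r" using s by (simp add: powr_mult_base)
  finally show ?thesis .
qed

text \<open>Terms with distinct integer exponents at most \<open>m\<close> are among those of a
  geometric series with top term \<open>2 powr (c * m)\<close>. The levels of nested cubes through a
  point are such exponents.\<close>

lemma sum_powr_levels:
  fixes k :: "'i \<Rightarrow> int" and c :: real
  assumes "finite A" "inj_on k A" "\<And>a. a \<in> A \<Longrightarrow> k a \<le> m" "c > 0"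
  shows "(\<Sum>a\<in>A. 2 powr (c * k a)) \<le> 2 powr (c * m) / (1 - 2 powr (- c))"
proof -
  let ?j = "\<lambda>a. nat (m - k a)" and ?r = "2 powr (- c) :: real"
  have r: "0 < ?r" "?r < 1"
    using assms(4) powr_less_cancel_iff[of 2 "- c" 0] by auto
  have inj: "inj_on ?j A"
  proof (rule inj_onI)
    fix a b assume "a \<in> A" "b \<in> A" "?j a = ?j b"
    then have "k a = k b" using assms(3)[of a] assms(3)[of b] by auto
    then show "a = b" using assms(2) \<open>a \<in> A\<close> \<open>b \<in> A\<close> by (auto dest: inj_onD)
  qed
  have "(\<Sum>a\<in>A. 2 powr (c * k a)) = (\<Sum>a\<in>A. 2 powr (c * m) * ?r ^ ?j a)"
  proof (rule sum.cong)
    fix a assume "a \<in> A"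
    then have "real (?j a) = m - k a" using assms(3)[of a] by simp
    moreover have "?r ^ ?j a = 2 powr (- c * real (?j a))"
      by (simp flip: powr_realpow add: powr_powr)
    ultimately show "2 powr (c * k a) = 2 powr (c * m) * ?r ^ ?j a"
      by (simp flip: powr_add add: right_diff_distrib)
  qed simp
  also have "\<dots> = 2 powr (c * m) * (\<Sum>j\<in>?j ` A. ?r ^ j)"
    by (simp add: sum.reindex[OF inj] sum_distrib_left)
  also have "\<dots> \<le> 2 powr (c * m) * (\<Sum>j. ?r ^ j)"
    using r assms(1) by (intro mult_left_mono sum_le_suminf) auto
  also have "\<dots> = 2 powr (c * m) / (1 - ?r)"
    using r by (simp add: suminf_geometric)
  finally show ?thesis .
qed

section \<open>Laminar families\<close>

locale laminar =
  fixes D :: "'a set set"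
  assumes finite_D: "finite D"
    and nonempty: "{} \<notin> D"
    and nested: "\<And>P Q. P \<in> D \<Longrightarrow> Q \<in> D \<Longrightarrow> P \<inter> Q = {} \<or> P \<subseteq> Q \<or> Q \<subseteq> P"
begin

lemma comparable: "P \<in> D \<Longrightarrow> Q \<in> D \<Longrightarrow> x \<in> P \<Longrightarrow> x \<in> Q \<Longrightarrow> P \<subseteq> Q \<or> Q \<subseteq> P"
  using nested by blast

lemma subfamily: "E \<subseteq> D \<Longrightarrow> laminar E"
  using finite_D nonempty nested by (auto simp: laminar_def intro: finite_subset)

text \<open>Read from the largest member down, a member is a record when its level exceeds all
  levels met so far. For levels of averages these are the stopping cubes of a corona decomposition,
  described without recursion; for a constant level they are the maximal members.\<close>

definition records :: "('a set \<Rightarrow> int) \<Rightarrow> 'a set set" where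
  "records k = {Q \<in> D. \<forall>P\<in>D. Q \<subset> P \<longrightarrow> k P < k Q}"

lemma records_subset: "records k \<subseteq> D"
  by (auto simp: records_def)

lemma finite_records: "finite (records k)"
  using finite_D records_subset finite_subset by blast

lemma records_mono: "P \<in> records k \<Longrightarrow> Q \<in> records k \<Longrightarrow> Q \<subset> P \<Longrightarrow> k P < k Q"
  by (auto simp: records_def)

text \<open>The records through a point form a chain along which \<open>k\<close> is strictly
  monotone. This takes the place of sparseness: sums over them become sums over distinct
  integers.\<close>

lemma inj_on_records: "inj_on k {Q \<in> records k. x \<in> Q}"
proof (rule inj_onI)
  fix P Q assume *: "P \<in> {Q \<in> records k. x \<in> Q}" "Q \<in> {Q \<in> records k. x \<in> Q}" "k P = k Q"
  then have "P \<subseteq> Q \<or> Q \<subseteq> P" 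
    using comparable[of P Q x] records_subset[of k] by auto
  then show "P = Q" using * records_mono[of P k Q] records_mono[of Q k P] by auto
qed

text \<open>Take the members that contain \<open>Q\<close>, among these the ones of greatest level,
  and among these a maximal one: anything larger has a smaller level.\<close>

lemma ex_record:
  assumes "Q \<in> D"
  shows "\<exists>P\<in>records k. Q \<subseteq> P \<and> k Q \<le> k P"
proof -
  let ?A = "{P \<in> D. Q \<subseteq> P}"
  have A: "finite ?A" "Q \<in> ?A" using finite_D assms by auto
  define m where "m = Max (k ` ?A)"
  let ?B = "{P \<in> ?A. k P = m}"
  have "m \<in> k ` ?A" unfolding m_def using A by (intro Max_in) auto
  then have "?B \<noteq> {}" "finite ?B" using finite_D by auto
  then obtain P where P: "P \<in> ?B" "\<And>P'. P' \<in> ?B \<Longrightarrow> P \<subseteq> P' \<Longrightarrow> P = P'"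
    using finite_has_maximal[of ?B] by auto
  have le: "k P' \<le> m" if "P' \<in> ?A" for P' unfolding m_def using A that by auto
  have "P \<in> records k" unfolding records_def
  proof (intro CollectI conjI ballI impI)
    show "P \<in> D" using P by auto
  next
    fix P' assume P': "P' \<in> D" "P \<subset> P'"
    then have "P' \<in> ?A" using P(1) by auto
    moreover have "P' \<notin> ?B" using P(2)[of P'] P' by blast
    ultimately show "k P' < k P" using le[of P'] P(1) by auto
  qed
  then show ?thesis using P(1) le[OF A(2)] by auto
qed

text \<open>The smallest record above a member \<open>Q\<close>: the records containing a nonempty
  set form a finite chain, so the intersection is one of them. Written as an intersection it lies in
  every record around \<open>Q\<close> by definition.\<close>

definition parent :: "('a set \<Rightarrow> int) \<Rightarrow> 'a set \<Rightarrow> 'a set" where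
  "parent k Q = \<Inter>{P \<in> records k. Q \<subseteq> P}"

lemma parent:
  assumes "Q \<in> D"
  shows parent_record: "parent k Q \<in> records k" and subset_parent: "Q \<subseteq> parent k Q"
    and level_le_parent: "k Q \<le> k (parent k Q)"
proof -
  let ?A = "{P \<in> records k. Q \<subseteq> P}"
  obtain P where P: "P \<in> records k" "Q \<subseteq> P" "k Q \<le> k P" using ex_record[OF assms] by blast
  then have "?A \<noteq> {}" "finite ?A" using finite_records by auto
  then have "\<exists>R\<in>?A. \<forall>P'\<in>?A. P' \<subseteq> R \<longrightarrow> R = P'"
    using finite_has_minimal[of ?A] by simp
  then obtain R where R: "R \<in> ?A" and R_min: "\<forall>P'\<in>?A. P' \<subseteq> R \<longrightarrow> R = P'"
    by (rule bexE)
  obtain x where x: "x \<in> Q" using assms nonempty by (metis ex_in_conv)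
  have min: "R \<subseteq> P'" if "P' \<in> ?A" for P'
  proof -
    have "R \<subseteq> P' \<or> P' \<subseteq> R"
    proof (rule comparable)
      show "R \<in> D" using R(1) records_subset[of k] by blast
      show "P' \<in> D" using that records_subset[of k] by blast
      show "x \<in> R" using R(1) x by blast
      show "x \<in> P'" using that x by blast
    qed
    then show ?thesis using R_min[THEN bspec, OF that] by auto
  qed
  then have eq: "parent k Q = R" unfolding parent_def using R(1) min by (intro antisym Inter_lower Inter_greatest) auto
  show "parent k Q \<in> records k" "Q \<subseteq> parent k Q" using eq R by auto
  \<comment> \<open>Levels grow towards smaller records, so the least record above \<open>Q\<close>
    has at least the level of \<open>P\<close>.\<close>
  have "R \<subseteq> P" using P by (intro min) auto
  then have "k P \<le> k R" using records_mono[OF P(1), of R] R(1) by (cases "R = P") (auto simp: psubset_eq)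
  then show "k Q \<le> k (parent k Q)" using P eq by simp
qed

lemma parent_subset: "P \<in> records k \<Longrightarrow> Q \<subseteq> P \<Longrightarrow> parent k Q \<subseteq> P"
  by (auto simp: parent_def)

end

section \<open>Carleson embedding\<close>

lemma nn_integral_sum_indicator:
  fixes c :: "'i \<Rightarrow> real"
  assumes "finite I" "\<And>i. i \<in> I \<Longrightarrow> 0 \<le> c i" "\<And>i. i \<in> I \<Longrightarrow> E i \<in> sets M"
    "\<And>i. i \<in> I \<Longrightarrow> emeasure M (E i) < \<infinity>"
  shows "(\<integral>\<^sup>+x. ennreal (\<Sum>i\<in>I. c i * indicator (E i) x) \<partial>M) = ennreal (\<Sum>i\<in>I. c i * measure M (E i))"
proof -
  have "(\<integral>\<^sup>+x. ennreal (\<Sum>i\<in>I. c i * indicator (E i) x) \<partial>M)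
      = (\<integral>\<^sup>+x. (\<Sum>i\<in>I. ennreal (c i) * indicator (E i) x) \<partial>M)"
    using assms(2) by (intro nn_integral_cong)
      (auto simp: sum_ennreal[symmetric] ennreal_mult ennreal_indicator intro!: sum.cong)
  also have "\<dots> = (\<Sum>i\<in>I. ennreal (c i) * emeasure M (E i))"
    using assms by (subst nn_integral_sum) (auto simp: nn_integral_cmult_indicator)
  also have "\<dots> = (\<Sum>i\<in>I. ennreal (c i * measure M (E i)))"
    using assms by (intro sum.cong) (auto simp: emeasure_eq_ennreal_measure ennreal_mult less_top)
  also have "\<dots> = ennreal (\<Sum>i\<in>I. c i * measure M (E i))"
    using assms by (simp add: sum_ennreal)
  finally show ?thesis .
qed

definition average :: "'a measure \<Rightarrow> ('a \<Rightarrow> real) \<Rightarrow> 'a set \<Rightarrow> real" where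
  "average M f Q = (LINT x:Q|M. f x) / measure M Q"

definition dyadic_level :: "real \<Rightarrow> int" where
  "dyadic_level r = \<lfloor>log 2 r\<rfloor>"

lemma dyadic_level:
  assumes "0 < r"
  shows "2 powr dyadic_level r \<le> r" "r < 2 powr (dyadic_level r + 1)"
  using floor_log_eq_powr_iff[of r 2 "dyadic_level r"] assms by (auto simp: dyadic_level_def)

lemma le_dyadic_level: "2 powr (real_of_int k) \<le> r \<Longrightarrow> k \<le> dyadic_level r"
  by (auto simp: dyadic_level_def le_floor_iff le_log_iff) (smt (verit) le_log_iff powr_gt_zero)

text \<open>The factor 2 comes from keeping half of an average, one \<open>2 powr (p - 1)\<close>
  from rounding the average up to the next power of two, another from capping the levels at twice
  the function value, and the denominator from the geometric series.\<close>

definition carleson_const :: "real \<Rightarrow> real" where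
  "carleson_const p = 2 * 4 powr (p - 1) / (1 - 2 powr (- (p - 1)))"

lemma carleson_const_nonneg: "1 < p \<Longrightarrow> 0 \<le> carleson_const p"
  using powr_less_cancel_iff[of 2 "- (p - 1)" 0] by (auto simp: carleson_const_def)

text \<open>Pointwise \<open>f \<le> 1 + f powr p\<close>, and \<open>1\<close> is integrable over
  \<open>Q\<close>.\<close>

lemma set_integrable_powr:
  fixes f :: "'a \<Rightarrow> real"
  assumes "1 < p" "Q \<in> sets M" "emeasure M Q < \<infinity>" "f \<in> borel_measurable M"
    "\<And>x. 0 \<le> f x" "integrable M (\<lambda>x. f x powr p)"
  shows "integrable M (\<lambda>x. indicator Q x * f x)"
proof (rule Bochner_Integration.integrable_bound)
  show "integrable M (\<lambda>x. indicator Q x + f x powr p)"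
    using assms by (intro Bochner_Integration.integrable_add) auto
  show "(\<lambda>x. indicator Q x * f x) \<in> borel_measurable M" using assms by measurable
  have "f x \<le> 1 + f x powr p" for x
  proof (cases "f x \<le> 1")
    case False
    then have "f x powr 1 \<le> f x powr p" using assms(1) by (intro powr_mono) auto
    then show ?thesis using False by auto
  qed (auto intro: add_increasing2)
  then show "AE x in M. norm (indicator Q x * f x) \<le> norm (indicator Q x + f x powr p)"
    using assms(5) by (auto simp: indicator_def)
qed

context laminar
begin

text \<open>Here \<open>y\<close> is the value of the function at \<open>x\<close>. The truncation
  caps the levels at \<open>dyadic_level (2 * y)\<close>, and levels through \<open>x\<close> are
  distinct, so the sum of their powers is comparable to its top term, of order
  \<open>y powr (p - 1)\<close>.\<close>

lemma sum_records_powr_le: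
  assumes p: "1 < p" and y: "0 \<le> y"
  shows "(\<Sum>F\<in>records k. 2 * 2 powr ((p - 1) * (real_of_int (k F) + 1)) * (y * indicator F x
      * (if 2 powr (real_of_int (k F) - 1) < y then 1 else 0))) \<le> carleson_const p * y powr p"
proof -
  let ?S = "{F \<in> records k. x \<in> F \<and> 2 powr (real_of_int (k F) - 1) < y}"
  have r: "0 < 1 - 2 powr (- (p - 1))" using p powr_less_cancel_iff[of 2 "- (p - 1)" 0] by auto
  have "(\<Sum>F\<in>records k. 2 * 2 powr ((p - 1) * (real_of_int (k F) + 1)) * (y * indicator F x
        * (if 2 powr (real_of_int (k F) - 1) < y then 1 else 0)))
      = (\<Sum>F\<in>?S. 2 * 2 powr ((p - 1) * (real_of_int (k F) + 1)) * y)"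
    by (rule sum.mono_neutral_cong_right) (auto simp: finite_records indicator_def split: if_splits)
  also have "\<dots> = 2 * y * 2 powr (p - 1) * (\<Sum>F\<in>?S. 2 powr ((p - 1) * k F))"
    unfolding sum_distrib_left by (intro sum.cong) (auto simp: distrib_left powr_add)
  also have "\<dots> \<le> carleson_const p * y powr p"
  proof (cases "y = 0")
    case False
    then have y: "0 < y" using y by simp
    have "(\<Sum>F\<in>?S. 2 powr ((p - 1) * k F))
        \<le> 2 powr ((p - 1) * dyadic_level (2 * y)) / (1 - 2 powr (- (p - 1)))"
    proof (rule sum_powr_levels)
      show "finite ?S" using finite_records by auto
      show "inj_on k ?S" using inj_on_records[of k x] by (rule inj_on_subset) auto
      show "k F \<le> dyadic_level (2 * y)" if "F \<in> ?S" for F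
      proof (rule le_dyadic_level)
        have "2 powr real_of_int (k F) = 2 powr (real_of_int (k F) - 1) * 2 powr 1"
          using powr_add[of 2 "real_of_int (k F) - 1" 1] by simp
        then show "2 powr real_of_int (k F) \<le> 2 * y" using that by auto
      qed
    qed (use p in auto)
    also have "\<dots> \<le> (2 * y) powr (p - 1) / (1 - 2 powr (- (p - 1)))"
    proof (intro divide_right_mono)
      have "2 powr ((p - 1) * dyadic_level (2 * y)) = (2 powr dyadic_level (2 * y)) powr (p - 1)"
        by (simp add: powr_powr mult.commute)
      also have "\<dots> \<le> (2 * y) powr (p - 1)"
        using dyadic_level(1)[of "2 * y"] y p by (intro powr_mono2) auto
      finally show "2 powr ((p - 1) * dyadic_level (2 * y)) \<le> (2 * y) powr (p - 1)" .
    qed (use r in auto)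
    finally have "2 * y * 2 powr (p - 1) * (\<Sum>F\<in>?S. 2 powr ((p - 1) * k F))
        \<le> 2 * y * 2 powr (p - 1) * ((2 * y) powr (p - 1) / (1 - 2 powr (- (p - 1))))"
      using y by (intro mult_left_mono) auto
    also have "\<dots> = carleson_const p * (y * y powr (p - 1))"
    proof -
      have "(4::real) powr (p - 1) = 2 powr (p - 1) * 2 powr (p - 1)" by (simp flip: powr_mult)
      then show ?thesis by (simp add: carleson_const_def powr_mult)
    qed
    finally show ?thesis using y by (simp add: powr_mult_base)
  qed simp
  finally show ?thesis .
qed

text \<open>The average of \<^term>\<open>f\<close> over a record \<^term>\<open>F\<close> is at least twice the truncation level, so
  the part of \<^term>\<open>f\<close> above that level carries half of the average. Records through
  a point have distinct levels, hence the resulting sum is geometric.\<close>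

lemma carleson_records:
  assumes p: "1 < p" and D: "D \<subseteq> sets M" "\<And>Q. Q \<in> D \<Longrightarrow> emeasure M Q < \<infinity>"
    and f: "f \<in> borel_measurable M" "\<And>x. 0 \<le> f x" "integrable M (\<lambda>x. f x powr p)"
    and pos: "\<And>Q. Q \<in> D \<Longrightarrow> 0 < average M f Q"
  defines "k \<equiv> \<lambda>Q. dyadic_level (average M f Q)"
  shows "(\<Sum>F\<in>records k. average M f F powr p * measure M F)
    \<le> carleson_const p * (LINT x|M. f x powr p)"
proof -
  let ?h = "\<lambda>F x. f x * indicator F x * (if 2 powr (real_of_int (k F) - 1) < f x then 1 else 0)"
  have intF: "integrable M (\<lambda>x. indicator F x * f x)" if "F \<in> D" for F
    using that p D f by (intro set_integrable_powr[where p = p]) auto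
  have inth: "integrable M (?h F)" if "F \<in> D" for F
  proof (rule Bochner_Integration.integrable_bound[OF intF[OF that]])
    have [measurable]: "f \<in> borel_measurable M" "F \<in> sets M" using f that D by auto
    show "?h F \<in> borel_measurable M" by measurable
  qed (auto simp: indicator_def)
  have step: "average M f F powr p * measure M F
      \<le> 2 * 2 powr ((p - 1) * (real_of_int (k F) + 1)) * (LINT x|M. ?h F x)" if "F \<in> records k" for F
  proof -
    have F: "F \<in> D" using that records_subset by auto
    let ?A = "average M f F" and ?w = "measure M F" and ?c = "2 powr (real_of_int (k F) - 1)"
    have A: "0 < ?A" using pos F by auto
    \<comment> \<open>A quotient by zero is zero, so a positive average excludes a null set.\<close>
    then have w: "0 < ?w" by (auto simp: average_def zero_less_measure_iff)
    have k: "2 powr k F \<le> ?A" "?A < 2 powr (real_of_int (k F) + 1)" using dyadic_level[OF A] by (auto simp: k_def)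
    have c: "2 * ?c \<le> ?A"
    proof -
      have "2 powr real_of_int (k F) = 2 powr (real_of_int (k F) - 1) * 2 powr 1"
          using powr_add[of 2 "real_of_int (k F) - 1" 1] by simp
      then show ?thesis using k(1) by auto
    qed
    have "?A * ?w = (LINT x|M. indicator F x * f x)"
      using w by (simp add: average_def set_lebesgue_integral_def)
    also have "\<dots> \<le> (LINT x|M. ?h F x + ?c * indicator F x)"
    proof (rule integral_mono)
      show "integrable M (\<lambda>x. ?h F x + ?c * indicator F x)"
        using F D by (intro Bochner_Integration.integrable_add inth) auto
    qed (use F intF in \<open>auto simp: indicator_def\<close>)
    also have "\<dots> = (LINT x|M. ?h F x) + ?c * ?w"
      using F D by (subst Bochner_Integration.integral_add) (auto intro!: inth)
    finally have "?A * ?w \<le> (LINT x|M. ?h F x) + ?c * ?w" .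
    moreover have "2 * ?c * ?w \<le> ?A * ?w" using c w by (intro mult_right_mono) auto
    ultimately have half: "?A * ?w \<le> 2 * (LINT x|M. ?h F x)" by linarith
    have "?A powr p * ?w = ?A powr (p - 1) * (?A * ?w)"
      using A by (simp add: powr_mult_base flip: mult.assoc mult.commute[of ?A])
    also have "\<dots> \<le> 2 powr ((p - 1) * (real_of_int (k F) + 1)) * (2 * (LINT x|M. ?h F x))"
    proof (rule mult_mono[OF _ half])
      have "?A powr (p - 1) \<le> (2 powr (real_of_int (k F) + 1)) powr (p - 1)"
        using A k p by (intro powr_mono2) auto
      then show "?A powr (p - 1) \<le> 2 powr ((p - 1) * (real_of_int (k F) + 1))"
        by (simp add: powr_powr mult.commute)
    qed (use A w in auto)
    finally show ?thesis by (simp add: mult_ac)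
  qed
  have "(\<Sum>F\<in>records k. average M f F powr p * measure M F)
      \<le> (\<Sum>F\<in>records k. 2 * 2 powr ((p - 1) * (real_of_int (k F) + 1)) * (LINT x|M. ?h F x))"
    by (intro sum_mono step)
  also have "\<dots> = (LINT x|M. (\<Sum>F\<in>records k. 2 * 2 powr ((p - 1) * (real_of_int (k F) + 1)) * ?h F x))"
    using records_subset[of k] by (subst Bochner_Integration.integral_sum) (auto intro!: inth)
  also have "\<dots> \<le> (LINT x|M. carleson_const p * f x powr p)"
  proof (rule integral_mono)
    show "integrable M (\<lambda>x. \<Sum>F\<in>records k. 2 * 2 powr ((p - 1) * (real_of_int (k F) + 1)) * ?h F x)"
      using records_subset[of k] by (intro Bochner_Integration.integrable_sum integrable_mult_right inth) auto
    show "integrable M (\<lambda>x. carleson_const p * f x powr p)" using f by auto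
  qed (use sum_records_powr_le[OF p] f in auto)
  finally show ?thesis by simp
qed

end

section \<open>Parallel corona decomposition\<close>

context laminar
begin

text \<open>Averages over \<open>Q\<close> are replaced by twice those over the stopping parents,
  and the sum is grouped by the parent \<open>P\<close> for \<open>f\<close>. In each group the
  averages of \<open>g\<close> are dominated by one function built from the stopping cubes of
  \<open>g\<close> assigned to \<open>P\<close>, so Hoelder and testing on \<open>P\<close> apply. A
  second Hoelder inequality over \<open>P\<close> leaves two Carleson sums; the one for
  \<open>g\<close> appears with a power \<open>p' / q'\<close>, which \<open>p \<le> q\<close> makes
  at least 1.\<close>

lemma corona_half:
  fixes \<sigma> \<mu> :: "'a measure" and f g :: "'a \<Rightarrow> real" and lam :: "'a set \<Rightarrow> real"
  assumes p: "1 < p" "1 / p + 1 / p' = 1" and q: "1 < q" "1 / q + 1 / q' = 1" and "p \<le> q"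
    and D: "D \<subseteq> sets \<sigma>" "D \<subseteq> sets \<mu>" "\<And>Q. Q \<in> D \<Longrightarrow> emeasure \<sigma> Q < \<infinity>"
      "\<And>Q. Q \<in> D \<Longrightarrow> emeasure \<mu> Q < \<infinity>"
    and f: "f \<in> borel_measurable \<sigma>" "\<And>x. 0 \<le> f x" "integrable \<sigma> (\<lambda>x. f x powr p)"
    and g: "g \<in> borel_measurable \<mu>" "\<And>x. 0 \<le> g x" "integrable \<mu> (\<lambda>x. g x powr q')"
    and pos: "\<And>Q. Q \<in> D \<Longrightarrow> 0 < average \<sigma> f Q" "\<And>Q. Q \<in> D \<Longrightarrow> 0 < average \<mu> g Q"
    and lam: "\<And>Q. 0 \<le> lam Q" and K: "0 \<le> K"
    and testing: "\<And>R. R \<in> D \<Longrightarrow>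
      (\<integral>\<^sup>+x. ennreal ((\<Sum>Q | Q \<in> D \<and> Q \<subseteq> R. lam Q * measure \<sigma> Q * indicator Q x) powr q) \<partial>\<mu>)
        \<le> ennreal (K powr q * measure \<sigma> R powr (q / p))"
  defines "k \<equiv> \<lambda>Q. dyadic_level (average \<sigma> f Q)" and "l \<equiv> \<lambda>Q. dyadic_level (average \<mu> g Q)"
  shows "(\<Sum>Q | Q \<in> D \<and> parent l Q \<subseteq> parent k Q. lam Q * (LINT x:Q|\<sigma>. f x) * (LINT x:Q|\<mu>. g x))
    \<le> 4 * K * (carleson_const p * (LINT x|\<sigma>. f x powr p)) powr (1 / p)
        * (carleson_const q' * (LINT x|\<mu>. g x powr q')) powr (1 / q')"
proof -
  let ?A = "average \<sigma> f" and ?B = "average \<mu> g"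
  let ?F = "parent k" and ?G = "parent l"
  have "1 / q' = 1 - 1 / q" "1 / p' = 1 - 1 / p" "1 / q \<le> 1 / p"
    using p q \<open>p \<le> q\<close> by (auto simp: frac_le)
  moreover have "0 < 1 - 1 / q" "1 - 1 / q < 1" "0 < 1 - 1 / p" "1 - 1 / p < 1"
    using p q by auto
  ultimately have *: "0 < 1 / q'" "1 / q' < 1" "0 < 1 / p'" "1 / p' < 1" "1 / p' \<le> 1 / q'"
    by linarith+
  then have q': "1 < q'" and p': "1 < p'" "q' \<le> p'" by (auto simp: field_simps)
  have w: "0 < measure \<sigma> Q" "0 < measure \<mu> Q" if "Q \<in> D" for Q
    using pos[OF that] by (auto simp: average_def zero_less_measure_iff)
  have int: "(LINT x:Q|\<sigma>. f x) = ?A Q * measure \<sigma> Q" "(LINT x:Q|\<mu>. g x) = ?B Q * measure \<mu> Q"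
    if "Q \<in> D" for Q
    using w[OF that] by (auto simp: average_def)
  have le_parent: "h Q \<le> 2 * h (parent (\<lambda>Q. dyadic_level (h Q)) Q)"
    if "Q \<in> D" "\<And>Q. Q \<in> D \<Longrightarrow> 0 < h Q" for h :: "'a set \<Rightarrow> real" and Q
  proof -
    let ?l = "\<lambda>Q. dyadic_level (h Q)"
    have P: "parent ?l Q \<in> D" "?l Q \<le> ?l (parent ?l Q)"
      using parent_record[OF that(1), of ?l] level_le_parent[OF that(1), of ?l]
        records_subset[of ?l] by auto
    have "h Q \<le> 2 powr (?l Q + 1)" using dyadic_level(2)[of "h Q"] that by simp
    also have "\<dots> \<le> 2 powr (?l (parent ?l Q) + 1)" using P(2) by simp
    also have "\<dots> = 2 * 2 powr (?l (parent ?l Q))" by (simp add: powr_add)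
    also have "\<dots> \<le> 2 * h (parent ?l Q)" using dyadic_level(1)[of "h (parent ?l Q)"] that P by simp
    finally show ?thesis .
  qed
  have F: "?F Q \<in> records k" "?F Q \<in> D" "Q \<subseteq> ?F Q" "?A Q \<le> 2 * ?A (?F Q)"
    and G: "?G Q \<in> records l" "?G Q \<in> D" "Q \<subseteq> ?G Q" "?B Q \<le> 2 * ?B (?G Q)" if "Q \<in> D" for Q
    using parent_record[OF that] subset_parent[OF that] records_subset[of k] records_subset[of l]
      le_parent[OF that, of ?A] le_parent[OF that, of ?B] pos unfolding k_def l_def by blast+
  have A_nonneg: "0 \<le> ?A P" if "P \<in> records k" for P
    using pos(1)[of P] that records_subset[of k] by (auto intro: less_imp_le)
  let ?E = "\<lambda>P. {Q \<in> D. ?G Q \<subseteq> ?F Q \<and> ?F Q = P}"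
  let ?H = "\<lambda>P. {R \<in> records l. ?F R = P}"
  let ?h = "\<lambda>P. \<Sum>R\<in>?H P. ?B R powr q' * measure \<mu> R"
  have h_nonneg: "0 \<le> ?h P" for P by (intro sum_nonneg) auto
  have inner: "(\<Sum>Q\<in>?E P. lam Q * measure \<sigma> Q * ?B (?G Q) * measure \<mu> Q)
      \<le> K * measure \<sigma> P powr (1 / p) * ?h P powr (1 / q')" if P: "P \<in> records k" for P
  proof -
    have PD: "P \<in> D" using P records_subset by auto
    let ?T = "\<lambda>x. \<Sum>Q | Q \<in> D \<and> Q \<subseteq> P. lam Q * measure \<sigma> Q * indicator Q x :: real"
    \<comment> \<open>A sum of \<open>q'\<close>-th powers in place of a supremum: it dominates
      every average it contains, and its \<open>q'\<close>-th power integrates to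
      \<open>?h P\<close>.\<close>
    let ?g = "\<lambda>x. (\<Sum>R\<in>?H P. ?B R powr q' * indicator R x) powr (1 / q')"
    have fin: "finite (?E P)" "finite (?H P)" using finite_D finite_records by auto
    have g_ge: "?B (?G Q) \<le> ?g x" if "Q \<in> ?E P" "x \<in> Q" for Q x
    proof -
      have Q: "Q \<in> D" using that by auto
      \<comment> \<open>\<open>?G Q\<close> lies between \<open>Q\<close> and
        \<open>?F Q = P\<close>, so the smallest record of \<open>k\<close> around it is again
        \<open>P\<close>. This is where the restriction to
        \<open>parent l Q \<subseteq> parent k Q\<close> is used.\<close>
      have "?F (?G Q) = P"
      proof
        show "?F (?G Q) \<subseteq> P" using that by (intro parent_subset[OF P]) auto
        have "Q \<subseteq> ?F (?G Q)" using F(3)[OF G(2)[OF Q]] G(3)[OF Q] by blast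
        then have "?F Q \<subseteq> ?F (?G Q)" by (rule parent_subset[OF F(1)[OF G(2)[OF Q]]])
        then show "P \<subseteq> ?F (?G Q)" using that by auto
      qed
      then have "?G Q \<in> ?H P" "x \<in> ?G Q" using G(1)[OF Q] G(3)[OF Q] that(2) by blast+
      then have "?B (?G Q) powr q' * indicator (?G Q) x \<le> (\<Sum>R\<in>?H P. ?B R powr q' * indicator R x)"
        using fin by (intro member_le_sum) auto
      then have "(?B (?G Q) powr q') powr (1 / q') \<le> ?g x"
        using \<open>x \<in> ?G Q\<close> q' by (intro powr_mono2) auto
      then show ?thesis using q' pos(2)[OF G(2)[OF Q]] by (simp add: powr_powr)
    qed
    have T_nonneg: "0 \<le> ?T x" for x using lam by (intro sum_nonneg) auto
    have "ennreal (\<Sum>Q\<in>?E P. lam Q * measure \<sigma> Q * ?B (?G Q) * measure \<mu> Q)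
        = (\<integral>\<^sup>+x. ennreal (\<Sum>Q\<in>?E P. lam Q * measure \<sigma> Q * ?B (?G Q) * indicator Q x) \<partial>\<mu>)"
      using fin D lam less_imp_le[OF pos(2)[OF G(2)]]
      by (intro nn_integral_sum_indicator[symmetric]) auto
    also have "\<dots> \<le> (\<integral>\<^sup>+x. ennreal (?T x * ?g x) \<partial>\<mu>)"
    proof (intro nn_integral_mono ennreal_leI)
      fix x
      have "(\<Sum>Q\<in>?E P. lam Q * measure \<sigma> Q * ?B (?G Q) * indicator Q x)
          \<le> (\<Sum>Q\<in>?E P. lam Q * measure \<sigma> Q * indicator Q x * ?g x)"
      proof (rule sum_mono)
        fix Q assume Q: "Q \<in> ?E P"
        show "lam Q * measure \<sigma> Q * ?B (?G Q) * indicator Q x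
            \<le> lam Q * measure \<sigma> Q * indicator Q x * ?g x"
        proof (cases "x \<in> Q")
          case True
          then show ?thesis using g_ge[OF Q True] lam by (auto intro!: mult_left_mono)
        qed simp
      qed
      also have "\<dots> \<le> (\<Sum>Q | Q \<in> D \<and> Q \<subseteq> P. lam Q * measure \<sigma> Q * indicator Q x * ?g x)"
      proof (rule sum_mono2)
        show "?E P \<subseteq> {Q \<in> D. Q \<subseteq> P}" using F(3) by blast
      qed (use finite_D lam in auto)
      also have "\<dots> = ?T x * ?g x" by (rule sum_distrib_right[symmetric])
      finally show "(\<Sum>Q\<in>?E P. lam Q * measure \<sigma> Q * ?B (?G Q) * indicator Q x) \<le> ?T x * ?g x" .
    qed
    also have "\<dots> \<le> ennreal ((K powr q * measure \<sigma> P powr (q / p)) powr (1 / q) * ?h P powr (1 / q'))"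
    proof (rule Holder_nn_integral[OF q])
      have ind: "(\<lambda>x. c * indicator Q x :: real) \<in> borel_measurable \<mu>" if "Q \<in> D" for c Q
        using D that by (intro borel_measurable_times borel_measurable_const borel_measurable_indicator) auto
      show "?T \<in> borel_measurable \<mu>" by (intro borel_measurable_sum ind) simp
      show "?g \<in> borel_measurable \<mu>"
        using records_subset[of l]
        by (intro powr_real_measurable borel_measurable_sum borel_measurable_const ind) blast
      show "(\<integral>\<^sup>+x. ennreal (?T x powr q) \<partial>\<mu>) \<le> ennreal (K powr q * measure \<sigma> P powr (q / p))"
        by (rule testing[OF PD])
      have "(\<integral>\<^sup>+x. ennreal (?g x powr q') \<partial>\<mu>)
          = (\<integral>\<^sup>+x. ennreal (\<Sum>R\<in>?H P. ?B R powr q' * indicator R x) \<partial>\<mu>)"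
        using q' by (intro nn_integral_cong) (simp add: powr_powr sum_nonneg)
      also have "\<dots> = ennreal (?h P)"
        using fin D records_subset[of l] by (intro nn_integral_sum_indicator) auto
      finally show "(\<integral>\<^sup>+x. ennreal (?g x powr q') \<partial>\<mu>) \<le> ennreal (?h P)" by simp
    qed (use T_nonneg h_nonneg in auto)
    also have "(K powr q * measure \<sigma> P powr (q / p)) powr (1 / q) = K * measure \<sigma> P powr (1 / p)"
      using q K by (simp add: powr_mult powr_powr)
    finally show ?thesis
      using K h_nonneg by (subst (asm) ennreal_le_iff) auto
  qed
  have "(\<Sum>Q | Q \<in> D \<and> ?G Q \<subseteq> ?F Q. lam Q * (LINT x:Q|\<sigma>. f x) * (LINT x:Q|\<mu>. g x))
      \<le> (\<Sum>Q | Q \<in> D \<and> ?G Q \<subseteq> ?F Q. 4 * (?A (?F Q) * (lam Q * measure \<sigma> Q * ?B (?G Q) * measure \<mu> Q)))"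
  proof (rule sum_mono)
    fix Q assume "Q \<in> {Q \<in> D. ?G Q \<subseteq> ?F Q}"
    then have Q: "Q \<in> D" by auto
    have "lam Q * (LINT x:Q|\<sigma>. f x) * (LINT x:Q|\<mu>. g x)
        = (lam Q * measure \<sigma> Q * measure \<mu> Q) * (?A Q * ?B Q)"
      using int[OF Q] by simp
    also have "\<dots> \<le> (lam Q * measure \<sigma> Q * measure \<mu> Q) * ((2 * ?A (?F Q)) * (2 * ?B (?G Q)))"
      using F[OF Q] G[OF Q] pos[OF Q] pos[OF F(2)[OF Q]] lam
      by (intro mult_left_mono mult_mono) auto
    finally show "lam Q * (LINT x:Q|\<sigma>. f x) * (LINT x:Q|\<mu>. g x)
        \<le> 4 * (?A (?F Q) * (lam Q * measure \<sigma> Q * ?B (?G Q) * measure \<mu> Q))"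
      by (simp add: mult_ac)
  qed
  also have "\<dots> = (\<Sum>P\<in>records k. \<Sum>Q\<in>?E P.
      4 * (?A (?F Q) * (lam Q * measure \<sigma> Q * ?B (?G Q) * measure \<mu> Q)))"
  proof -
    have "?E P = {Q \<in> {Q \<in> D. ?G Q \<subseteq> ?F Q}. ?F Q = P}" for P by auto
    then show ?thesis
      using finite_D finite_records F by (simp only:) (intro sum.group[symmetric]; auto)
  qed
  also have "\<dots> = 4 * (\<Sum>P\<in>records k. ?A P * (\<Sum>Q\<in>?E P. lam Q * measure \<sigma> Q * ?B (?G Q) * measure \<mu> Q))"
    by (simp add: sum_distrib_left)
  also have "\<dots> \<le> 4 * (\<Sum>P\<in>records k. ?A P * (K * measure \<sigma> P powr (1 / p) * ?h P powr (1 / q')))"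
    using inner A_nonneg by (intro mult_left_mono sum_mono) auto
  \<comment> \<open>\<open>Holder_sum\<close> asks for nonnegative functions also outside the index
    set, hence the absolute value.\<close>
  also have "\<dots> = 4 * K * (\<Sum>P\<in>records k. \<bar>?A P\<bar> * measure \<sigma> P powr (1 / p) * ?h P powr (1 / q'))"
    unfolding sum_distrib_left using A_nonneg by (intro sum.cong refl) (simp add: mult_ac)
  also have "\<dots> \<le> 4 * K * ((\<Sum>P\<in>records k. (\<bar>?A P\<bar> * measure \<sigma> P powr (1 / p)) powr p) powr (1 / p)
      * (\<Sum>P\<in>records k. (?h P powr (1 / q')) powr p') powr (1 / p'))"
    using K by (intro mult_left_mono Holder_sum p finite_records) auto
  also have "(\<Sum>P\<in>records k. (\<bar>?A P\<bar> * measure \<sigma> P powr (1 / p)) powr p)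
      = (\<Sum>P\<in>records k. ?A P powr p * measure \<sigma> P)"
    using p A_nonneg by (intro sum.cong refl) (simp add: powr_mult powr_powr)
  also have "(\<Sum>P\<in>records k. (?h P powr (1 / q')) powr p') = (\<Sum>P\<in>records k. ?h P powr (p' / q'))"
    by (simp add: powr_powr)
  also have "4 * K * ((\<Sum>P\<in>records k. ?A P powr p * measure \<sigma> P) powr (1 / p)
        * (\<Sum>P\<in>records k. ?h P powr (p' / q')) powr (1 / p'))
      \<le> 4 * K * ((carleson_const p * (LINT x|\<sigma>. f x powr p)) powr (1 / p)
        * (carleson_const q' * (LINT x|\<mu>. g x powr q')) powr (1 / q'))"
  proof (intro mult_left_mono mult_mono)
    show "(\<Sum>P\<in>records k. ?A P powr p * measure \<sigma> P) powr (1 / p)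
        \<le> (carleson_const p * (LINT x|\<sigma>. f x powr p)) powr (1 / p)"
      unfolding k_def using p D f pos by (intro powr_mono2 carleson_records sum_nonneg) auto
    \<comment> \<open>Every record of \<open>l\<close> is assigned to exactly one \<open>P\<close>,
      so the groups add up to the full sum.\<close>
    have "(\<Sum>P\<in>records k. ?h P) = (\<Sum>R\<in>records l. ?B R powr q' * measure \<mu> R)"
      using finite_records F(1) records_subset[of l] by (intro sum.group) auto
    also have "\<dots> \<le> carleson_const q' * (LINT x|\<mu>. g x powr q')"
      unfolding l_def using q' D g pos by (intro carleson_records) auto
    finally have h_le: "(\<Sum>P\<in>records k. ?h P) \<le> carleson_const q' * (LINT x|\<mu>. g x powr q')" .
    \<comment> \<open>From \<open>p \<le> q\<close> follows \<open>q' \<le> p'\<close>, so a sum of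
      powers with exponent \<open>p' / q'\<close> is at most the power of the sum.\<close>
    have "(\<Sum>P\<in>records k. ?h P powr (p' / q')) powr (1 / p')
        \<le> ((\<Sum>P\<in>records k. ?h P) powr (p' / q')) powr (1 / p')"
      using p' q' h_nonneg
      by (intro powr_mono2 sum_powr_le_powr_sum sum_nonneg finite_records) auto
    also have "\<dots> = (\<Sum>P\<in>records k. ?h P) powr (1 / q')"
      using p' by (simp add: powr_powr)
    also have "\<dots> \<le> (carleson_const q' * (LINT x|\<mu>. g x powr q')) powr (1 / q')"
      using h_le q' h_nonneg by (intro powr_mono2 sum_nonneg) auto
    finally show "(\<Sum>P\<in>records k. ?h P powr (p' / q')) powr (1 / p')
        \<le> (carleson_const q' * (LINT x|\<mu>. g x powr q')) powr (1 / q')" .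
  qed (use K in auto)
  finally show ?thesis by (simp add: mult.assoc)
qed

end

section \<open>Hedberg estimate and depth\<close>

text \<open>One geometric series for the cubes up to the critical size, one for the larger
  cubes.\<close>

definition hedberg_const :: "real \<Rightarrow> real \<Rightarrow> real" where
  "hedberg_const \<gamma> \<tau> = 2 powr (\<tau> - \<gamma>) / (1 - 2 powr (- (\<tau> - \<gamma>))) + 2 powr \<gamma> / (1 - 2 powr (- \<gamma>))"

context laminar
begin

lemma inj_on_dyadic_level:
  fixes sz :: "'a set \<Rightarrow> real"
  assumes pos: "\<And>Q. Q \<in> D \<Longrightarrow> 0 < sz Q"
    and dbl: "\<And>P Q. P \<in> D \<Longrightarrow> Q \<in> D \<Longrightarrow> Q \<subset> P \<Longrightarrow> 2 * sz Q \<le> sz P"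
  shows "inj_on (\<lambda>Q. dyadic_level (sz Q)) {Q \<in> D. x \<in> Q}"
proof -
  have lt: "dyadic_level (sz Q) < dyadic_level (sz P)" if "P \<in> D" "Q \<in> D" "Q \<subset> P" for P Q
  proof -
    have "2 powr (dyadic_level (sz Q) + 1) = 2 powr dyadic_level (sz Q) * 2 powr 1"
      using powr_add[of 2 "dyadic_level (sz Q)" 1] by simp
    also have "\<dots> \<le> 2 * sz Q" using dyadic_level(1)[OF pos[OF that(2)]] by simp
    also have "\<dots> \<le> sz P" by (rule dbl) fact+
    finally have "dyadic_level (sz Q) + 1 \<le> dyadic_level (sz P)"
      by (intro le_dyadic_level) simp
    then show ?thesis by simp
  qed
  show ?thesis
  proof (rule inj_onI)
    fix P Q assume *: "P \<in> {Q \<in> D. x \<in> Q}" "Q \<in> {Q \<in> D. x \<in> Q}"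
      and eq: "dyadic_level (sz P) = dyadic_level (sz Q)"
    then have "P \<subseteq> Q \<or> Q \<subseteq> P" using comparable[of P Q x] by auto
    then show "P = Q" using lt[of P Q] lt[of Q P] * eq by auto
  qed
qed

text \<open>The two bounds on \<open>\<mu> Q\<close> agree at the size
  \<open>\<rho> = (m / V) powr (1 / \<tau>)\<close>. Below it the bound by \<open>V\<close> leaves
  positive powers \<open>\<tau> - \<gamma>\<close> of the sizes, above it the bound by
  \<open>m\<close> leaves negative powers \<open>- \<gamma>\<close>; sizes through \<open>x\<close>
  at least double, so both sums are geometric and dominated by their value at
  \<open>\<rho>\<close>.\<close>

lemma hedberg:
  fixes sz \<mu> :: "'a set \<Rightarrow> real"
  assumes pos: "\<And>Q. Q \<in> D \<Longrightarrow> 0 < sz Q"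
    and dbl: "\<And>P Q. P \<in> D \<Longrightarrow> Q \<in> D \<Longrightarrow> Q \<subset> P \<Longrightarrow> 2 * sz Q \<le> sz P"
    and \<gamma>: "0 < \<gamma>" "\<gamma> < \<tau>" and mV: "0 < m" "0 < V"
    and le: "\<And>Q. Q \<in> D \<Longrightarrow> x \<in> Q \<Longrightarrow> \<mu> Q \<le> m" "\<And>Q. Q \<in> D \<Longrightarrow> x \<in> Q \<Longrightarrow> \<mu> Q \<le> V * sz Q powr \<tau>"
  shows "(\<Sum>Q | Q \<in> D \<and> x \<in> Q. sz Q powr (- \<gamma>) * \<mu> Q)
    \<le> hedberg_const \<gamma> \<tau> * m powr (1 - \<gamma> / \<tau>) * V powr (\<gamma> / \<tau>)"
proof -
  define \<rho> where "\<rho> = (m / V) powr (1 / \<tau>)"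
  have \<rho>: "0 < \<rho>" using mV by (simp add: \<rho>_def)
  let ?k = "\<lambda>Q. dyadic_level (sz Q)"
  let ?X = "{Q \<in> D. x \<in> Q}"
  let ?S = "{Q \<in> ?X. sz Q \<le> \<rho>}" and ?L = "{Q \<in> ?X. \<rho> < sz Q}"
  have fin: "finite ?S" "finite ?L" using finite_D by auto
  have inj: "inj_on ?k ?X" by (rule inj_on_dyadic_level[OF pos dbl])
  have r: "0 < 1 - 2 powr (- c)" if "0 < c" for c :: real
    using that powr_less_cancel_iff[of 2 "- c" 0] by auto
  have small: "(\<Sum>Q\<in>?S. sz Q powr c) \<le> 2 powr c * \<rho> powr c / (1 - 2 powr (- c))" if c: "0 < c" for c
  proof -
    have "(\<Sum>Q\<in>?S. sz Q powr c) \<le> (\<Sum>Q\<in>?S. 2 powr c * 2 powr (c * ?k Q))"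
    proof (rule sum_mono)
      fix Q assume "Q \<in> ?S"
      then have "0 < sz Q" using pos by auto
      then have "sz Q powr c \<le> (2 powr (?k Q + 1)) powr c"
        using dyadic_level(2)[of "sz Q"] c by (intro powr_mono2) auto
      then show "sz Q powr c \<le> 2 powr c * 2 powr (c * ?k Q)"
        by (simp add: powr_powr powr_add[symmetric] algebra_simps)
    qed
    also have "\<dots> \<le> 2 powr c * (2 powr (c * dyadic_level \<rho>) / (1 - 2 powr (- c)))"
      unfolding sum_distrib_left[symmetric]
    proof (intro mult_left_mono sum_powr_levels)
      show "inj_on ?k ?S" using inj by (rule inj_on_subset) auto
      show "?k Q \<le> dyadic_level \<rho>" if "Q \<in> ?S" for Q
        using that pos[of Q] dyadic_level(1)[of "sz Q"] by (intro le_dyadic_level) auto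
    qed (use fin c in auto)
    also have "\<dots> \<le> 2 powr c * (\<rho> powr c / (1 - 2 powr (- c)))"
    proof (intro mult_left_mono divide_right_mono)
      have "2 powr (c * dyadic_level \<rho>) = (2 powr dyadic_level \<rho>) powr c"
        by (simp add: powr_powr mult.commute)
      also have "\<dots> \<le> \<rho> powr c" using dyadic_level(1)[OF \<rho>] c by (intro powr_mono2) auto
      finally show "2 powr (c * dyadic_level \<rho>) \<le> \<rho> powr c" .
    qed (use r[OF c] in auto)
    finally show ?thesis by simp
  qed
  have large: "(\<Sum>Q\<in>?L. sz Q powr (- c)) \<le> 2 powr c * \<rho> powr (- c) / (1 - 2 powr (- c))" if c: "0 < c" for c
  proof -
    have "(\<Sum>Q\<in>?L. sz Q powr (- c)) \<le> (\<Sum>Q\<in>?L. 2 powr (c * real_of_int (- ?k Q)))"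
    proof (rule sum_mono)
      fix Q assume "Q \<in> ?L"
      then have "0 < sz Q" using pos by auto
      then have "sz Q powr (- c) \<le> (2 powr (?k Q)) powr (- c)"
        using dyadic_level(1)[of "sz Q"] c by (intro powr_mono2') auto
      then show "sz Q powr (- c) \<le> 2 powr (c * real_of_int (- ?k Q))"
        by (simp add: powr_powr mult.commute)
    qed
    also have "\<dots> \<le> 2 powr (c * real_of_int (- dyadic_level \<rho>)) / (1 - 2 powr (- c))"
    proof (intro sum_powr_levels)
      have "inj_on ?k ?L" using inj by (rule inj_on_subset) auto
      then show "inj_on (\<lambda>Q. - ?k Q) ?L" by (auto simp: inj_on_def)
      show "- ?k Q \<le> - dyadic_level \<rho>" if "Q \<in> ?L" for Q
        using that \<rho> dyadic_level(1)[of \<rho>] by (auto intro!: le_dyadic_level)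
    qed (use fin c in auto)
    also have "\<dots> \<le> (2 powr c * \<rho> powr (- c)) / (1 - 2 powr (- c))"
    proof (intro divide_right_mono)
      have "\<rho> powr c \<le> (2 powr (dyadic_level \<rho> + 1)) powr c"
        using dyadic_level(2)[OF \<rho>] c \<rho> by (intro powr_mono2) auto
      also have "\<dots> = 2 powr c * 2 powr (c * dyadic_level \<rho>)"
        by (simp add: powr_powr powr_add[symmetric] algebra_simps)
      finally have "\<rho> powr c \<le> 2 powr c * 2 powr (c * dyadic_level \<rho>)" .
      then show "2 powr (c * real_of_int (- dyadic_level \<rho>)) \<le> 2 powr c * \<rho> powr (- c)"
        using \<rho> by (simp add: powr_minus field_simps)
    qed (use r[OF c] in auto)
    finally show ?thesis .
  qed
  have "(\<Sum>Q\<in>?X. sz Q powr (- \<gamma>) * \<mu> Q)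
      = (\<Sum>Q\<in>?S. sz Q powr (- \<gamma>) * \<mu> Q) + (\<Sum>Q\<in>?L. sz Q powr (- \<gamma>) * \<mu> Q)"
    using finite_D by (subst sum.union_disjoint[symmetric]) (auto intro!: sum.cong)
  also have "(\<Sum>Q\<in>?S. sz Q powr (- \<gamma>) * \<mu> Q) \<le> (\<Sum>Q\<in>?S. V * sz Q powr (\<tau> - \<gamma>))"
  proof (rule sum_mono)
    fix Q assume "Q \<in> ?S"
    then have "sz Q powr (- \<gamma>) * \<mu> Q \<le> sz Q powr (- \<gamma>) * (V * sz Q powr \<tau>)"
      using le by (intro mult_left_mono) auto
    then show "sz Q powr (- \<gamma>) * \<mu> Q \<le> V * sz Q powr (\<tau> - \<gamma>)"
      by (simp add: powr_diff powr_minus_divide mult_ac)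
  qed
  also have "\<dots> \<le> V * (2 powr (\<tau> - \<gamma>) * \<rho> powr (\<tau> - \<gamma>) / (1 - 2 powr (- (\<tau> - \<gamma>))))"
    unfolding sum_distrib_left[symmetric] using mV \<gamma> by (intro mult_left_mono small) auto
  also have "\<dots> = 2 powr (\<tau> - \<gamma>) / (1 - 2 powr (- (\<tau> - \<gamma>))) * (m powr (1 - \<gamma> / \<tau>) * V powr (\<gamma> / \<tau>))"
  proof -
    have "(\<tau> - \<gamma>) / \<tau> = 1 - \<gamma> / \<tau>" using \<gamma> by (simp add: field_simps)
    then have "\<rho> powr (\<tau> - \<gamma>) = (m / V) powr (1 - \<gamma> / \<tau>)" by (simp add: \<rho>_def powr_powr)
    also have "V * \<dots> = m powr (1 - \<gamma> / \<tau>) * (V powr 1 / V powr (1 - \<gamma> / \<tau>))"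
      using mV by (simp add: powr_divide)
    also have "V powr 1 / V powr (1 - \<gamma> / \<tau>) = V powr (\<gamma> / \<tau>)"
      by (subst powr_diff[symmetric]) simp
    finally have "V * \<rho> powr (\<tau> - \<gamma>) = m powr (1 - \<gamma> / \<tau>) * V powr (\<gamma> / \<tau>)"
      using \<open>\<rho> powr (\<tau> - \<gamma>) = (m / V) powr (1 - \<gamma> / \<tau>)\<close> by simp
    then show ?thesis by (simp add: mult_ac)
  qed
  also have "(\<Sum>Q\<in>?L. sz Q powr (- \<gamma>) * \<mu> Q) \<le> (\<Sum>Q\<in>?L. m * sz Q powr (- \<gamma>))"
    using le by (intro sum_mono) (auto simp: mult.commute[of m] intro!: mult_left_mono)
  also have "\<dots> \<le> m * (2 powr \<gamma> * \<rho> powr (- \<gamma>) / (1 - 2 powr (- \<gamma>)))"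
    unfolding sum_distrib_left[symmetric] using mV \<gamma> by (intro mult_left_mono large) auto
  also have "\<dots> = 2 powr \<gamma> / (1 - 2 powr (- \<gamma>)) * (m powr (1 - \<gamma> / \<tau>) * V powr (\<gamma> / \<tau>))"
  proof -
    have "\<rho> powr (- \<gamma>) = (m / V) powr (- (\<gamma> / \<tau>))" by (simp add: \<rho>_def powr_powr)
    also have "m * \<dots> = (m powr 1 / m powr (\<gamma> / \<tau>)) * V powr (\<gamma> / \<tau>)"
      using mV by (simp add: powr_divide powr_minus divide_simps)
    also have "m powr 1 / m powr (\<gamma> / \<tau>) = m powr (1 - \<gamma> / \<tau>)"
      by (rule powr_diff[symmetric])
    finally have "m * \<rho> powr (- \<gamma>) = m powr (1 - \<gamma> / \<tau>) * V powr (\<gamma> / \<tau>)"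
      using \<open>\<rho> powr (- \<gamma>) = (m / V) powr (- (\<gamma> / \<tau>))\<close> by simp
    then show ?thesis by (simp add: mult_ac)
  qed
  finally show ?thesis by (simp add: hedberg_const_def algebra_simps)
qed

text \<open>The maximal members of \<open>W\<close> are disjoint and cover the union, and the masses
  of disjoint subsets of \<open>P\<close> add up to at most the mass of \<open>P\<close>.\<close>

lemma measure_Union_le:
  assumes fin: "W \<subseteq> D" and sets: "D \<subseteq> sets m" "D \<subseteq> sets \<mu>" "P \<in> sets \<mu>" "emeasure \<mu> P < \<infinity>"
    and m_fin: "\<And>Q. Q \<in> W \<Longrightarrow> emeasure m Q < \<infinity>"
    and sub: "\<And>Q. Q \<in> W \<Longrightarrow> Q \<subseteq> P"
    and le: "\<And>Q. Q \<in> W \<Longrightarrow> measure m Q \<le> c * measure \<mu> Q" and c: "0 \<le> c"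
  shows "measure m (\<Union>W) \<le> c * measure \<mu> P"
proof -
  interpret W: laminar W by (rule subfamily[OF fin])
  let ?M = "W.records (\<lambda>_. 0)"
  have MW: "?M \<subseteq> W" by (rule W.records_subset)
  have "\<Union>W = \<Union>?M"
  proof
    show "\<Union>W \<subseteq> \<Union>?M" using W.ex_record[of _ "\<lambda>_. 0"] by blast
  qed (use MW in auto)
  have disj: "disjoint_family_on (\<lambda>Q. Q) ?M"
    unfolding disjoint_family_on_def
  proof (intro ballI impI)
    fix P Q assume PQ: "P \<in> ?M" "Q \<in> ?M" "P \<noteq> Q"
    then have "P \<inter> Q = {} \<or> P \<subseteq> Q \<or> Q \<subseteq> P" using W.nested MW by blast
    then show "P \<inter> Q = {}"
      using W.records_mono[of P "\<lambda>_. 0" Q] W.records_mono[of Q "\<lambda>_. 0" P] PQ by auto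
  qed
  have "measure m (\<Union>W) = measure m (\<Union>Q\<in>?M. Q)" using \<open>\<Union>W = \<Union>?M\<close> by simp
  also have "\<dots> \<le> (\<Sum>Q\<in>?M. measure m Q)"
    using W.finite_records MW fin sets m_fin
    by (intro measure_UNION_le) (auto simp: fmeasurable_def)
  also have "\<dots> \<le> (\<Sum>Q\<in>?M. c * measure \<mu> Q)" using MW le by (intro sum_mono) auto
  also have "\<dots> = c * (\<Sum>Q\<in>?M. measure \<mu> Q)" by (simp add: sum_distrib_left)
  also have "(\<Sum>Q\<in>?M. measure \<mu> Q) = measure \<mu> (\<Union>Q\<in>?M. Q)"
  proof (rule measure_finite_Union[symmetric])
    show "emeasure \<mu> Q \<noteq> \<infinity>" if "Q \<in> ?M" for Q
    proof -
      have "emeasure \<mu> Q \<le> emeasure \<mu> P" using that MW sub sets by (intro emeasure_mono) auto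
      then show ?thesis using sets(4) by (auto simp: top_unique)
    qed
  qed (use W.finite_records disj MW fin sets in auto)
  also have "\<dots> \<le> measure \<mu> P"
    using MW sub sets fin W.finite_records
    by (intro measure_mono_fmeasurable sets.finite_UN) (auto simp: fmeasurable_def)
  finally show ?thesis using c by (simp add: mult_left_mono)
qed

text \<open>Used for families of records, where it counts how often the level rises on the way from
  \<open>P\<close> down to \<open>x\<close>.\<close>

definition depth :: "'a set \<Rightarrow> 'a \<Rightarrow> nat" where
  "depth P x = card {Q \<in> D. Q \<subset> P \<and> x \<in> Q}"

lemma depth_measurable [measurable]:
  assumes "D \<subseteq> sets M"
  shows "depth P \<in> measurable M (count_space UNIV)"
proof -
  have "depth P x = (\<Sum>Q | Q \<in> D \<and> Q \<subset> P. indicator Q x)" for x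
  proof -
    have "depth P x = (\<Sum>Q\<in>{Q \<in> D. Q \<subset> P \<and> x \<in> Q}. 1)" by (simp add: depth_def)
    also have "\<dots> = (\<Sum>Q | Q \<in> D \<and> Q \<subset> P. indicator Q x)"
      using finite_D by (intro sum.mono_neutral_cong_left) (auto simp: indicator_def)
    finally show ?thesis .
  qed
  then have "depth P = (\<lambda>x. \<Sum>Q | Q \<in> D \<and> Q \<subset> P. indicator Q x)" by auto
  moreover have "(\<lambda>x. \<Sum>Q | Q \<in> D \<and> Q \<subset> P. indicator Q x :: nat) \<in> borel_measurable M"
    using assms by (intro borel_measurable_sum) auto
  moreover have "measurable M (borel :: nat measure) = measurable M (count_space UNIV)"
    by (rule measurable_cong_sets[OF refl sets_borel_eq_count_space])
  ultimately show ?thesis by simp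
qed

lemma depth_sets:
  assumes "D \<subseteq> sets M" "P \<in> sets M"
  shows "{x\<in>P. d \<le> depth P x} \<in> sets M"
proof -
  have "depth P -` {d..} \<inter> space M \<in> sets M"
    by (rule measurable_sets[OF depth_measurable[OF assms(1)]]) simp
  moreover have "{x\<in>P. d \<le> depth P x} = P \<inter> (depth P -` {d..} \<inter> space M)"
    using sets.sets_into_space[OF assms(2)] by auto
  ultimately show ?thesis using assms(2) by simp
qed

text \<open>If \<^term>\<open>d\<close> is the median depth in \<^term>\<open>P\<close>, then half of \<^term>\<open>P\<close> has depth at most
  \<^term>\<open>d\<close>; through a given point every depth occurs only once.\<close>

lemma sum_depth:
  assumes sets: "D \<subseteq> sets M" "R \<in> sets M" "emeasure M R < \<infinity>" and sub: "\<And>P. P \<in> D \<Longrightarrow> P \<subseteq> R"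
    and g: "\<And>d. 0 \<le> g d" "antimono g" "summable g"
    and c: "\<And>P d. P \<in> D \<Longrightarrow> measure M P \<le> 2 * measure M {x\<in>P. d \<le> depth P x} \<Longrightarrow> c P \<le> g d"
    and c_nonneg: "\<And>P. 0 \<le> c P"
  shows "(\<Sum>P\<in>D. c P * measure M P) \<le> 2 * suminf g * measure M R"
proof -
  note [measurable] = depth_measurable[OF sets(1)]
  have fm: "P \<in> fmeasurable M" if "P \<in> D" for P
    using fmeasurableI2[of R M P] that sets sub by (auto simp: fmeasurable_def)
  have single: "ennreal (c P * measure M P) \<le> (\<integral>\<^sup>+x. ennreal (2 * (indicator P x * g (depth P x))) \<partial>M)"
    if P: "P \<in> D" for P
  proof (cases "measure M P = 0")
    case False
    let ?\<Omega> = "\<lambda>d. {x\<in>P. d \<le> depth P x}"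
    have [measurable]: "P \<in> sets M" using P sets by auto
    have \<Omega>[measurable]: "?\<Omega> d \<in> sets M" for d
    proof -
      have "?\<Omega> d = P \<inter> {x\<in>space M. d \<le> depth P x}" using sets.sets_into_space[of P M] by auto
      then show ?thesis by simp
    qed
    \<comment> \<open>The inequality holds at depth 0, where the set is all of \<open>P\<close>, and
      fails beyond \<open>card D\<close>, where the set is empty; \<open>d\<close> is a depth at
      which it holds for the last time before failing.\<close>
    have "\<exists>d. measure M P \<le> 2 * measure M (?\<Omega> d) \<and> \<not> measure M P \<le> 2 * measure M (?\<Omega> (Suc d))"
    proof (rule ccontr)
      assume "\<not> ?thesis"
      then have *: "measure M P \<le> 2 * measure M (?\<Omega> d) \<Longrightarrow> measure M P \<le> 2 * measure M (?\<Omega> (Suc d))" for d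
        by blast
      have "measure M P \<le> 2 * measure M (?\<Omega> d)" for d by (induction d) (use * in auto)
      moreover have "?\<Omega> (Suc (card D)) = {}"
      proof -
        have "depth P x \<le> card D" for x unfolding depth_def using finite_D by (intro card_mono) auto
        then show ?thesis using not_less_eq_eq by blast
      qed
      ultimately have "measure M P \<le> 2 * measure M {}" by metis
      then show False using False by (simp add: measure_le_0_iff)
    qed
    then obtain d where d: "measure M P \<le> 2 * measure M (?\<Omega> d)"
      "2 * measure M (?\<Omega> (Suc d)) < measure M P" by auto
    have "measure M (P - ?\<Omega> (Suc d)) = measure M P - measure M (?\<Omega> (Suc d))"
      by (intro measure_Diff) (use fm[OF P] in \<open>auto simp: fmeasurable_def\<close>)
    then have half: "measure M P \<le> 2 * measure M (P - ?\<Omega> (Suc d))" using d by simp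
    have "c P * measure M P \<le> g d * (2 * measure M (P - ?\<Omega> (Suc d)))"
      using c[OF P d(1)] half c_nonneg g by (intro mult_mono) auto
    then have "ennreal (c P * measure M P) \<le> ennreal (2 * g d) * ennreal (measure M (P - ?\<Omega> (Suc d)))"
      using g by (simp add: ennreal_mult[symmetric] mult_ac)
    also have "ennreal (measure M (P - ?\<Omega> (Suc d))) = emeasure M (P - ?\<Omega> (Suc d))"
      by (intro emeasure_eq_measure2[symmetric] fmeasurableI2[OF fm[OF P]]) auto
    also have "ennreal (2 * g d) * emeasure M (P - ?\<Omega> (Suc d))
        = (\<integral>\<^sup>+x. ennreal (2 * g d) * indicator (P - ?\<Omega> (Suc d)) x \<partial>M)"
      by (subst nn_integral_cmult_indicator) auto
    also have "\<dots> \<le> (\<integral>\<^sup>+x. ennreal (2 * (indicator P x * g (depth P x))) \<partial>M)"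
    proof (rule nn_integral_mono)
      fix x
      show "ennreal (2 * g d) * indicator (P - ?\<Omega> (Suc d)) x
          \<le> ennreal (2 * (indicator P x * g (depth P x)))"
      proof (cases "x \<in> P - ?\<Omega> (Suc d)")
        case True
        then have "depth P x \<le> d" by auto
        then have "g d \<le> g (depth P x)" by (rule antimonoD[OF g(2)])
        then show ?thesis using True by (simp add: ennreal_leI)
      qed simp
    qed
    finally show ?thesis .
  qed simp
  have g_le: "(\<Sum>P\<in>D. indicator P x * g (depth P x)) \<le> suminf g * indicator R x" for x
  proof -
    let ?X = "{P \<in> D. x \<in> P}"
    have lt: "depth Q x < depth P x" if "P \<in> ?X" "Q \<in> ?X" "Q \<subset> P" for P Q
      unfolding depth_def using that finite_D by (intro psubset_card_mono) auto
    have inj: "inj_on (\<lambda>P. depth P x) ?X"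
    proof (rule inj_onI)
      fix P Q assume *: "P \<in> ?X" "Q \<in> ?X" and eq: "depth P x = depth Q x"
      then have "P \<subseteq> Q \<or> Q \<subseteq> P" using comparable[of P Q x] by auto
      then show "P = Q" using lt[of P Q] lt[of Q P] * eq by auto
    qed
    have "(\<Sum>P\<in>D. indicator P x * g (depth P x)) = (\<Sum>P\<in>?X. g (depth P x))"
      using finite_D by (intro sum.mono_neutral_cong_right) (auto simp: indicator_def split: if_splits)
    also have "\<dots> = (\<Sum>d\<in>(\<lambda>P. depth P x) ` ?X. g d)" by (simp add: sum.reindex[OF inj])
    also have "\<dots> \<le> suminf g" using finite_D g by (intro sum_le_suminf) auto
    finally have le: "(\<Sum>P\<in>D. indicator P x * g (depth P x)) \<le> suminf g" .
    show ?thesis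
    proof (cases "x \<in> R")
      case False
      then have "(\<Sum>P\<in>D. indicator P x * g (depth P x)) = 0"
        using sub by (intro sum.neutral) (auto simp: indicator_def)
      then show ?thesis using False by simp
    qed (use le in simp)
  qed
  have "ennreal (\<Sum>P\<in>D. c P * measure M P) = (\<Sum>P\<in>D. ennreal (c P * measure M P))"
    using c_nonneg by (simp add: sum_ennreal)
  also have "\<dots> \<le> (\<Sum>P\<in>D. \<integral>\<^sup>+x. ennreal (2 * (indicator P x * g (depth P x))) \<partial>M)"
    by (intro sum_mono single)
  also have "\<dots> = (\<integral>\<^sup>+x. (\<Sum>P\<in>D. ennreal (2 * (indicator P x * g (depth P x)))) \<partial>M)"
  proof (rule nn_integral_sum[symmetric])
    fix P assume "P \<in> D"
    then have [measurable]: "P \<in> sets M" using sets by auto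
    have [measurable]: "(\<lambda>x. g (depth P x)) \<in> borel_measurable M"
      by (rule measurable_compose[OF depth_measurable[OF sets(1)]]) simp
    show "(\<lambda>x. ennreal (2 * (indicator P x * g (depth P x)))) \<in> borel_measurable M" by measurable
  qed
  also have "\<dots> \<le> (\<integral>\<^sup>+x. ennreal (2 * suminf g) * indicator R x \<partial>M)"
  proof (rule nn_integral_mono)
    fix x
    have "(\<Sum>P\<in>D. ennreal (2 * (indicator P x * g (depth P x))))
        = ennreal (2 * (\<Sum>P\<in>D. indicator P x * g (depth P x)))"
      using g by (simp add: sum_ennreal sum_distrib_left)
    also have "\<dots> \<le> ennreal (2 * (suminf g * indicator R x))"
      by (intro ennreal_leI mult_left_mono g_le) auto
    also have "\<dots> = ennreal (2 * suminf g) * indicator R x" by (auto simp: indicator_def)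
    finally show "(\<Sum>P\<in>D. ennreal (2 * (indicator P x * g (depth P x))))
        \<le> ennreal (2 * suminf g) * indicator R x" .
  qed
  also have "\<dots> = ennreal (2 * suminf g * measure M R)"
    using sets g suminf_nonneg[OF g(3)]
    by (simp add: nn_integral_cmult_indicator emeasure_eq_ennreal_measure less_top ennreal_mult)
  finally show ?thesis
    using suminf_nonneg[OF g(3)] g by (subst (asm) ennreal_le_iff) auto
qed

end

section \<open>Testing conditions from the bump\<close>

text \<open>Of the two caps on \<open>\<theta>\<close>, the first keeps the power of
  \<open>\<mu>(P)\<close> in the sum over records at least 1, the second makes the exponent
  \<open>\<tau> = \<gamma> / (1 - \<theta>)\<close> at most 1. The factor
  \<open>2 powr (1 - \<theta>)\<close> pays for rounding the maximal function to dyadic levels, and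
  twice the series is the constant of \<open>sum_depth\<close>.\<close>

definition testing_const :: "real \<Rightarrow> real \<Rightarrow> real \<Rightarrow> real" where
  "testing_const \<gamma> a b = (let \<theta> = min (1 - 1 / a - 1 / b) (1 - \<gamma>) in
     (hedberg_const \<gamma> (\<gamma> / (1 - \<theta>)) * 2 powr (1 - \<theta>)) powr b
       * (2 * (\<Sum>d. (1 + real d) powr (- (b * (1 - 1 / a))))))"

text \<open>Multiplied by \<open>b\<close>, the inequality \<open>1 / b < 1 - 1 / a\<close> says
  that the exponent exceeds 1. For the exponents of the theorem this is
  \<open>p < q\<close>.\<close>

lemma summable_testing:
  fixes a b :: real
  assumes "1 < a" "1 < b" "1 / a + 1 / b < 1"
  shows "summable (\<lambda>d. (1 + real d) powr (- (b * (1 - 1 / a))))"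
proof -
  have "b * (1 / b) < b * (1 - 1 / a)" using assms by (intro mult_strict_left_mono) auto
  then have "1 < b * (1 - 1 / a)" using assms by simp
  then have "summable (\<lambda>d. real d powr (- (b * (1 - 1 / a))))"
    by (subst summable_real_powr_iff) auto
  then have "summable (\<lambda>d. real (Suc d) powr (- (b * (1 - 1 / a))))"
    by (subst summable_Suc_iff)
  then show ?thesis by (simp add: add.commute)
qed

lemma testing_const_nonneg:
  assumes "1 < a" "1 < b" "1 / a + 1 / b < 1"
  shows "0 \<le> testing_const \<gamma> a b"
  using suminf_nonneg[OF summable_testing[OF assms]] by (auto simp: testing_const_def Let_def)

context laminar
begin

text \<open>At depth \<open>d\<close> the integer level has risen by at least \<open>d\<close>, so
  the point lies in a record \<open>Q\<close> with \<open>|Q| powr (- \<tau>) * \<mu>(Q)\<close> at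
  least \<open>2 powr (d - 1)\<close> times the value at \<open>P\<close>. With
  \<open>|Q| \<le> |P|\<close> this bounds \<open>|Q| / |P|\<close> by
  \<open>2 powr (1 - d) * \<mu>(Q) / \<mu>(P)\<close>, and \<open>measure_Union_le\<close> sums over
  such \<open>Q\<close>.\<close>

lemma measure_depth_le:
  assumes sets: "D \<subseteq> sets m" "D \<subseteq> sets \<mu>" and fin: "\<And>Q. Q \<in> D \<Longrightarrow> emeasure m Q < \<infinity>"
      "\<And>Q. Q \<in> D \<Longrightarrow> emeasure \<mu> Q < \<infinity>"
    and pos: "\<And>Q. Q \<in> D \<Longrightarrow> 0 < measure m Q" "\<And>Q. Q \<in> D \<Longrightarrow> 0 < measure \<mu> Q"
    and \<tau>: "0 < \<tau>" "\<tau> \<le> 1"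
  defines "k \<equiv> \<lambda>Q. dyadic_level (measure m Q powr (- \<tau>) * measure \<mu> Q)"
  assumes P: "P \<in> records k"
  shows "measure m {x\<in>P. d \<le> laminar.depth (records k) P x} \<le> 2 * (1 / 2) ^ d * measure m P"
proof -
  interpret S: laminar "records k" by (rule subfamily[OF records_subset])
  have PD: "P \<in> D" using P records_subset by auto
  let ?v = "\<lambda>Q. measure m Q powr (- \<tau>) * measure \<mu> Q"
  have v: "0 < ?v Q" if "Q \<in> D" for Q using pos[OF that] by simp
  show ?thesis
  proof (cases "d = 0")
    case True
    have "measure m {x\<in>P. d \<le> S.depth P x} = measure m P" using True by simp
    then show ?thesis using True by simp
  next
    case False
    define W where "W = {Q \<in> records k. Q \<subset> P \<and> k P + int d \<le> k Q}"
    have WD: "W \<subseteq> D" using records_subset by (auto simp: W_def)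
    have cover: "{x\<in>P. d \<le> S.depth P x} \<subseteq> \<Union>W"
    proof
      fix x assume x: "x \<in> {x\<in>P. d \<le> S.depth P x}"
      let ?C = "{Q \<in> records k. Q \<subset> P \<and> x \<in> Q}"
      have C: "finite ?C" "d \<le> card ?C" using x finite_records by (auto simp: S.depth_def)
      \<comment> \<open>The levels are distinct integers above \<open>k P\<close>, so the highest of
        at least \<open>d\<close> of them is at least \<open>k P + d\<close>.\<close>
      have inj: "inj_on k ?C" using inj_on_records[of k x] by (rule inj_on_subset) auto
      have "?C \<noteq> {}" using C False by (metis card.empty le_zero_eq)
      then have "Max (k ` ?C) \<in> k ` ?C" using C by (intro Max_in) auto
      then obtain Q where Q: "Q \<in> ?C" "Max (k ` ?C) = k Q" by (rule imageE) blast
      have "k ` ?C \<subseteq> {k P + 1..k Q}"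
      proof (rule image_subsetI)
        fix Q' assume Q': "Q' \<in> ?C"
        then have "k Q' \<le> k Q" unfolding Q(2)[symmetric] using C(1) by (intro Max_ge) auto
        moreover have "k P < k Q'" using Q' records_mono[OF P, of Q'] by auto
        ultimately show "k Q' \<in> {k P + 1..k Q}" by simp
      qed
      then have "card (k ` ?C) \<le> card {k P + 1..k Q}" by (intro card_mono) auto
      then have "card ?C \<le> nat (k Q - k P)" using inj by (simp add: card_image)
      then have "k P + int d \<le> k Q" using C(2) False by linarith
      then show "x \<in> \<Union>W" using Q(1) by (auto simp: W_def)
    qed
    let ?c = "2 * (1 / 2) ^ d * measure m P / measure \<mu> P"
    have le: "measure m Q \<le> ?c * measure \<mu> Q" if "Q \<in> W" for Q
    proof -
      have Q: "Q \<in> D" "Q \<subseteq> P" "k P + int d \<le> k Q" using that WD by (auto simp: W_def)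
      have "?v P * 2 ^ d \<le> 2 powr (k P + 1) * 2 ^ d"
        using dyadic_level(2)[OF v[OF PD]] by (auto simp: k_def)
      also have "\<dots> = 2 * 2 powr (real_of_int (k P + int d))"
        by (simp add: powr_add powr_realpow)
      also have "\<dots> \<le> 2 * 2 powr (real_of_int (k Q))" using Q by (simp del: of_int_add)
      also have "\<dots> \<le> 2 * ?v Q" using dyadic_level(1)[OF v[OF Q(1)]] by (simp add: k_def)
      finally have vv: "?v P * 2 ^ d \<le> 2 * ?v Q" .
      have mQP: "measure m Q \<le> measure m P"
        using Q PD sets fin by (intro measure_mono_fmeasurable) (auto simp: fmeasurable_def)
      have pQ: "0 < measure m Q" "0 < measure m P" "0 < measure \<mu> P" using pos Q PD by auto
      have "measure m Q = measure m Q powr \<tau> * measure m Q powr (1 - \<tau>)"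
        using pQ by (simp flip: powr_add)
      \<comment> \<open>Monotonicity needs \<open>1 - \<tau> \<ge> 0\<close>, the reason for the cap
        \<open>1 - \<gamma>\<close> on \<open>\<theta>\<close> in
        \<open>testing_const\<close>.\<close>
      also have "\<dots> \<le> measure m Q powr \<tau> * measure m P powr (1 - \<tau>)"
        using \<tau> mQP pQ by (intro mult_left_mono powr_mono2) auto
      also have "measure m Q powr \<tau> * measure m P powr (1 - \<tau>)
          = measure m Q powr \<tau> / measure \<mu> P / 2 ^ d * measure m P * (?v P * 2 ^ d)"
        using pQ by (simp add: powr_diff powr_minus divide_simps)
      also have "\<dots> \<le> measure m Q powr \<tau> / measure \<mu> P / 2 ^ d * measure m P * (2 * ?v Q)"
        using vv pQ by (intro mult_left_mono) auto
      also have "\<dots> = ?c * measure \<mu> Q"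
        using pQ by (simp add: powr_minus power_one_over divide_simps)
      finally show ?thesis .
    qed
    have [simp]: "\<Union>W \<in> fmeasurable m"
      using WD sets fin finite_subset[OF WD finite_D]
      by (intro fmeasurable.finite_Union) (auto simp: fmeasurable_def)
    have "measure m {x\<in>P. d \<le> S.depth P x} \<le> measure m (\<Union>W)"
    proof (intro measure_mono_fmeasurable cover)
      show "{x\<in>P. d \<le> S.depth P x} \<in> sets m"
        using records_subset[of k] sets(1) PD by (intro S.depth_sets) blast+
    qed simp
    also have "\<dots> \<le> ?c * measure \<mu> P"
      using sets fin PD WD le pos(2)[OF PD] by (intro measure_Union_le) (auto simp: W_def)
    also have "\<dots> = 2 * (1 / 2) ^ d * measure m P" using pos(2)[OF PD] by simp
    finally show ?thesis .
  qed
qed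

text \<open>In \<open>bump\<close>, \<open>\<Omega>\<close> will be the part of \<open>P\<close> at
  depth at least \<open>d\<close>, which \<open>measure_depth_le\<close> shows to be small. The
  Hedberg bound is a power of a maximal function, and its power \<open>b\<close> is at most a sum
  over the records through the point. \<open>\<tau>\<close> is chosen so that
  \<open>measure m P\<close> appears in a summand with the power from \<open>bump\<close>; what
  remains is a power of \<open>measure \<mu> P\<close> with exponent at least 1, of which one factor
  feeds \<open>sum_depth\<close> and the rest is estimated on \<open>R\<close>.\<close>

lemma testing_local:
  assumes sets: "D \<subseteq> sets m" "sets \<mu> = sets m" "sets \<nu> = sets m" "R \<in> sets m"
    and fin: "\<And>Q. Q \<in> D \<Longrightarrow> emeasure m Q < \<infinity>" "emeasure \<mu> R < \<infinity>" "emeasure \<nu> R < \<infinity>"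
    and sub: "\<And>Q. Q \<in> D \<Longrightarrow> Q \<subseteq> R"
    and pos: "\<And>Q. Q \<in> D \<Longrightarrow> 0 < measure m Q" "\<And>Q. Q \<in> D \<Longrightarrow> 0 < measure \<mu> Q"
    and dbl: "\<And>P Q. P \<in> D \<Longrightarrow> Q \<in> D \<Longrightarrow> Q \<subset> P \<Longrightarrow> 2 * measure m Q \<le> measure m P"
    and \<gamma>: "0 < \<gamma>" "\<gamma> < 1" and ab: "1 < a" "1 < b" "1 / a + 1 / b < 1" and A: "0 \<le> A"
    and bump: "\<And>P \<Omega> d. P \<in> D \<Longrightarrow> \<Omega> \<in> sets m \<Longrightarrow> \<Omega> \<subseteq> P \<Longrightarrow>
      measure m \<Omega> \<le> 2 * (1 / 2) ^ d * measure m P \<Longrightarrow> measure \<mu> P \<le> 2 * measure \<mu> \<Omega> \<Longrightarrow>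
      measure m P powr (- \<gamma>) * measure \<mu> P powr (1 / a) * measure \<nu> P powr (1 / b)
        \<le> A * (1 + real d) powr (- (1 - 1 / a))"
  shows "(\<integral>\<^sup>+x. ennreal ((\<Sum>Q\<in>D. measure m Q powr (- \<gamma>) * measure \<mu> Q * indicator Q x) powr b) \<partial>\<nu>)
    \<le> ennreal (testing_const \<gamma> a b * A powr b * measure \<mu> R powr (b * (1 - 1 / a)))"
proof (cases "D = {}")
  case True
  then show ?thesis by simp
next
  case False
  define \<theta> where "\<theta> = min (1 - 1 / a - 1 / b) (1 - \<gamma>)"
  define \<tau> where "\<tau> = \<gamma> / (1 - \<theta>)"
  have ab': "0 < 1 / a" "0 < 1 / b" using ab by auto
  have \<theta>: "0 < \<theta>" "\<theta> < 1" "\<theta> \<le> 1 - 1 / a - 1 / b" "\<theta> \<le> 1 - \<gamma>"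
    using ab ab' \<gamma> by (auto simp: \<theta>_def min_less_iff_disj)
  have \<tau>: "\<gamma> < \<tau>" "\<tau> \<le> 1" "0 < \<tau>" "\<gamma> / \<tau> = 1 - \<theta>" "1 - \<gamma> / \<tau> = \<theta>"
    using \<theta> \<gamma> by (auto simp: \<tau>_def field_simps)
  let ?m = "measure m" and ?\<mu> = "measure \<mu>" and ?\<nu> = "measure \<nu>"
  let ?v = "\<lambda>Q. ?m Q powr (- \<tau>) * ?\<mu> Q"
  define k where "k = (\<lambda>Q. dyadic_level (?v Q))"
  interpret S: laminar "records k" by (rule subfamily[OF records_subset])
  have SD: "records k \<subseteq> D" by (rule records_subset)
  have setsD: "D \<subseteq> sets \<mu>" "D \<subseteq> sets \<nu>" using sets by auto
  have fin': "emeasure \<mu> Q < \<infinity>" "emeasure \<nu> Q < \<infinity>" if "Q \<in> D" for Q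
  proof -
    have "emeasure \<mu> Q \<le> emeasure \<mu> R" "emeasure \<nu> Q \<le> emeasure \<nu> R"
      using that sub sets by (auto intro!: emeasure_mono)
    then show "emeasure \<mu> Q < \<infinity>" "emeasure \<nu> Q < \<infinity>" using fin(2,3) by auto
  qed
  have \<mu>_le: "?\<mu> Q \<le> ?\<mu> R" if "Q \<in> D" for Q
    using that sub sets fin by (intro measure_mono_fmeasurable) (auto simp: fmeasurable_def)
  have R: "0 < ?\<mu> R" using False pos \<mu>_le by fastforce
  have v: "0 < ?v Q" if "Q \<in> D" for Q using pos[OF that] by simp
  let ?T = "\<lambda>x. \<Sum>Q\<in>D. ?m Q powr (- \<gamma>) * ?\<mu> Q * indicator Q x :: real"
  let ?h = "hedberg_const \<gamma> \<tau>"
  have h: "0 \<le> ?h"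
  proof -
    have "0 \<le> 1 - 2 powr (- (\<tau> - \<gamma>))" "0 \<le> 1 - 2 powr (- \<gamma>)"
      using powr_le_cancel_iff[of 2 "- (\<tau> - \<gamma>)" 0] powr_le_cancel_iff[of 2 "- \<gamma>" 0] \<tau> \<gamma> by auto
    then show ?thesis unfolding hedberg_const_def
      by (intro add_nonneg_nonneg divide_nonneg_nonneg powr_ge_zero)
  qed
  define c0 where "c0 = (?h * 2 powr (1 - \<theta>)) powr b * ?\<mu> R powr (b * \<theta>)"
  have c0: "0 \<le> c0" by (simp add: c0_def)
  have pointwise: "?T x powr b \<le> (\<Sum>P\<in>records k. c0 * ?v P powr (b * (1 - \<theta>)) * indicator P x)" for x
  proof (cases "\<exists>Q\<in>D. x \<in> Q")
    case False
    then have "?T x = 0" by (intro sum.neutral) auto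
    then have "?T x powr b = 0" by simp
    also have "0 \<le> (\<Sum>P\<in>records k. c0 * ?v P powr (b * (1 - \<theta>)) * indicator P x)"
      using c0 by (intro sum_nonneg) auto
    finally show ?thesis .
  next
    case True
    let ?X = "{Q \<in> D. x \<in> Q}"
    define V where "V = Max (?v ` ?X)"
    have X: "finite ?X" "?X \<noteq> {}" using finite_D True by auto
    then have "V \<in> ?v ` ?X" unfolding V_def by (intro Max_in) auto
    then obtain Q0 where Q0: "Q0 \<in> D" "x \<in> Q0" "V = ?v Q0" by auto
    have V: "0 < V" using v Q0 by simp
    have V_ge: "?v Q \<le> V" if "Q \<in> D" "x \<in> Q" for Q
      unfolding V_def using X that by (intro Max_ge) auto
    \<comment> \<open>The maximum \<open>V\<close> need not be attained at a record, but some record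
      around \<open>Q0\<close> has at least its level, so passing to it costs only the rounding
      factor 2.\<close>
    obtain P where P: "P \<in> records k" "Q0 \<subseteq> P" "k Q0 \<le> k P" using ex_record[OF Q0(1), of k] by blast
    then have PD: "P \<in> D" "x \<in> P" using SD Q0 by auto
    have "V \<le> 2 powr (k Q0 + 1)" using dyadic_level(2)[OF v[OF Q0(1)]] Q0 by (simp add: k_def)
    also have "\<dots> \<le> 2 powr (k P + 1)" using P by simp
    also have "\<dots> = 2 * 2 powr (k P)" by (simp add: powr_add)
    also have "\<dots> \<le> 2 * ?v P" using dyadic_level(1)[OF v[OF PD(1)]] by (simp add: k_def)
    finally have VP: "V \<le> 2 * ?v P" .
    have "?T x = (\<Sum>Q\<in>?X. ?m Q powr (- \<gamma>) * ?\<mu> Q)"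
      using finite_D by (intro sum.mono_neutral_cong_right) (auto simp: indicator_def split: if_splits)
    also have "\<dots> \<le> ?h * ?\<mu> R powr (1 - \<gamma> / \<tau>) * V powr (\<gamma> / \<tau>)"
    proof (rule hedberg[OF pos(1) dbl])
      show "?\<mu> Q \<le> V * ?m Q powr \<tau>" if "Q \<in> D" "x \<in> Q" for Q
        using V_ge[OF that] pos[OF that(1)] by (simp add: powr_minus field_simps)
    qed (use \<gamma> \<tau> R V \<mu>_le in auto)
    also have "\<dots> = ?h * ?\<mu> R powr \<theta> * V powr (1 - \<theta>)" by (simp add: \<tau>)
    also have "\<dots> \<le> ?h * ?\<mu> R powr \<theta> * (2 * ?v P) powr (1 - \<theta>)"
      using VP V \<theta> h by (intro mult_left_mono powr_mono2) auto
    finally have "?T x \<le> ?h * ?\<mu> R powr \<theta> * (2 * ?v P) powr (1 - \<theta>)" .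
    moreover have "0 \<le> ?T x" by (intro sum_nonneg) auto
    ultimately have "?T x powr b \<le> (?h * ?\<mu> R powr \<theta> * (2 * ?v P) powr (1 - \<theta>)) powr b"
      using ab by (intro powr_mono2) auto
    also have "\<dots> = c0 * ?v P powr (b * (1 - \<theta>))"
      using R by (simp add: c0_def powr_mult powr_powr mult_ac)
    also have "\<dots> \<le> (\<Sum>P\<in>records k. c0 * ?v P powr (b * (1 - \<theta>)) * indicator P x)"
      using member_le_sum[of P "records k" "\<lambda>P. c0 * ?v P powr (b * (1 - \<theta>)) * indicator P x"]
        P(1) PD(2) c0 finite_records by auto
    finally show ?thesis .
  qed
  have "(\<integral>\<^sup>+x. ennreal (?T x powr b) \<partial>\<nu>)
      \<le> (\<integral>\<^sup>+x. ennreal (\<Sum>P\<in>records k. c0 * ?v P powr (b * (1 - \<theta>)) * indicator P x) \<partial>\<nu>)"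
    by (intro nn_integral_mono ennreal_leI pointwise)
  also have "\<dots> = ennreal (\<Sum>P\<in>records k. c0 * ?v P powr (b * (1 - \<theta>)) * ?\<nu> P)"
    using c0 SD setsD fin' finite_records by (intro nn_integral_sum_indicator) auto
  also have "(\<Sum>P\<in>records k. c0 * ?v P powr (b * (1 - \<theta>)) * ?\<nu> P)
      \<le> testing_const \<gamma> a b * A powr b * ?\<mu> R powr (b * (1 - 1 / a))"
  proof -
    \<comment> \<open>The power of \<open>?\<mu> P\<close> left after splitting off
      \<open>?c P\<close>; \<open>\<theta> \<le> 1 - 1 / a - 1 / b\<close> is what makes it at least
      1.\<close>
    define e where "e = b * (1 - \<theta> - 1 / a)"
    have e: "1 \<le> e"
    proof -
      have "b * (1 / b) \<le> b * (1 - \<theta> - 1 / a)" using \<theta> ab by (intro mult_left_mono) auto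
      then show ?thesis using ab by (simp add: e_def)
    qed
    let ?c = "\<lambda>P. (?m P powr (- \<gamma>) * ?\<mu> P powr (1 / a) * ?\<nu> P powr (1 / b)) powr b"
    define g where "g = (\<lambda>d. A powr b * (1 + real d) powr (- (b * (1 - 1 / a))))"
    have b1: "1 < b * (1 - 1 / a)"
    proof -
      have "b * (1 / b) < b * (1 - 1 / a)" using ab by (intro mult_strict_left_mono) auto
      then show ?thesis using ab by simp
    qed
    have depth: "(\<Sum>P\<in>records k. ?c P * ?\<mu> P) \<le> 2 * suminf g * ?\<mu> R"
    proof (rule S.sum_depth)
      show "antimono g"
        unfolding g_def using b1 by (intro antimonoI mult_left_mono powr_mono2') auto
      show "summable g" unfolding g_def by (intro summable_mult summable_testing ab)
      show "?c P \<le> g d" if P: "P \<in> records k" and "?\<mu> P \<le> 2 * ?\<mu> {x\<in>P. d \<le> S.depth P x}" for P d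
      proof -
        have PD: "P \<in> D" using P SD by auto
        have "{x\<in>P. d \<le> S.depth P x} \<in> sets m"
          using SD sets(1) PD by (intro S.depth_sets) blast+
        moreover have "?m {x\<in>P. d \<le> S.depth P x} \<le> 2 * (1 / 2) ^ d * ?m P"
          unfolding k_def
          by (rule measure_depth_le) (use sets(1) setsD fin fin' pos \<tau> P in \<open>auto simp: k_def\<close>)
        ultimately have "?m P powr (- \<gamma>) * ?\<mu> P powr (1 / a) * ?\<nu> P powr (1 / b)
            \<le> A * (1 + real d) powr (- (1 - 1 / a))"
          using that PD by (intro bump) auto
        then have "?c P \<le> (A * (1 + real d) powr (- (1 - 1 / a))) powr b"
          using ab by (intro powr_mono2) auto
        also have "\<dots> = g d" by (simp add: g_def powr_mult powr_powr mult_ac right_diff_distrib)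
        finally show ?thesis .
      qed
      show "P \<subseteq> R" if "P \<in> records k" for P using that sub SD by blast
      show "records k \<subseteq> sets \<mu>" using SD setsD by blast
    qed (use sets fin in \<open>auto simp: g_def\<close>)
    have single: "c0 * ?v P powr (b * (1 - \<theta>)) * ?\<nu> P \<le> c0 * ?\<mu> R powr (e - 1) * (?c P * ?\<mu> P)"
      if P: "P \<in> records k" for P
    proof -
      have PD: "P \<in> D" using P SD by auto
      have pP: "0 < ?m P" "0 < ?\<mu> P" using pos PD by auto
      have \<tau>\<theta>: "\<tau> * (b * (1 - \<theta>)) = \<gamma> * b" using \<theta> by (simp add: \<tau>_def)
      have "?v P powr (b * (1 - \<theta>)) * ?\<nu> P
          = ?m P powr (- (\<gamma> * b)) * ?\<mu> P powr (b * (1 - \<theta>)) * ?\<nu> P"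
        by (simp add: powr_mult powr_powr \<tau>\<theta>)
      also have "\<dots> = ?c P * ?\<mu> P powr e"
      proof -
        have "?\<mu> P powr (b * (1 - \<theta>)) = ?\<mu> P powr (b / a) * ?\<mu> P powr e"
          unfolding powr_add[symmetric] e_def by (simp add: algebra_simps)
        moreover have "?c P = ?m P powr (- (\<gamma> * b)) * ?\<mu> P powr (b / a) * ?\<nu> P"
          using ab by (simp add: powr_mult powr_powr)
        ultimately show ?thesis by simp
      qed
      also have "?\<mu> P powr e = ?\<mu> P * ?\<mu> P powr (e - 1)" using pP by (simp add: powr_mult_base)
      also have "?c P * (?\<mu> P * ?\<mu> P powr (e - 1)) \<le> ?c P * (?\<mu> P * ?\<mu> R powr (e - 1))"
        using e \<mu>_le[OF PD] by (intro mult_left_mono powr_mono2) auto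
      finally have "c0 * (?v P powr (b * (1 - \<theta>)) * ?\<nu> P) \<le> c0 * (?c P * (?\<mu> P * ?\<mu> R powr (e - 1)))"
        using c0 by (intro mult_left_mono) auto
      then show ?thesis by (simp only: mult_ac)
    qed
    have "(\<Sum>P\<in>records k. c0 * ?v P powr (b * (1 - \<theta>)) * ?\<nu> P)
        \<le> c0 * ?\<mu> R powr (e - 1) * (\<Sum>P\<in>records k. ?c P * ?\<mu> P)"
      unfolding sum_distrib_left by (intro sum_mono single)
    also have "\<dots> \<le> c0 * ?\<mu> R powr (e - 1) * (2 * suminf g * ?\<mu> R)"
      using c0 by (intro mult_left_mono depth) auto
    also have "\<dots> = (?h * 2 powr (1 - \<theta>)) powr b * (2 * suminf g)
        * (?\<mu> R powr (b * \<theta>) * (?\<mu> R * ?\<mu> R powr (e - 1)))"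
      by (simp add: c0_def)
    also have "?\<mu> R * ?\<mu> R powr (e - 1) = ?\<mu> R powr e" using R by (simp add: powr_mult_base)
    \<comment> \<open>The auxiliary exponent cancels:
      \<open>b * \<theta> + e = b * (1 - 1 / a)\<close>, the homogeneity that the corona argument
      asks for.\<close>
    also have "?\<mu> R powr (b * \<theta>) * ?\<mu> R powr e = ?\<mu> R powr (b * (1 - 1 / a))"
      unfolding powr_add[symmetric] e_def by (simp add: algebra_simps)
    also have "suminf g = A powr b * (\<Sum>d. (1 + real d) powr (- (b * (1 - 1 / a))))"
      unfolding g_def by (rule suminf_mult[OF summable_testing[OF ab]])
    finally show ?thesis
      by (simp add: testing_const_def \<theta>_def[symmetric] \<tau>_def[symmetric] Let_def mult_ac)
  qed
  finally show ?thesis by (simp add: ennreal_leI)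
qed

end

section \<open>Two-weight bounds for the dyadic operator\<close>

text \<open>The bump condition freed of Luxemburg norms: the more \<open>\<mu>\<close> concentrates
  half of its mass in \<open>P\<close> on a small set, the smaller the two-weight quantity of
  \<open>P\<close> must be. The case \<open>\<Omega> = P\<close>, \<open>d = 0\<close> is the
  condition without a bump.\<close>

definition bumped :: "'a set set \<Rightarrow> 'a measure \<Rightarrow> 'a measure \<Rightarrow> 'a measure \<Rightarrow> real \<Rightarrow> real \<Rightarrow> real \<Rightarrow> real \<Rightarrow> bool" where
  "bumped D m \<mu> \<nu> \<gamma> a b A \<longleftrightarrow> (\<forall>P\<in>D. \<forall>\<Omega>\<in>sets m. \<forall>d. \<Omega> \<subseteq> P \<longrightarrow>
     measure m \<Omega> \<le> 2 * (1 / 2) ^ d * measure m P \<longrightarrow> measure \<mu> P \<le> 2 * measure \<mu> \<Omega> \<longrightarrow>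
     measure m P powr (- \<gamma>) * measure \<mu> P powr (1 / a) * measure \<nu> P powr (1 / b)
       \<le> A * (1 + real d) powr (- (1 - 1 / a)))"

definition dyadic_const :: "real \<Rightarrow> real \<Rightarrow> real \<Rightarrow> real \<Rightarrow> real \<Rightarrow> real" where
  "dyadic_const \<gamma> p p' q q' =
     4 * testing_const \<gamma> p' q powr (1 / q) * carleson_const p powr (1 / p) * carleson_const q' powr (1 / q')
     + 4 * testing_const \<gamma> q p' powr (1 / p') * carleson_const p powr (1 / p) * carleson_const q' powr (1 / q')"

lemma dyadic_const_nonneg: "0 \<le> dyadic_const \<gamma> p p' q q'"
  by (simp add: dyadic_const_def)

locale dyadic_family = laminar D for D :: "'a set set" +
  fixes m :: "'a measure"
  assumes sets_D: "D \<subseteq> sets m"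
    and finite_m: "\<And>Q. Q \<in> D \<Longrightarrow> emeasure m Q < \<infinity>"
    and pos_m: "\<And>Q. Q \<in> D \<Longrightarrow> 0 < measure m Q"
    and doubling: "\<And>P Q. P \<in> D \<Longrightarrow> Q \<in> D \<Longrightarrow> Q \<subset> P \<Longrightarrow> 2 * measure m Q \<le> measure m P"
begin

lemma testing:
  assumes sets: "sets \<mu> = sets m" "sets \<nu> = sets m"
    and fin: "\<And>Q. Q \<in> D \<Longrightarrow> emeasure \<mu> Q < \<infinity>" "\<And>Q. Q \<in> D \<Longrightarrow> emeasure \<nu> Q < \<infinity>"
    and pos: "\<And>Q. Q \<in> D \<Longrightarrow> 0 < measure \<mu> Q"
    and \<gamma>: "0 < \<gamma>" "\<gamma> < 1" and ab: "1 < a" "1 < b" "1 / a + 1 / b < 1" and A: "0 \<le> A"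
    and bump: "bumped D m \<mu> \<nu> \<gamma> a b A" and R: "R \<in> D"
  shows "(\<integral>\<^sup>+x. ennreal ((\<Sum>Q | Q \<in> D \<and> Q \<subseteq> R. measure m Q powr (- \<gamma>) * measure \<mu> Q * indicator Q x) powr b) \<partial>\<nu>)
    \<le> ennreal (testing_const \<gamma> a b * A powr b * measure \<mu> R powr (b * (1 - 1 / a)))"
proof -
  interpret R: laminar "{Q \<in> D. Q \<subseteq> R}" by (rule subfamily) auto
  show ?thesis
  proof (rule R.testing_local)
    show "measure m P powr (- \<gamma>) * measure \<mu> P powr (1 / a) * measure \<nu> P powr (1 / b)
        \<le> A * (1 + real d) powr (- (1 - 1 / a))"
      if "P \<in> {Q \<in> D. Q \<subseteq> R}" "\<Omega> \<in> sets m" "\<Omega> \<subseteq> P"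
        "measure m \<Omega> \<le> 2 * (1 / 2) ^ d * measure m P" "measure \<mu> P \<le> 2 * measure \<mu> \<Omega>" for P \<Omega> d
      using bump that unfolding bumped_def by blast
  qed (use assms sets_D finite_m pos_m doubling in auto)
qed

text \<open>The two stopping parents of \<open>Q\<close> both contain \<open>Q\<close>, hence are
  comparable, and \<open>corona_half\<close> handles either order. The second order is the first
  with the measures exchanged and \<open>(q', p')\<close> in place of \<open>(p, q)\<close>,
  admissible because \<open>q' \<le> p'\<close>. Cubes counted twice do no harm, since all terms are
  nonnegative.\<close>

lemma dyadic_form_pos:
  fixes f g :: "'a \<Rightarrow> real"
  assumes p: "1 < p" "1 / p + 1 / p' = 1" and q: "1 < q" "1 / q + 1 / q' = 1" and "p < q"
    and sets: "sets \<mu> = sets m" "sets \<sigma> = sets m"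
    and fin: "\<And>Q. Q \<in> D \<Longrightarrow> emeasure \<mu> Q < \<infinity>" "\<And>Q. Q \<in> D \<Longrightarrow> emeasure \<sigma> Q < \<infinity>"
    and \<gamma>: "0 < \<gamma>" "\<gamma> < 1" and A: "0 \<le> A"
    and bump: "bumped D m \<mu> \<sigma> \<gamma> q p' A" "bumped D m \<sigma> \<mu> \<gamma> p' q A"
    and f: "f \<in> borel_measurable m" "\<And>x. 0 \<le> f x" "integrable \<sigma> (\<lambda>x. f x powr p)"
    and g: "g \<in> borel_measurable m" "\<And>x. 0 \<le> g x" "integrable \<mu> (\<lambda>x. g x powr q')"
    and pos: "\<And>Q. Q \<in> D \<Longrightarrow> 0 < average \<sigma> f Q" "\<And>Q. Q \<in> D \<Longrightarrow> 0 < average \<mu> g Q"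
  shows "(\<Sum>Q\<in>D. measure m Q powr (- \<gamma>) * (LINT x:Q|\<sigma>. f x) * (LINT x:Q|\<mu>. g x))
    \<le> dyadic_const \<gamma> p p' q q' * A * (LINT x|\<sigma>. f x powr p) powr (1 / p) * (LINT x|\<mu>. g x powr q') powr (1 / q')"
proof -
  have "1 / q' = 1 - 1 / q" "1 / p' = 1 - 1 / p" "1 / q < 1 / p"
    using p q \<open>p < q\<close> by (auto simp: frac_less2)
  moreover have "0 < 1 - 1 / q" "1 - 1 / q < 1" "0 < 1 - 1 / p" "1 - 1 / p < 1" using p q by auto
  ultimately have *: "0 < 1 / q'" "1 / q' < 1" "0 < 1 / p'" "1 / p' < 1" "1 / p' \<le> 1 / q'"
    "1 / q + 1 / p' < 1" by linarith+
  then have q': "1 < q'" and p': "1 < p'" "q' \<le> p'" by (auto simp: field_simps)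
  have sum1: "1 / q + 1 / p' < 1" "1 / p' + 1 / q < 1" using * by auto
  have w: "0 < measure \<sigma> Q" "0 < measure \<mu> Q" if "Q \<in> D" for Q
    using pos[OF that] by (auto simp: average_def zero_less_measure_iff)
  let ?lam = "\<lambda>Q. measure m Q powr (- \<gamma>)"
  let ?k = "\<lambda>Q. dyadic_level (average \<sigma> f Q)" and ?l = "\<lambda>Q. dyadic_level (average \<mu> g Q)"
  let ?X = "(LINT x|\<sigma>. f x powr p)" and ?Y = "(LINT x|\<mu>. g x powr q')"
  let ?C1 = "testing_const \<gamma> p' q" and ?C2 = "testing_const \<gamma> q p'"
  have C: "0 \<le> ?C1" "0 \<le> ?C2" by (rule testing_const_nonneg; fact)+
  have sD: "D \<subseteq> sets \<sigma>" "D \<subseteq> sets \<mu>" using sets sets_D by auto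
  have meas: "f \<in> borel_measurable \<sigma>" "g \<in> borel_measurable \<mu>"
    using f(1) g(1) sets by (auto cong: measurable_cong_sets)
  have qp: "q * (1 - 1 / p') = q / p" "p' * (1 - 1 / q) = p' / q'"
  proof -
    have "1 - 1 / p' = 1 / p" "1 - 1 / q = 1 / q'" using p q by linarith+
    then show "q * (1 - 1 / p') = q / p" "p' * (1 - 1 / q) = p' / q'" by simp_all
  qed
  have half1: "(\<Sum>Q | Q \<in> D \<and> parent ?l Q \<subseteq> parent ?k Q. ?lam Q * (LINT x:Q|\<sigma>. f x) * (LINT x:Q|\<mu>. g x))
    \<le> 4 * (?C1 powr (1 / q) * A) * (carleson_const p * ?X) powr (1 / p) * (carleson_const q' * ?Y) powr (1 / q')"
  proof (rule corona_half[OF p q])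
    show "(\<integral>\<^sup>+x. ennreal ((\<Sum>Q | Q \<in> D \<and> Q \<subseteq> R. ?lam Q * measure \<sigma> Q * indicator Q x) powr q) \<partial>\<mu>)
        \<le> ennreal ((?C1 powr (1 / q) * A) powr q * measure \<sigma> R powr (q / p))" if R: "R \<in> D" for R
    proof -
      have "(\<integral>\<^sup>+x. ennreal ((\<Sum>Q | Q \<in> D \<and> Q \<subseteq> R. ?lam Q * measure \<sigma> Q * indicator Q x) powr q) \<partial>\<mu>)
          \<le> ennreal (?C1 * A powr q * measure \<sigma> R powr (q * (1 - 1 / p')))"
        by (rule testing) (use sets fin w \<gamma> p' q sum1 A bump R in auto)
      also have "?C1 * A powr q * measure \<sigma> R powr (q * (1 - 1 / p'))
          = (?C1 powr (1 / q) * A) powr q * measure \<sigma> R powr (q / p)"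
        using q C by (simp add: powr_mult powr_powr qp)
      finally show ?thesis .
    qed
  qed (use \<open>p < q\<close> sD fin meas f g pos A in auto)
  have half2: "(\<Sum>Q | Q \<in> D \<and> parent ?k Q \<subseteq> parent ?l Q. ?lam Q * (LINT x:Q|\<mu>. g x) * (LINT x:Q|\<sigma>. f x))
    \<le> 4 * (?C2 powr (1 / p') * A) * (carleson_const q' * ?Y) powr (1 / q') * (carleson_const p * ?X) powr (1 / p)"
  proof (rule corona_half[where p = q' and p' = q and q = p' and q' = p])
    show "(\<integral>\<^sup>+x. ennreal ((\<Sum>Q | Q \<in> D \<and> Q \<subseteq> R. ?lam Q * measure \<mu> Q * indicator Q x) powr p') \<partial>\<sigma>)
        \<le> ennreal ((?C2 powr (1 / p') * A) powr p' * measure \<mu> R powr (p' / q'))" if R: "R \<in> D" for R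
    proof -
      have "(\<integral>\<^sup>+x. ennreal ((\<Sum>Q | Q \<in> D \<and> Q \<subseteq> R. ?lam Q * measure \<mu> Q * indicator Q x) powr p') \<partial>\<sigma>)
          \<le> ennreal (?C2 * A powr p' * measure \<mu> R powr (p' * (1 - 1 / q)))"
        by (rule testing) (use sets fin w \<gamma> p' q sum1 A bump R in auto)
      also have "?C2 * A powr p' * measure \<mu> R powr (p' * (1 - 1 / q))
          = (?C2 powr (1 / p') * A) powr p' * measure \<mu> R powr (p' / q')"
        using p' C by (simp add: powr_mult powr_powr qp)
      finally show ?thesis .
    qed
  qed (use p q p' q' sD fin meas f g pos A in \<open>auto simp: add.commute\<close>)
  let ?t = "\<lambda>Q. ?lam Q * (LINT x:Q|\<sigma>. f x) * (LINT x:Q|\<mu>. g x)"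
  let ?D1 = "{Q \<in> D. parent ?l Q \<subseteq> parent ?k Q}" and ?D2 = "{Q \<in> D. parent ?k Q \<subseteq> parent ?l Q}"
  have nn: "0 \<le> (LINT x:Q|\<sigma>. f x)" "0 \<le> (LINT x:Q|\<mu>. g x)" for Q
    using f g by (auto simp: set_lebesgue_integral_def)
  then have t: "0 \<le> ?t Q" for Q by simp
  have "D = ?D1 \<union> ?D2"
  proof -
    have "parent ?l Q \<subseteq> parent ?k Q \<or> parent ?k Q \<subseteq> parent ?l Q" if Q: "Q \<in> D" for Q
    proof -
      obtain x where "x \<in> Q" using Q nonempty by (metis ex_in_conv)
      then have "x \<in> parent ?l Q" "x \<in> parent ?k Q" using subset_parent[OF Q] by blast+
      moreover have "parent ?l Q \<in> D" "parent ?k Q \<in> D"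
        using parent_record[OF Q] records_subset by blast+
      ultimately show ?thesis by (intro comparable)
    qed
    then show ?thesis by auto
  qed
  then have "(\<Sum>Q\<in>D. ?t Q) = sum ?t (?D1 \<union> ?D2)" by simp
  also have "\<dots> \<le> sum ?t ?D1 + sum ?t ?D2"
    using finite_D sum_nonneg[of "?D1 \<inter> ?D2" ?t] t by (subst sum_Un) auto
  also have "sum ?t ?D2 = (\<Sum>Q | Q \<in> D \<and> parent ?k Q \<subseteq> parent ?l Q. ?lam Q * (LINT x:Q|\<mu>. g x) * (LINT x:Q|\<sigma>. f x))"
    by (simp add: mult_ac)
  also have "sum ?t ?D1 + \<dots> \<le> dyadic_const \<gamma> p p' q q' * A * ?X powr (1 / p) * ?Y powr (1 / q')"
    using add_mono[OF half1 half2] by (simp add: dyadic_const_def powr_mult algebra_simps)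
  finally show ?thesis .
qed

text \<open>The corona takes logarithms of averages, so they must be positive. A cube on which one
  average is not positive contributes zero, and deleting such cubes leaves a dyadic family.\<close>

lemma dyadic_form:
  fixes f g :: "'a \<Rightarrow> real"
  assumes p: "1 < p" "1 / p + 1 / p' = 1" and q: "1 < q" "1 / q + 1 / q' = 1" and "p < q"
    and sets: "sets \<mu> = sets m" "sets \<sigma> = sets m"
    and fin: "\<And>Q. Q \<in> D \<Longrightarrow> emeasure \<mu> Q < \<infinity>" "\<And>Q. Q \<in> D \<Longrightarrow> emeasure \<sigma> Q < \<infinity>"
    and \<gamma>: "0 < \<gamma>" "\<gamma> < 1" and A: "0 \<le> A"
    and bump: "bumped D m \<mu> \<sigma> \<gamma> q p' A" "bumped D m \<sigma> \<mu> \<gamma> p' q A"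
    and f: "f \<in> borel_measurable m" "\<And>x. 0 \<le> f x" "integrable \<sigma> (\<lambda>x. f x powr p)"
    and g: "g \<in> borel_measurable m" "\<And>x. 0 \<le> g x" "integrable \<mu> (\<lambda>x. g x powr q')"
  shows "(\<Sum>Q\<in>D. measure m Q powr (- \<gamma>) * (LINT x:Q|\<sigma>. f x) * (LINT x:Q|\<mu>. g x))
    \<le> dyadic_const \<gamma> p p' q q' * A * (LINT x|\<sigma>. f x powr p) powr (1 / p) * (LINT x|\<mu>. g x powr q') powr (1 / q')"
proof -
  let ?E = "{Q \<in> D. 0 < average \<sigma> f Q \<and> 0 < average \<mu> g Q}"
  interpret E: laminar ?E by (rule subfamily) auto
  interpret E: dyadic_family ?E m
    by unfold_locales (use sets_D finite_m pos_m doubling in auto)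
  have nn: "0 \<le> (LINT x:Q|\<sigma>. f x)" "0 \<le> (LINT x:Q|\<mu>. g x)" for Q
    using f g by (auto simp: set_lebesgue_integral_def)
  have zero: "(LINT x:Q|M. h x) = 0"
    if "\<not> 0 < average M h Q" "0 \<le> (LINT x:Q|M. h x)" "h \<in> borel_measurable M" "Q \<in> sets M"
      "emeasure M Q < \<infinity>" for M and h :: "'a \<Rightarrow> real" and Q
  \<comment> \<open>On a null set the average is 0 by the convention for division and carries no
    information; the integral vanishes there for another reason.\<close>
  proof (cases "measure M Q = 0")
    case True
    then have "emeasure M Q = 0" using that by (simp add: emeasure_eq_ennreal_measure less_top)
    then have "AE x in M. x \<notin> Q" using that by (intro AE_not_in) auto
    then show ?thesis
      unfolding set_lebesgue_integral_def by (intro integral_eq_zero_AE) (auto elim!: eventually_mono)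
  next
    case False
    then have "0 < measure M Q" by (simp add: zero_less_measure_iff)
    then show ?thesis using that by (auto simp: average_def zero_less_divide_iff)
  qed
  have meas: "f \<in> borel_measurable \<sigma>" "g \<in> borel_measurable \<mu>"
    using f(1) g(1) sets by (auto cong: measurable_cong_sets)
  have "(\<Sum>Q\<in>D. measure m Q powr (- \<gamma>) * (LINT x:Q|\<sigma>. f x) * (LINT x:Q|\<mu>. g x))
      = (\<Sum>Q\<in>?E. measure m Q powr (- \<gamma>) * (LINT x:Q|\<sigma>. f x) * (LINT x:Q|\<mu>. g x))"
  proof (rule sum.mono_neutral_right)
    show "\<forall>Q\<in>D - ?E. measure m Q powr (- \<gamma>) * (LINT x:Q|\<sigma>. f x) * (LINT x:Q|\<mu>. g x) = 0"
    proof
      fix Q assume Q: "Q \<in> D - ?E"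
      then have "Q \<in> sets \<sigma>" "Q \<in> sets \<mu>" using sets sets_D by auto
      then show "measure m Q powr (- \<gamma>) * (LINT x:Q|\<sigma>. f x) * (LINT x:Q|\<mu>. g x) = 0"
        using Q zero[OF _ nn(1) meas(1), of Q] zero[OF _ nn(2) meas(2), of Q] fin by auto
    qed
  qed (use finite_D in auto)
  also have "\<dots> \<le> dyadic_const \<gamma> p p' q q' * A * (LINT x|\<sigma>. f x powr p) powr (1 / p) * (LINT x|\<mu>. g x powr q') powr (1 / q')"
    by (rule E.dyadic_form_pos) (use assms in \<open>auto simp: bumped_def\<close>)
  finally show ?thesis .
qed

text \<open>Duality with \<^term>\<open>g = T powr (q - 1)\<close>, where \<^term>\<open>T\<close> is the dyadic operator applied to \<^term>\<open>f\<close>.\<close>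

lemma dyadic_norm:
  fixes f :: "'a \<Rightarrow> real"
  assumes p: "1 < p" "1 / p + 1 / p' = 1" and q: "1 < q" and "p < q"
    and sets: "sets \<mu> = sets m" "sets \<sigma> = sets m"
    and fin: "\<And>Q. Q \<in> D \<Longrightarrow> emeasure \<mu> Q < \<infinity>" "\<And>Q. Q \<in> D \<Longrightarrow> emeasure \<sigma> Q < \<infinity>"
    and \<gamma>: "0 < \<gamma>" "\<gamma> < 1" and A: "0 \<le> A"
    and bump: "bumped D m \<mu> \<sigma> \<gamma> q p' A" "bumped D m \<sigma> \<mu> \<gamma> p' q A"
    and f: "f \<in> borel_measurable m" "\<And>x. 0 \<le> f x" "integrable \<sigma> (\<lambda>x. f x powr p)"
  shows "(\<integral>\<^sup>+x. ennreal ((\<Sum>Q\<in>D. measure m Q powr (- \<gamma>) * (LINT x:Q|\<sigma>. f x) * indicator Q x) powr q) \<partial>\<mu>)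
    \<le> ennreal ((dyadic_const \<gamma> p p' q (q / (q - 1)) * A) powr q * (LINT x|\<sigma>. f x powr p) powr (q / p))"
proof -
  define q' where "q' = q / (q - 1)"
  have q': "1 / q + 1 / q' = 1" "0 < q'" "(q - 1) * q' = q"
    using q by (auto simp: q'_def field_simps)
  let ?c = "\<lambda>Q. measure m Q powr (- \<gamma>) * (LINT x:Q|\<sigma>. f x)"
  let ?X = "(LINT x|\<sigma>. f x powr p)"
  define T where "T = (\<lambda>x. \<Sum>Q\<in>D. ?c Q * indicator Q x :: real)"
  have c: "0 \<le> ?c Q" for Q using f by (auto simp: set_lebesgue_integral_def)
  have T: "0 \<le> T x" for x unfolding T_def using c by (intro sum_nonneg) auto
  have T_meas: "T \<in> borel_measurable m" unfolding T_def
    using sets_D by (intro borel_measurable_sum borel_measurable_times borel_measurable_const borel_measurable_indicator) auto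
  have sD: "D \<subseteq> sets \<mu>" using sets sets_D by auto
  have T_meas': "T \<in> borel_measurable \<mu>" using T_meas sets by (simp cong: measurable_cong_sets)
  have UD: "\<Union>D \<in> fmeasurable \<mu>"
    using sD fin finite_D by (intro fmeasurable.finite_Union) (auto simp: fmeasurable_def)
  \<comment> \<open>\<open>T\<close> is bounded and supported on a set of finite measure, so
    \<open>?I\<close> is finite. Only then may a power of \<open>?I\<close> be cancelled at the end
    of the duality argument.\<close>
  have int_q: "integrable \<mu> (\<lambda>x. T x powr q)"
  proof (rule Bochner_Integration.integrable_bound)
    show "integrable \<mu> (\<lambda>x. (\<Sum>Q\<in>D. ?c Q) powr q * indicator (\<Union>D) x)"
      using UD by (auto simp: fmeasurable_def)
    have "T x powr q \<le> (\<Sum>Q\<in>D. ?c Q) powr q * indicator (\<Union>D) x" for x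
    proof (cases "x \<in> \<Union>D")
      case True
      have "T x \<le> (\<Sum>Q\<in>D. ?c Q)"
        unfolding T_def using c by (intro sum_mono mult_left_le) (auto simp: indicator_def)
      then show ?thesis using True T q by (auto intro: powr_mono2)
    next
      case False
      then have "T x = 0" unfolding T_def by (intro sum.neutral) auto
      then show ?thesis by simp
    qed
    then show "AE x in \<mu>. norm (T x powr q) \<le> norm ((\<Sum>Q\<in>D. ?c Q) powr q * indicator (\<Union>D) x)"
      by (auto simp: abs_mult)
  qed (use T_meas' in measurable)
  let ?I = "LINT x|\<mu>. T x powr q"
  have I: "0 \<le> ?I" by simp
  let ?g = "\<lambda>x. T x powr (q - 1)"
  have g_q': "(\<lambda>x. ?g x powr q') = (\<lambda>x. T x powr q)" using q' by (simp add: powr_powr)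
  have "1 < q'" using q by (simp add: q'_def field_simps)
  then have int_g: "integrable \<mu> (\<lambda>x. indicator Q x * ?g x)" if "Q \<in> D" for Q
    using that sD fin T_meas' int_q g_q' by (intro set_integrable_powr[where p = q']) auto
  have "?I = (LINT x|\<mu>. (\<Sum>Q\<in>D. ?c Q * (indicator Q x * ?g x)))"
  proof (rule Bochner_Integration.integral_cong[OF refl])
    fix x
    have "T x powr q = T x * T x powr (q - 1)" using T q by (simp add: powr_mult_base)
    then show "T x powr q = (\<Sum>Q\<in>D. ?c Q * (indicator Q x * ?g x))"
      by (simp add: T_def sum_distrib_right mult_ac)
  qed
  also have "\<dots> = (\<Sum>Q\<in>D. ?c Q * (LINT x:Q|\<mu>. ?g x))"
    using int_g by (subst Bochner_Integration.integral_sum) (auto simp: set_lebesgue_integral_def)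
  also have "\<dots> \<le> dyadic_const \<gamma> p p' q q' * A * ?X powr (1 / p) * (LINT x|\<mu>. ?g x powr q') powr (1 / q')"
  proof (rule dyadic_form)
    show "integrable \<mu> (\<lambda>x. ?g x powr q')" using int_q g_q' by simp
    show "?g \<in> borel_measurable m" using T_meas by measurable
  qed (use assms q' in auto)
  also have "(LINT x|\<mu>. ?g x powr q') = ?I" using g_q' by simp
  finally have le: "?I \<le> dyadic_const \<gamma> p p' q q' * A * ?X powr (1 / p) * ?I powr (1 / q')" .
  let ?N = "dyadic_const \<gamma> p p' q q' * A * ?X powr (1 / p)"
  have N: "0 \<le> ?N" using dyadic_const_nonneg A by auto
  have "?I \<le> ?N powr q"
  proof (cases "?I = 0")
    case False
    with I have pos: "0 < ?I" by (rule le_neq_trans[OF _ not_sym])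
    have "?I powr (1 / q) * ?I powr (1 / q') = ?I"
      using q' I by (simp flip: powr_add)
    then have "?I powr (1 / q) * ?I powr (1 / q') \<le> ?N * ?I powr (1 / q')" using le by simp
    then have "?I powr (1 / q) \<le> ?N" using pos by (simp add: mult_le_cancel_right)
    then have "(?I powr (1 / q)) powr q \<le> ?N powr q" using q by (intro powr_mono2) auto
    then show ?thesis using q I by (simp add: powr_powr)
  qed simp
  moreover have "(\<integral>\<^sup>+x. ennreal (T x powr q) \<partial>\<mu>) = ennreal ?I"
    using int_q by (intro nn_integral_eq_integral) auto
  moreover have "?N powr q = (dyadic_const \<gamma> p p' q q' * A) powr q * ?X powr (q / p)"
    by (simp add: powr_mult powr_powr)
  ultimately show ?thesis unfolding T_def q'_def by (simp add: ennreal_leI)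
qed

end

section \<open>Dyadic grids\<close>

text \<open>\<open>t\<close> is the set of coordinates in which the grid is shifted by a third of
  its side, which gives one grid for each subset of the coordinates.\<close>

definition grid_index :: "'n set \<Rightarrow> int \<Rightarrow> real ^ 'n \<Rightarrow> 'n \<Rightarrow> int" where
  "grid_index t k x i = \<lfloor>x $ i / 4 powr k - (if i \<in> t then 1 / 3 else 0)\<rfloor>"

definition cell :: "'n set \<Rightarrow> int \<Rightarrow> ('n \<Rightarrow> int) \<Rightarrow> (real ^ 'n) set" where
  "cell t k j = {x. grid_index t k x = j}"

definition corner :: "'n set \<Rightarrow> int \<Rightarrow> ('n \<Rightarrow> int) \<Rightarrow> real ^ 'n" where
  "corner t k j = (\<chi> i. 4 powr k * (j i + (if i \<in> t then 1 / 3 else 0)))"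

text \<open>Half-open cells are exactly nested, while the suprema run over closed cubes. Both
  versions of a cell have the same volume.\<close>

definition closed_cell :: "'n set \<Rightarrow> int \<Rightarrow> ('n \<Rightarrow> int) \<Rightarrow> (real ^ 'n) set" where
  "closed_cell t k j = cbox (corner t k j) (corner t k j + (\<chi> i. 4 powr k))"

text \<open>The shift is the same at every scale: since \<open>4 / 3 - 1 / 3\<close> is an integer, the grids
  of side \<open>4 ^ k\<close> shifted by \<open>4 ^ k / 3\<close> are nested.\<close>

definition grid_family :: "'n set \<Rightarrow> nat \<Rightarrow> (real ^ 'n) set set" where
  "grid_family t N = (\<lambda>(k, j). cell t k j) ` ({- int N..int N} \<times> {j. \<forall>i. j i \<in> {- int N..int N}})"

lemma mem_cell_iff:
  "x \<in> cell t k j \<longleftrightarrow> (\<forall>i. corner t k j $ i \<le> x $ i \<and> x $ i < corner t k j $ i + 4 powr k)"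
proof -
  have "grid_index t k x i = j i \<longleftrightarrow> corner t k j $ i \<le> x $ i \<and> x $ i < corner t k j $ i + 4 powr k" for i
  proof -
    have "0 < (4::real) powr k" by simp
    then show ?thesis
      unfolding grid_index_def corner_def floor_eq_iff
      by (auto simp: field_simps)
  qed
  then show ?thesis by (auto simp: cell_def fun_eq_iff)
qed

lemma cell_subset: "cell t k j \<subseteq> closed_cell t k j"
  by (simp add: subset_iff mem_cell_iff closed_cell_def mem_box_cart) (meson less_imp_le)

lemma box_subset_cell: "box (corner t k j) (corner t k j + (\<chi> i. 4 powr k)) \<subseteq> cell t k j"
  by (simp add: subset_iff mem_cell_iff mem_box_cart) (meson less_imp_le)

lemma corner_in_cell: "corner t k j \<in> cell t k j"
  by (auto simp: mem_cell_iff)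

lemma closed_cell_cubes: "closed_cell t k j \<in> cubes"
  unfolding closed_cell_def cubes_def mem_Collect_eq by (intro exI conjI) (rule refl, simp)

lemma cell_sets [measurable]: "cell t k (j :: 'n::finite \<Rightarrow> int) \<in> sets borel"
proof -
  have "cell t k j = {x \<in> space borel. \<forall>i. corner t k j $ i \<le> x $ i \<and> x $ i < corner t k j $ i + 4 powr k}"
    by (auto simp: mem_cell_iff)
  also have "\<dots> \<in> sets borel" by measurable
  finally show ?thesis .
qed

lemma cell_sets_lebesgue: "cell t k (j :: 'n::finite \<Rightarrow> int) \<in> sets lebesgue"
  using cell_sets sets_completionI_sets[of _ lborel] by auto

lemma emeasure_cell:
  fixes j :: "'n::finite \<Rightarrow> int"
  shows "emeasure lebesgue (cell t k j) = ennreal (4 powr (real_of_int k * real CARD('n)))"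
    and "emeasure lebesgue (closed_cell t k j) = ennreal (4 powr (real_of_int k * real CARD('n)))"
proof -
  let ?a = "corner t k j" and ?b = "corner t k j + (\<chi> i. 4 powr k)"
  have p: "(\<Prod>b\<in>Basis. (?b - ?a) \<bullet> b) = 4 powr (real_of_int k * real CARD('n))"
  proof -
    have "(\<Prod>b\<in>Basis. (?b - ?a) \<bullet> b) = (\<Prod>b\<in>(Basis :: (real ^ 'n) set). 4 powr k)"
      by (intro prod.cong) (auto simp: Basis_vec_def inner_axis)
    also have "\<dots> = (4 powr k) ^ CARD('n)" by simp
    also have "\<dots> = 4 powr (real_of_int k * real CARD('n))"
      by (simp add: powr_powr flip: powr_realpow)
    finally show ?thesis .
  qed
  have le: "\<forall>b\<in>Basis. ?a \<bullet> b \<le> ?b \<bullet> b" by (auto simp: Basis_vec_def inner_axis)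
  have cbox: "emeasure lborel (cbox ?a ?b) = ennreal (4 powr (real_of_int k * real CARD('n)))"
    using le p by (simp add: emeasure_lborel_cbox_eq)
  have box: "emeasure lborel (box ?a ?b) = ennreal (4 powr (real_of_int k * real CARD('n)))"
    using le p by (simp add: emeasure_lborel_box_eq)
  have "emeasure lborel (cell t k j) = ennreal (4 powr (real_of_int k * real CARD('n)))"
  proof (rule antisym)
    show "emeasure lborel (cell t k j) \<le> ennreal (4 powr (real_of_int k * real CARD('n)))"
      unfolding cbox[symmetric] using cell_subset by (intro emeasure_mono) (auto simp: closed_cell_def)
    show "ennreal (4 powr (real_of_int k * real CARD('n))) \<le> emeasure lborel (cell t k j)"
      unfolding box[symmetric] using box_subset_cell by (intro emeasure_mono) auto
  qed
  then show "emeasure lebesgue (cell t k j) = ennreal (4 powr (real_of_int k * real CARD('n)))"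
    by simp
  show "emeasure lebesgue (closed_cell t k j) = ennreal (4 powr (real_of_int k * real CARD('n)))"
    using cbox by (simp add: closed_cell_def)
qed

lemma measure_cell:
  fixes j :: "'n::finite \<Rightarrow> int"
  shows "measure lebesgue (cell t k j) = 4 powr (real_of_int k * real CARD('n))"
    and "measure lebesgue (closed_cell t k j) = 4 powr (real_of_int k * real CARD('n))"
  using emeasure_cell by (auto simp: measure_def)

text \<open>The shift satisfies \<open>1 / 3 = (1 / 3 + 1) / 4\<close>, so the index at the next
  scale depends on \<open>x\<close> only through the index at this one. Hence points that share a
  cell share all larger cells.\<close>

lemma grid_index_Suc:
  "grid_index t (k + 1) x i = (grid_index t k x i - (if i \<in> t then 1 else 0)) div 4"
proof -
  let ?s = "if i \<in> t then 1 / 3 else 0 :: real" and ?r = "if i \<in> t then 1 else 0 :: int"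
  have "x $ i / 4 powr real_of_int (k + 1) - ?s = (x $ i / 4 powr k - ?s - real_of_int ?r) / real_of_int 4"
    by (simp add: powr_add field_simps)
  then have "grid_index t (k + 1) x i = \<lfloor>x $ i / 4 powr k - ?s - real_of_int ?r\<rfloor> div 4"
    unfolding grid_index_def using floor_divide_real_eq_div[of 4] by (simp del: of_int_numeral)
  then show ?thesis by (simp add: grid_index_def)
qed

lemma grid_index_mono:
  assumes "grid_index t k x = grid_index t k y" "k \<le> l"
  shows "grid_index t l x = grid_index t l y"
  using assms(2)
proof (induction l rule: int_ge_induct)
  case (step l)
  then show ?case by (auto simp: grid_index_Suc)
qed (fact assms(1))

lemma cell_mono:
  assumes "x \<in> cell t k j" "x \<in> cell t l j'" "k \<le> l"
  shows "cell t k j \<subseteq> cell t l j'"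
proof
  fix y assume "y \<in> cell t k j"
  then have "grid_index t k y = grid_index t k x" using assms(1) by (simp add: cell_def)
  then have "grid_index t l y = grid_index t l x" using assms(3) by (rule grid_index_mono)
  then show "y \<in> cell t l j'" using assms(2) by (simp add: cell_def)
qed

lemma dyadic_grid_family: "dyadic_family (grid_family t N :: (real ^ 'n::finite) set set) lebesgue"
proof unfold_locales
  have "finite {j :: 'n \<Rightarrow> int. \<forall>i. j i \<in> {- int N..int N}}"
    using finite_set_of_finite_funs[of "UNIV :: 'n set" "{- int N..int N}" 0] by simp
  then show "finite (grid_family t N)" by (auto simp: grid_family_def)
  show "{} \<notin> grid_family t N"
    using corner_in_cell by (auto simp: grid_family_def)
  show "P \<inter> Q = {} \<or> P \<subseteq> Q \<or> Q \<subseteq> P" if PQ: "P \<in> grid_family t N" "Q \<in> grid_family t N" for P Q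
  proof -
    obtain k j l j' where "P = cell t k j" "Q = cell t l j'" using PQ by (auto simp: grid_family_def)
    then show ?thesis using cell_mono[of _ t k j l j'] cell_mono[of _ t l j' k j] by (cases "k \<le> l") auto
  qed
  show "grid_family t N \<subseteq> sets lebesgue"
    using cell_sets_lebesgue by (auto simp: grid_family_def)
  show "emeasure lebesgue Q < \<infinity>" "0 < measure lebesgue Q" if "Q \<in> grid_family t N" for Q
    using that by (auto simp: grid_family_def emeasure_cell measure_cell)
  show "2 * measure lebesgue Q \<le> measure lebesgue P"
    if PQ: "P \<in> grid_family t N" "Q \<in> grid_family t N" "Q \<subset> P" for P Q
  proof -
    obtain k j l j' where *: "P = cell t k j" "Q = cell t l j'" using PQ by (auto simp: grid_family_def)
    have "\<not> k \<le> l"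
      using cell_mono[of "corner t l j'" t k j l j'] corner_in_cell[of t l j'] * PQ(3) by auto
    then have "real_of_int l * real CARD('n) + 1 \<le> real_of_int k * real CARD('n)"
    proof -
      have "1 * 1 \<le> (real_of_int k - real_of_int l) * real CARD('n)"
        using \<open>\<not> k \<le> l\<close> by (intro mult_mono) (auto simp: Suc_le_eq)
      then show ?thesis by (simp add: left_diff_distrib)
    qed
    then have "4 powr (real_of_int l * real CARD('n) + 1) \<le> 4 powr (real_of_int k * real CARD('n))"
      by simp
    then have "4 * 4 powr (real_of_int l * real CARD('n)) \<le> 4 powr (real_of_int k * real CARD('n))"
      by (simp add: powr_add)
    moreover have "2 * 4 powr (real_of_int l * real CARD('n)) \<le> 4 * 4 powr (real_of_int l * real CARD('n))"
      by (intro mult_right_mono) auto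
    ultimately show ?thesis unfolding * measure_cell by (rule order_trans[rotated])
  qed
qed

lemma grid_family_mono: "N \<le> N' \<Longrightarrow> grid_family t N \<subseteq> grid_family t N'"
proof -
  assume "N \<le> N'"
  then have "{- int N..int N} \<subseteq> {- int N'..int N'}" by auto
  then show ?thesis unfolding grid_family_def by (intro image_mono Sigma_mono) blast+
qed

text \<open>If both floors separated \<open>r\<close> from \<open>s\<close>, an integer and an
  integer plus \<open>1 / 3\<close> would lie between them, at distance less than
  \<open>1 / 3\<close>; such numbers are at least \<open>1 / 3\<close> apart.\<close>

lemma floor_or_shifted_floor_eq:
  fixes r s :: real
  assumes "\<bar>r - s\<bar> < 1 / 3"
  shows "\<lfloor>r\<rfloor> = \<lfloor>s\<rfloor> \<or> \<lfloor>r - 1 / 3\<rfloor> = \<lfloor>s - 1 / 3\<rfloor>"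
proof -
  have False if "\<lfloor>r\<rfloor> < \<lfloor>s\<rfloor>" "\<lfloor>r - 1 / 3\<rfloor> < \<lfloor>s - 1 / 3\<rfloor>" "s - r < 1 / 3" for r s :: real
  proof -
    define b d where "b = \<lfloor>s\<rfloor>" and "d = \<lfloor>s - 1 / 3\<rfloor>"
    have "r < real_of_int b" "r - 1 / 3 < real_of_int d"
      using that(1,2) by (simp_all add: b_def d_def floor_less_iff)
    moreover have "real_of_int b \<le> s" "real_of_int d \<le> s - 1 / 3"
      unfolding b_def d_def by (rule of_int_floor_le)+
    ultimately have "real_of_int d < real_of_int b" "real_of_int b < real_of_int (d + 1)"
      using that(3) by (simp, linarith)+
    then show False by (simp only: of_int_less_iff)
  qed
  moreover have "r < s" if "\<lfloor>r\<rfloor> < \<lfloor>s\<rfloor>" for r s :: real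
    using that by (rule floor_less_cancel)
  ultimately show ?thesis using assms
    by (smt (verit) linorder_neqE)
qed

text \<open>The one-third trick in each coordinate: the side \<open>4 powr k\<close> is the least
  one exceeding \<open>3 * norm (x - y)\<close>, and the grid is shifted exactly in those
  coordinates where the unshifted one separates \<open>x\<close> from \<open>y\<close>.\<close>

lemma ex_common_cell:
  fixes x y :: "real ^ 'n::finite"
  assumes "x \<noteq> y"
  obtains t N k j where "cell t k j \<in> grid_family t N" "x \<in> cell t k j" "y \<in> cell t k j"
    "4 powr k \<le> 12 * norm (x - y)"
proof -
  let ?r = "norm (x - y)"
  have r: "0 < ?r" using assms by simp
  define k where "k = \<lfloor>log 4 (3 * ?r)\<rfloor> + 1"
  have k: "3 * ?r < 4 powr k" "4 powr k \<le> 12 * ?r"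
  proof -
    have "4 powr \<lfloor>log 4 (3 * ?r)\<rfloor> \<le> 3 * ?r" "3 * ?r < 4 powr (\<lfloor>log 4 (3 * ?r)\<rfloor> + 1)"
      using floor_log_eq_powr_iff[of "3 * ?r" 4 "\<lfloor>log 4 (3 * ?r)\<rfloor>"] r by auto
    then show "3 * ?r < 4 powr k" "4 powr k \<le> 12 * ?r" by (auto simp: k_def powr_add)
  qed
  define t where "t = {i. \<lfloor>x $ i / 4 powr k\<rfloor> \<noteq> \<lfloor>y $ i / 4 powr k\<rfloor>}"
  define j where "j = grid_index t k x"
  have eq: "grid_index t k x i = grid_index t k y i" for i
  proof -
    have "\<bar>x $ i / 4 powr k - y $ i / 4 powr k\<bar> = \<bar>(x - y) $ i\<bar> / 4 powr k"
      by (simp flip: diff_divide_distrib)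
    also have "\<dots> \<le> ?r / 4 powr k" by (intro divide_right_mono component_le_norm_cart) auto
    also have "\<dots> < 1 / 3" using k by (simp add: field_simps)
    finally show ?thesis
      using floor_or_shifted_floor_eq[of "x $ i / 4 powr k" "y $ i / 4 powr k"]
      by (auto simp: grid_index_def t_def)
  qed
  define N where "N = nat (Max (insert \<bar>k\<bar> (range (\<lambda>i. \<bar>j i\<bar>))))"
  have N: "\<bar>k\<bar> \<le> int N" "\<bar>j i\<bar> \<le> int N" for i
  proof -
    let ?M = "Max (insert \<bar>k\<bar> (range (\<lambda>i. \<bar>j i\<bar>)))"
    have "\<bar>k\<bar> \<le> ?M" "\<bar>j i\<bar> \<le> ?M" by (rule Max_ge; simp)+
    then show "\<bar>k\<bar> \<le> int N" "\<bar>j i\<bar> \<le> int N" by (auto simp: N_def)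
  qed
  show thesis
  proof (rule that)
    have "k \<in> {- int N..int N}" "\<forall>i. j i \<in> {- int N..int N}" using N by (auto simp: abs_le_iff minus_le_iff)
    then show "cell t k j \<in> grid_family t N" unfolding grid_family_def by force
    show "x \<in> cell t k j" "y \<in> cell t k j" using eq by (auto simp: cell_def j_def fun_eq_iff)
  qed (fact k)
qed

section \<open>The bump condition\<close>

text \<open>The summand \<open>exp (exp 1)\<close> keeps the iterated logarithm at least 1, so its
  power is at least 1.\<close>

lemma loglog_bump_ge:
  assumes "1 < a" "0 \<le> \<delta>" "0 \<le> t"
  shows "t powr a * ln (exp 1 + t) powr (a - 1) \<le> loglog_bump a \<delta> t"
proof -
  have "exp 1 \<le> ln (exp (exp 1) + t)"
    using assms by (subst ln_ge_iff) (auto intro: add_pos_nonneg)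
  moreover have "(0::real) < exp 1" by simp
  ultimately have "1 \<le> ln (ln (exp (exp 1) + t))"
    by (subst ln_ge_iff) linarith+
  then have "1 \<le> ln (ln (exp (exp 1) + t)) powr (a - 1 + \<delta>)"
    using assms by (intro ge_one_powr_ge_zero) auto
  then have "t powr a * ln (exp 1 + t) powr (a - 1) * 1 \<le> loglog_bump a \<delta> t"
    unfolding loglog_bump_def by (intro mult_left_mono) auto
  then show ?thesis by simp
qed

text \<open>This is \<open>z \<le> exp z\<close> to the power \<open>c\<close>, with
  \<open>z\<close> scaled so that the right side becomes \<open>2 powr (y / 2)\<close>.\<close>

lemma powr_le_exponential:
  fixes y c :: real
  assumes "0 < c" "0 < y"
  shows "y powr c \<le> (2 * c / ln 2) powr c * 2 powr (y / 2)"
proof -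
  define z where "z = y * ln 2 / (2 * c)"
  have z: "0 < z" using assms by (simp add: z_def)
  have "z \<le> exp z" using exp_ge_add_one_self[of z] by linarith
  then have "z powr c \<le> exp z powr c" using z assms by (intro powr_mono2) auto
  also have "\<dots> = 2 powr (y / 2)" using assms by (simp add: powr_def z_def)
  finally have "z powr c \<le> 2 powr (y / 2)" .
  moreover have "y = 2 * c / ln 2 * z" using assms by (simp add: z_def)
  ultimately show ?thesis by (metis powr_mult mult_left_mono powr_ge_zero)
qed

text \<open>The two terms are the small and the large part of the splitting in
  \<open>emeasure_density_le_bump\<close>. The threshold \<open>2 powr (d / 2)\<close> is balanced:
  multiplied by the relative size \<open>2 * (1 / 2) ^ d\<close> it still decays exponentially, yet
  the logarithm at its root of order \<open>a\<close> is still of order \<open>d\<close>.\<close>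

lemma bump_decay:
  fixes a :: real
  assumes a: "1 < a"
  obtains c where "0 < c" "\<And>d :: nat. 2 * (1 / 2) ^ d * 2 powr (d / 2)
      + 1 / ln (exp 1 + 2 powr (d / 2 / a)) powr (a - 1) \<le> c * (1 + real d) powr (- (a - 1))"
proof -
  let ?k = "(2 * (a - 1) / ln 2) powr (a - 1)" and ?l = "(1 + 2 * a / ln 2) powr (a - 1)"
  have le: "2 * (1 / 2) ^ d * 2 powr (d / 2) + 1 / ln (exp 1 + 2 powr (d / 2 / a)) powr (a - 1)
      \<le> (4 * ?k + ?l) * (1 + real d) powr (- (a - 1))" for d :: nat
  proof -
    let ?y = "1 + real d"
    have yk: "?y powr (a - 1) \<le> ?k * 2 powr (?y / 2)" using a by (intro powr_le_exponential) auto
    have "2 * (1 / 2) ^ d * 2 powr (d / 2) = 2 * 2 powr (- (d / 2))"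
    proof -
      have "(1 / 2) ^ d = 2 powr (- real d)"
        by (simp add: powr_minus powr_realpow power_one_over inverse_eq_divide)
      then show ?thesis by (simp flip: powr_add)
    qed
    also have "\<dots> \<le> 4 * ?k * ?y powr (- (a - 1))"
    proof -
      have "2 powr (?y / 2) \<le> 2 * 2 powr (d / 2)"
      proof -
        have "2 powr (?y / 2) \<le> 2 powr (1 + d / 2)" by (simp add: field_simps)
        then show ?thesis by (simp add: powr_add)
      qed
      then have "?k * 2 powr (?y / 2) \<le> ?k * (2 * 2 powr (d / 2))" by (intro mult_left_mono) auto
      with yk have yk': "?y powr (a - 1) \<le> 2 * ?k * 2 powr (d / 2)" by linarith
      have key: "2 * inverse E \<le> 4 * k * inverse Y" if "Y \<le> 2 * k * E" "0 < Y" "0 < E"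
        for E Y k :: real using that by (simp add: field_simps)
      have "2 * inverse (2 powr (d / 2)) \<le> 4 * ?k * inverse (?y powr (a - 1))"
        by (rule key[OF yk']) auto
      then show ?thesis by (simp only: powr_minus)
    qed
    finally have 1: "2 * (1 / 2) ^ d * 2 powr (d / 2) \<le> 4 * ?k * ?y powr (- (a - 1))" .
    let ?L = "ln (exp 1 + 2 powr (d / 2 / a))"
    have L1: "1 \<le> ?L" by (subst ln_ge_iff) (auto intro: add_pos_pos)
    have "d / 2 / a * ln 2 = ln (2 powr (d / 2 / a))" by simp
    also have "\<dots> \<le> ?L" by (subst ln_le_cancel_iff) (auto intro: add_pos_pos)
    finally have "d / 2 / a * ln 2 \<le> ?L" .
    then have "(2 * a / ln 2) * (d / 2 / a * ln 2) \<le> (2 * a / ln 2) * ?L"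
      using a by (intro mult_left_mono) auto
    then have "real d \<le> 2 * a / ln 2 * ?L" using a by simp
    then have "?y \<le> (1 + 2 * a / ln 2) * ?L" using L1 by (simp add: distrib_right)
    then have "?y powr (a - 1) \<le> ((1 + 2 * a / ln 2) * ?L) powr (a - 1)" using a by (intro powr_mono2) auto
    then have yl: "?y powr (a - 1) \<le> ?l * ?L powr (a - 1)" by (simp add: powr_mult)
    have key: "1 / E \<le> k * inverse Y" if "Y \<le> k * E" "0 < Y" "0 < E"
      for E Y k :: real using that by (simp add: field_simps)
    have "1 / ?L powr (a - 1) \<le> ?l * inverse (?y powr (a - 1))"
      by (rule key[OF yl]) (use L1 in auto)
    then have 2: "1 / ?L powr (a - 1) \<le> ?l * ?y powr (- (a - 1))" by (simp only: powr_minus)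
    show ?thesis unfolding distrib_right by (rule add_mono[OF 1 2])
  qed
  have "0 < 1 + 2 * a / ln 2" using a by (intro add_pos_nonneg) auto
  then have "0 < 4 * ?k + ?l" by (intro add_nonneg_pos) auto
  then show thesis using le by (rule that)
qed

text \<open>Splitting at \<^term>\<open>u = s powr a * T\<close> with \<^term>\<open>T = 2 powr (d / 2)\<close>: the small values
  contribute little because \<^term>\<open>\<Omega>\<close> is small, and the large ones gain the logarithm.\<close>

lemma emeasure_density_le_bump:
  fixes u :: "real ^ 'n \<Rightarrow> real"
  assumes a: "1 < a" and \<delta>: "0 \<le> \<delta>" and c: "\<And>d :: nat. 2 * (1 / 2) ^ d * 2 powr (d / 2)
      + 1 / ln (exp 1 + 2 powr (d / 2 / a)) powr (a - 1) \<le> c * (1 + real d) powr (- (a - 1))"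
    and u: "u \<in> borel_measurable lebesgue" "\<And>x. 0 \<le> u x"
    and s: "0 < s" "(\<integral>\<^sup>+x\<in>Q. ennreal (loglog_bump a \<delta> (\<bar>u x powr (1 / a)\<bar> / s)) \<partial>lebesgue) \<le> ennreal v"
    and Q: "Q \<in> sets lebesgue" "0 < v"
    and \<Omega>: "\<Omega> \<in> sets lebesgue" "\<Omega> \<subseteq> Q" "emeasure lebesgue \<Omega> \<le> ennreal (2 * (1 / 2) ^ d * v)"
  shows "emeasure (density lebesgue u) \<Omega> \<le> ennreal (c * s powr a * v * (1 + real d) powr (- (a - 1)))"
proof -
  let ?T = "2 powr (d / 2) :: real" and ?L = "ln (exp 1 + 2 powr (d / 2 / a)) powr (a - 1)"
  let ?\<phi> = "\<lambda>x. loglog_bump a \<delta> (\<bar>u x powr (1 / a)\<bar> / s)"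
  have [measurable]: "u \<in> borel_measurable lebesgue" "Q \<in> sets lebesgue" "\<Omega> \<in> sets lebesgue" by fact+
  have ln1: "1 \<le> ln (exp 1 + 2 powr (d / 2 / a) :: real)"
    by (subst ln_ge_iff) (auto intro: add_pos_pos)
  then have L: "0 < ?L" by simp
  have sT: "0 \<le> s powr a * ?T" and sL: "0 \<le> s powr a / ?L" using L by auto
  have \<phi>_nonneg: "0 \<le> ?\<phi> x" for x by (simp add: loglog_bump_def)
  have \<phi>_meas: "(\<lambda>x. ennreal (?\<phi> x)) \<in> borel_measurable lebesgue"
    unfolding loglog_bump_def by measurable
  have pw: "u x \<le> s powr a * ?T + s powr a / ?L * ?\<phi> x" for x
  proof (cases "u x \<le> s powr a * ?T")
    case True
    then show ?thesis using L \<phi>_nonneg by (simp add: add_increasing2)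
  next
    case False
    let ?t = "u x powr (1 / a) / s"
    have t: "?t powr a = u x / s powr a" using a s u by (simp add: powr_divide powr_powr)
    have "?T powr (1 / a) \<le> (u x / s powr a) powr (1 / a)"
      using False a s by (intro powr_mono2) (auto simp: field_simps)
    also have "\<dots> = ?t" using a s by (simp add: powr_divide powr_powr)
    finally have tT: "2 powr (d / 2 / a) \<le> ?t" by (simp add: powr_powr)
    have t0: "0 \<le> ?t" using s by simp
    have "?L \<le> ln (exp 1 + ?t) powr (a - 1)"
    proof (rule powr_mono2)
      show "ln (exp 1 + 2 powr (d / 2 / a)) \<le> ln (exp 1 + ?t)"
        using tT by (intro ln_mono) (auto intro: add_pos_pos)
    qed (use a ln1 in linarith)+
    then have "u x / s powr a * ?L \<le> ?t powr a * ln (exp 1 + ?t) powr (a - 1)"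
      unfolding t using u s by (intro mult_left_mono) auto
    also have "\<dots> \<le> ?\<phi> x" using loglog_bump_ge[OF a \<delta> t0] by simp
    finally have "u x \<le> s powr a / ?L * ?\<phi> x" using s L by (simp add: field_simps)
    then show ?thesis using s by (simp add: add_increasing)
  qed
  have "emeasure (density lebesgue u) \<Omega> = (\<integral>\<^sup>+x\<in>\<Omega>. ennreal (u x) \<partial>lebesgue)"
    by (subst emeasure_density) auto
  also have "\<dots> \<le> (\<integral>\<^sup>+x. ennreal (s powr a * ?T) * indicator \<Omega> x
      + ennreal (s powr a / ?L) * (ennreal (?\<phi> x) * indicator Q x) \<partial>lebesgue)"
  proof (rule nn_integral_mono)
    fix x
    show "ennreal (u x) * indicator \<Omega> x \<le> ennreal (s powr a * ?T) * indicator \<Omega> x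
      + ennreal (s powr a / ?L) * (ennreal (?\<phi> x) * indicator Q x)"
    proof (cases "x \<in> \<Omega>")
      case True
      have "ennreal (u x) \<le> ennreal (s powr a * ?T + s powr a / ?L * ?\<phi> x)"
        by (rule ennreal_leI[OF pw])
      also have "\<dots> = ennreal (s powr a * ?T) + ennreal (s powr a / ?L) * ennreal (?\<phi> x)"
        by (simp only: ennreal_mult[OF sL \<phi>_nonneg]
            ennreal_plus[OF sT mult_nonneg_nonneg[OF sL \<phi>_nonneg]])
      finally show ?thesis using True \<Omega>(2) by (auto simp: indicator_def)
    qed simp
  qed
  also have "\<dots> = ennreal (s powr a * ?T) * emeasure lebesgue \<Omega>
      + ennreal (s powr a / ?L) * (\<integral>\<^sup>+x\<in>Q. ennreal (?\<phi> x) \<partial>lebesgue)"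
    using \<phi>_meas by (subst nn_integral_add) (auto simp: nn_integral_cmult nn_integral_cmult_indicator)
  also have "\<dots> \<le> ennreal (s powr a * ?T) * ennreal (2 * (1 / 2) ^ d * v) + ennreal (s powr a / ?L) * ennreal v"
    using s \<Omega> by (intro add_mono mult_left_mono) auto
  also have "\<dots> = ennreal (s powr a * v * (2 * (1 / 2) ^ d * ?T + 1 / ?L))"
    using L Q by (simp add: algebra_simps flip: ennreal_mult ennreal_plus)
  also have "\<dots> \<le> ennreal (s powr a * v * (c * (1 + real d) powr (- (a - 1))))"
    using Q s by (intro ennreal_leI mult_left_mono c) auto
  finally show ?thesis by (simp add: mult_ac)
qed

text \<open>Every admissible \<open>s\<close> bounds the mass of \<open>\<Omega>\<close>, which is
  at least half of \<open>V\<close>; solved for \<open>s\<close> this bounds the infimum from below.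
  Taking the root of order \<open>a\<close> turns the decay exponent \<open>a - 1\<close> into
  \<open>1 - 1 / a\<close>.\<close>

lemma luxemburg_norm_ge:
  fixes u :: "real ^ 'n \<Rightarrow> real"
  assumes a: "1 < a" and \<delta>: "0 \<le> \<delta>" and c0: "0 < c" and c: "\<And>d :: nat. 2 * (1 / 2) ^ d * 2 powr (d / 2)
      + 1 / ln (exp 1 + 2 powr (d / 2 / a)) powr (a - 1) \<le> c * (1 + real d) powr (- (a - 1))"
    and u: "u \<in> borel_measurable lebesgue" "\<And>x. 0 \<le> u x"
    and Q: "Q \<in> sets lebesgue" "emeasure lebesgue Q = ennreal v" "0 < v"
    and \<Omega>: "\<Omega> \<in> sets lebesgue" "\<Omega> \<subseteq> Q" "emeasure lebesgue \<Omega> \<le> ennreal (2 * (1 / 2) ^ d * v)"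
    and V: "0 \<le> V" "ennreal V \<le> 2 * emeasure (density lebesgue u) \<Omega>"
  shows "ennreal ((V / v) powr (1 / a) * (1 + real d) powr (1 - 1 / a) / (2 * c) powr (1 / a))
    \<le> luxemburg_norm (loglog_bump a \<delta>) (\<lambda>x. u x powr (1 / a)) Q"
  unfolding luxemburg_norm_def
proof (rule Inf_greatest, elim CollectE exE conjE)
  fix r s assume r: "r = ennreal s" and s: "0 < s"
    and le: "(\<integral>\<^sup>+x\<in>Q. ennreal (loglog_bump a \<delta> (\<bar>u x powr (1 / a)\<bar> / s)) \<partial>lebesgue) / emeasure lebesgue Q \<le> 1"
  let ?J = "\<integral>\<^sup>+x\<in>Q. ennreal (loglog_bump a \<delta> (\<bar>u x powr (1 / a)\<bar> / s)) \<partial>lebesgue"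
  have "?J = ?J / ennreal v * ennreal v"
    using Q by (simp add: ennreal_divide_times ennreal_mult_divide_eq)
  also have "\<dots> \<le> 1 * ennreal v" using le Q by (intro mult_right_mono) auto
  finally have "?J \<le> ennreal v" by simp
  then have "emeasure (density lebesgue u) \<Omega> \<le> ennreal (c * s powr a * v * (1 + real d) powr (- (a - 1)))"
    by (intro emeasure_density_le_bump[OF a \<delta> c u s _ Q(1) Q(3) \<Omega>])
  then have "ennreal V \<le> 2 * ennreal (c * s powr a * v * (1 + real d) powr (- (a - 1)))"
    by (intro order_trans[OF V(2)] mult_left_mono) auto
  also have "\<dots> = ennreal (2 * (c * s powr a * v * (1 + real d) powr (- (a - 1))))"
    using c0 Q s by (subst ennreal_mult) auto
  finally have "V \<le> 2 * (c * s powr a * v * (1 + real d) powr (- (a - 1)))"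
    using c0 Q s by (subst (asm) ennreal_le_iff) auto
  then have "V / v \<le> 2 * c * s powr a * (1 + real d) powr (- (a - 1))"
    using Q by (simp add: field_simps)
  then have "(V / v) powr (1 / a) \<le> (2 * c * s powr a * (1 + real d) powr (- (a - 1))) powr (1 / a)"
    using V Q a by (intro powr_mono2) auto
  also have "\<dots> = (2 * c) powr (1 / a) * s * (1 + real d) powr (- (1 - 1 / a))"
  proof -
    have "(- (a - 1)) * (1 / a) = - (1 - 1 / a)" using a by (simp add: field_simps)
    then show ?thesis using a s by (simp only: powr_mult powr_powr) simp
  qed
  finally have "(V / v) powr (1 / a) * (1 + real d) powr (1 - 1 / a) \<le> (2 * c) powr (1 / a) * s
      * ((1 + real d) powr (- (1 - 1 / a)) * (1 + real d) powr (1 - 1 / a))"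
    by (simp add: mult.assoc[symmetric] mult_right_mono)
  also have "(1 + real d) powr (- (1 - 1 / a)) * (1 + real d) powr (1 - 1 / a) = 1"
    by (subst powr_add[symmetric]) simp
  finally have "(V / v) powr (1 / a) * (1 + real d) powr (1 - 1 / a) / (2 * c) powr (1 / a) \<le> s"
    using c0 by (simp add: divide_le_eq mult.commute)
  then show "ennreal ((V / v) powr (1 / a) * (1 + real d) powr (1 - 1 / a) / (2 * c) powr (1 / a)) \<le> r"
    unfolding r by (rule ennreal_leI)
qed

section \<open>Weights on cells and the Riesz kernel\<close>

lemma enn_powr_ennreal: "0 \<le> r \<Longrightarrow> enn_powr (ennreal r) s = ennreal (r powr s)"
  by (simp add: enn_powr_def)

lemma enn_powr_mono:
  assumes "x \<le> y" "0 \<le> s"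
  shows "enn_powr x s \<le> enn_powr y s"
proof (cases "y = \<infinity>")
  case False
  then have "x \<noteq> \<infinity>" "enn2real x \<le> enn2real y"
    using assms by (auto simp: top_unique less_top intro!: enn2real_mono)
  then show ?thesis
    using False assms by (auto simp: enn_powr_def intro!: ennreal_leI powr_mono2)
qed (simp add: enn_powr_def)

lemma sum_powr_le_card:
  fixes a :: "'i \<Rightarrow> real"
  assumes "finite I" "\<And>i. i \<in> I \<Longrightarrow> 0 \<le> a i" "0 < q"
  shows "(\<Sum>i\<in>I. a i) powr q \<le> real (card I) powr q * (\<Sum>i\<in>I. a i powr q)"
proof (cases "I = {}")
  case False
  define M where "M = Max (a ` I)"
  have "M \<in> a ` I" unfolding M_def using assms False by (intro Max_in) auto
  then obtain i where i: "i \<in> I" "M = a i" by auto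
  have "(\<Sum>i\<in>I. a i) \<le> (\<Sum>i\<in>I. M)"
    using assms(1) unfolding M_def by (intro sum_mono Max_ge) auto
  then have "(\<Sum>i\<in>I. a i) powr q \<le> (real (card I) * M) powr q"
    using assms by (intro powr_mono2 sum_nonneg) auto
  also have "\<dots> = real (card I) powr q * a i powr q" by (simp add: powr_mult i)
  also have "\<dots> \<le> real (card I) powr q * (\<Sum>i\<in>I. a i powr q)"
    using assms i by (intro mult_left_mono member_le_sum) auto
  finally show ?thesis .
qed simp

text \<open>Integrability over each ball makes the restrictions measurable, and \<open>w\<close> is
  their pointwise limit.\<close>

lemma weight_measurable:
  assumes "weight w"
  shows "w \<in> borel_measurable lebesgue"
proof (rule borel_measurable_LIMSEQ_real)
  show "(\<lambda>x. indicator (cball 0 (real n)) x *\<^sub>R w x) \<in> borel_measurable lebesgue" for n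
  proof -
    have "integrable lebesgue (\<lambda>x. indicator (cball 0 (real n)) x *\<^sub>R w x)"
      using assms compact_cball unfolding weight_def set_integrable_def by blast
    then show ?thesis by (rule borel_measurable_integrable)
  qed
  show "(\<lambda>n. indicator (cball 0 (real n)) x *\<^sub>R w x) \<longlonglongrightarrow> w x" for x
  proof (rule tendsto_eventually)
    obtain N where "norm x \<le> real N" using real_arch_simple by blast
    then show "\<forall>\<^sub>F n in sequentially. indicator (cball 0 (real n)) x *\<^sub>R w x = w x"
      by (intro eventually_sequentiallyI[of N]) (auto simp: indicator_def)
  qed
qed

lemma weight_emeasure_finite:
  assumes "weight w" "compact K" "A \<in> sets lebesgue" "A \<subseteq> K"
  shows "emeasure (density lebesgue w) A < \<infinity>"
proof -
  have K: "K \<in> sets lebesgue" using compact_imp_closed[OF assms(2)] by auto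
  have "emeasure (density lebesgue w) A \<le> emeasure (density lebesgue w) K"
    using assms K by (intro emeasure_mono) auto
  also have "\<dots> = (\<integral>\<^sup>+x. ennreal (w x) * indicator K x \<partial>lebesgue)"
    using K weight_measurable[OF assms(1)] by (intro emeasure_density) auto
  also have "\<dots> = (\<integral>\<^sup>+x. ennreal (indicator K x *\<^sub>R w x) \<partial>lebesgue)"
    by (intro nn_integral_cong) (auto simp: indicator_def)
  also have "\<dots> < \<infinity>"
  proof -
    have "integrable lebesgue (\<lambda>x. indicator K x *\<^sub>R w x)"
      using assms by (auto simp: weight_def set_integrable_def)
    then have "(\<integral>\<^sup>+x. ennreal (norm (indicator K x *\<^sub>R w x)) \<partial>lebesgue) < \<infinity>"
      by (simp add: integrable_iff_bounded)
    then show ?thesis using assms by (simp add: weight_def abs_mult)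
  qed
  finally show ?thesis .
qed

lemma emeasure_cell_finite:
  fixes j :: "'n::finite \<Rightarrow> int"
  assumes "weight w" "A \<in> sets lebesgue" "A \<subseteq> closed_cell t k j"
  shows "emeasure (density lebesgue w) A < \<infinity>"
  using assms by (intro weight_emeasure_finite[of w "closed_cell t k j"]) (auto simp: closed_cell_def)

lemma avg_norm_ge:
  fixes w :: "real ^ 'n \<Rightarrow> real"
  assumes "0 < b" "\<And>x. 0 \<le> w x" "w \<in> borel_measurable lebesgue"
    and Q: "Q \<in> sets lebesgue" "emeasure lebesgue Q = ennreal v" "0 < v"
    and W: "0 \<le> W" "ennreal W \<le> emeasure (density lebesgue w) Q"
  shows "ennreal ((W / v) powr (1 / b)) \<le> avg_norm b (\<lambda>x. w x powr (1 / b)) Q"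
proof -
  have "ennreal ((W / v) powr (1 / b)) = enn_powr (ennreal W / ennreal v) (1 / b)"
    using W Q by (simp add: divide_ennreal enn_powr_ennreal)
  also have "\<dots> \<le> enn_powr (emeasure (density lebesgue w) Q / ennreal v) (1 / b)"
    using assms by (intro enn_powr_mono divide_right_mono_ennreal) auto
  also have "emeasure (density lebesgue w) Q = (\<integral>\<^sup>+x\<in>Q. ennreal (\<bar>w x powr (1 / b)\<bar> powr b) \<partial>lebesgue)"
    using assms by (subst emeasure_density) (auto simp: powr_powr)
  finally show ?thesis by (simp add: avg_norm_def Q)
qed

text \<open>The supremum is applied to the closed version of the cell \<open>P\<close>. Both norms
  are averages, and their normalization lowers the exponent of the volume from \<open>e\<close> to
  \<open>- \<gamma>\<close>. The growth in \<open>d\<close> of the lower bound for the Luxemburg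
  norm becomes the decay demanded by \<open>bumped\<close>.\<close>

lemma bumped_grid_family:
  fixes u w :: "real ^ 'n::finite \<Rightarrow> real"
  assumes a: "1 < a" and b: "1 < b" and \<delta>: "0 \<le> \<delta>" and c0: "0 < c" and c: "\<And>d :: nat. 2 * (1 / 2) ^ d * 2 powr (d / 2)
      + 1 / ln (exp 1 + 2 powr (d / 2 / a)) powr (a - 1) \<le> c * (1 + real d) powr (- (a - 1))"
    and u: "weight u" and w: "weight w" and e: "e - 1 / a - 1 / b = - \<gamma>" and B: "0 \<le> B"
    and sup: "\<And>Q. Q \<in> cubes \<Longrightarrow> ennreal (measure lebesgue Q powr e)
      * luxemburg_norm (loglog_bump a \<delta>) (\<lambda>x. u x powr (1 / a)) Q
      * avg_norm b (\<lambda>x. w x powr (1 / b)) Q \<le> ennreal B"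
  shows "bumped (grid_family t N) lebesgue (density lebesgue u) (density lebesgue w) \<gamma> a b (B * (2 * c) powr (1 / a))"
  unfolding bumped_def
proof (intro ballI allI impI)
  fix P \<Omega> :: "(real ^ 'n) set" and d
  assume "P \<in> grid_family t N" and \<Omega>: "\<Omega> \<in> sets lebesgue" "\<Omega> \<subseteq> P"
    and le: "measure lebesgue \<Omega> \<le> 2 * (1 / 2) ^ d * measure lebesgue P"
      "measure (density lebesgue u) P \<le> 2 * measure (density lebesgue u) \<Omega>"
  then obtain k j where P: "P = cell t k j" by (auto simp: grid_family_def)
  let ?Q = "closed_cell t k j" and ?U = "measure (density lebesgue u) P"
    and ?W = "measure (density lebesgue w) P"
  define v where "v = 4 powr (real_of_int k * real CARD('n))"
  have v: "0 < v" "measure lebesgue P = v" "emeasure lebesgue ?Q = ennreal v" "measure lebesgue ?Q = v"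
    "emeasure lebesgue P = ennreal v"
    by (auto simp: v_def P measure_cell emeasure_cell)
  have PQ: "P \<subseteq> ?Q" "P \<in> sets lebesgue" "?Q \<in> sets lebesgue"
    using cell_subset[of t k j] cell_sets_lebesgue[of t k j] by (auto simp: P closed_cell_def)
  have nn: "\<And>x. 0 \<le> u x" "\<And>x. 0 \<le> w x" using u w by (auto simp: weight_def)
  have "ennreal ((?U / v) powr (1 / a) * (1 + real d) powr (1 - 1 / a) / (2 * c) powr (1 / a))
      \<le> luxemburg_norm (loglog_bump a \<delta>) (\<lambda>x. u x powr (1 / a)) ?Q"
  proof (rule luxemburg_norm_ge[OF a \<delta> c0 c weight_measurable[OF u] nn(1) PQ(3) v(3) v(1) \<Omega>(1)])
    show "\<Omega> \<subseteq> ?Q" using \<Omega> PQ by auto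
    have "emeasure lebesgue \<Omega> \<le> ennreal v"
      using \<Omega> PQ v by (metis emeasure_mono)
    then have "emeasure lebesgue \<Omega> \<noteq> top" by (auto simp: top_unique)
    then show "emeasure lebesgue \<Omega> \<le> ennreal (2 * (1 / 2) ^ d * v)"
      using le(1) v by (simp add: emeasure_eq_ennreal_measure ennreal_leI)
    have "emeasure (density lebesgue u) \<Omega> < \<infinity>"
      using u \<Omega> PQ by (intro emeasure_cell_finite[of u \<Omega> t k j]) auto
    then have "2 * emeasure (density lebesgue u) \<Omega> = ennreal (2 * measure (density lebesgue u) \<Omega>)"
      by (simp add: emeasure_eq_ennreal_measure ennreal_mult less_top)
    then show "ennreal ?U \<le> 2 * emeasure (density lebesgue u) \<Omega>"
      using le(2) by (simp add: ennreal_leI)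
  qed simp
  moreover have "ennreal ((?W / v) powr (1 / b)) \<le> avg_norm b (\<lambda>x. w x powr (1 / b)) ?Q"
  proof (rule avg_norm_ge)
    have "emeasure (density lebesgue w) P < \<infinity>" using w PQ by (intro emeasure_cell_finite) auto
    then have "ennreal ?W = emeasure (density lebesgue w) P"
      by (simp add: emeasure_eq_ennreal_measure less_top)
    also have "\<dots> \<le> emeasure (density lebesgue w) ?Q" using PQ by (intro emeasure_mono) auto
    finally show "ennreal ?W \<le> emeasure (density lebesgue w) ?Q" .
  qed (use b nn weight_measurable[OF w] PQ v in auto)
  ultimately have "ennreal (v powr e)
      * ennreal ((?U / v) powr (1 / a) * (1 + real d) powr (1 - 1 / a) / (2 * c) powr (1 / a))
      * ennreal ((?W / v) powr (1 / b)) \<le> ennreal (measure lebesgue ?Q powr e)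
      * luxemburg_norm (loglog_bump a \<delta>) (\<lambda>x. u x powr (1 / a)) ?Q
      * avg_norm b (\<lambda>x. w x powr (1 / b)) ?Q"
    unfolding v(4) by (intro mult_mono) auto
  also have "\<dots> \<le> ennreal B" by (rule sup[OF closed_cell_cubes])
  finally have "ennreal (v powr e
      * ((?U / v) powr (1 / a) * (1 + real d) powr (1 - 1 / a) / (2 * c) powr (1 / a))
      * (?W / v) powr (1 / b)) \<le> ennreal B"
    by (simp add: ennreal_mult'' flip: ennreal_mult)
  then have le_B: "v powr e * ((?U / v) powr (1 / a) * (1 + real d) powr (1 - 1 / a) / (2 * c) powr (1 / a))
      * (?W / v) powr (1 / b) \<le> B"
    using B by (simp add: ennreal_le_iff)
  have "v powr (- \<gamma>) = v powr e / v powr (1 / a) / v powr (1 / b)"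
    unfolding e[symmetric] by (simp add: powr_diff)
  then have "v powr (- \<gamma>) * ?U powr (1 / a) * ?W powr (1 / b)
      = v powr e * (?U / v) powr (1 / a) * (?W / v) powr (1 / b)"
    by (simp add: powr_divide)
  also have "\<dots> = (v powr e * ((?U / v) powr (1 / a) * (1 + real d) powr (1 - 1 / a) / (2 * c) powr (1 / a))
      * (?W / v) powr (1 / b)) * ((2 * c) powr (1 / a) * (1 + real d) powr (- (1 - 1 / a)))"
  proof -
    have "(1 + real d) powr (1 - 1 / a) * (1 + real d) powr (- (1 - 1 / a)) = 1"
      by (subst powr_add[symmetric]) simp
    moreover have "X * Y * Z = (X * (Y * D / C) * Z) * (C * E)" if "D * E = 1" "C \<noteq> 0" for X Y Z D E C :: real
    proof -
      have "(X * (Y * D / C) * Z) * (C * E) = X * Y * Z * (D * E)" using that(2) by simp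
      then show ?thesis using that(1) by simp
    qed
    ultimately show ?thesis using c0 by simp
  qed
  also have "\<dots> \<le> B * ((2 * c) powr (1 / a) * (1 + real d) powr (- (1 - 1 / a)))"
    by (intro mult_right_mono le_B) auto
  finally show "measure lebesgue P powr (- \<gamma>) * ?U powr (1 / a) * ?W powr (1 / b)
      \<le> B * (2 * c) powr (1 / a) * (1 + real d) powr (- (1 - 1 / a))"
    by (simp add: v mult.assoc)
qed

lemma bumped_mono: "bumped D m \<mu> \<nu> \<gamma> a b A \<Longrightarrow> A \<le> A' \<Longrightarrow> bumped D m \<mu> \<nu> \<gamma> a b A'"
  unfolding bumped_def by (meson mult_right_mono order_trans powr_ge_zero)

lemma finite_grid_family: "finite (grid_family t N :: (real ^ 'n::finite) set set)"
  using dyadic_grid_family[of t N] by (auto simp: dyadic_family_def laminar_def)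

text \<open>A single cell of side at most \<open>12 * norm (x - y)\<close> containing both points
  already dominates the kernel. The finite family in which it occurs depends on the points, hence
  the supremum over \<open>N\<close>. On the diagonal the kernel is \<open>1 / 0 = 0\<close> by
  convention.\<close>

lemma riesz_kernel_le:
  fixes x y :: "real ^ 'n::finite"
  assumes \<alpha>: "\<alpha> < real CARD('n)"
  defines "\<gamma> \<equiv> 1 - \<alpha> / real CARD('n)"
  shows "ennreal (1 / norm (x - y) powr (real CARD('n) - \<alpha>)) \<le> ennreal (12 powr (real CARD('n) - \<alpha>))
    * (SUP N. ennreal (\<Sum>t\<in>UNIV. \<Sum>Q\<in>grid_family t N. measure lebesgue Q powr (- \<gamma>) * indicator Q x * indicator Q y))"
proof (cases "x = y")
  case False
  let ?n = "real CARD('n)" and ?r = "norm (x - y)"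
  let ?S = "\<lambda>t N. \<Sum>Q\<in>grid_family t N. measure lebesgue Q powr (- \<gamma>) * indicator Q x * indicator Q y"
  have n: "0 < ?n" by simp
  obtain t N k j where *: "cell t k j \<in> grid_family t N" "x \<in> cell t k j" "y \<in> cell t k j"
    "4 powr k \<le> 12 * ?r" using ex_common_cell[OF False] .
  have r: "0 < ?r" using False by simp
  have "1 / (12 * ?r) powr (?n - \<alpha>) \<le> 1 / (4 powr k) powr (?n - \<alpha>)"
    using * \<alpha> r by (intro divide_left_mono powr_mono2 mult_pos_pos) auto
  also have "\<dots> = measure lebesgue (cell t k j) powr (- \<gamma>)"
  proof -
    have "?n * - \<gamma> = - (?n - \<alpha>)" using n by (simp add: \<gamma>_def right_diff_distrib)
    then have "real_of_int k * ?n * - \<gamma> = - (real_of_int k * (?n - \<alpha>))"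
      by (simp only: mult.assoc)
    then show ?thesis unfolding measure_cell powr_powr by (simp only: powr_minus_divide)
  qed
  also have "\<dots> = measure lebesgue (cell t k j) powr (- \<gamma>) * indicator (cell t k j) x * indicator (cell t k j) y"
    using * by simp
  also have "\<dots> \<le> ?S t N" using * by (intro member_le_sum finite_grid_family) auto
  also have "\<dots> \<le> (\<Sum>t\<in>UNIV. ?S t N)" by (intro member_le_sum sum_nonneg) auto
  finally have "1 / (12 * ?r) powr (?n - \<alpha>) \<le> (\<Sum>t\<in>UNIV. ?S t N)" .
  then have "12 powr (?n - \<alpha>) * (1 / (12 * ?r) powr (?n - \<alpha>)) \<le> 12 powr (?n - \<alpha>) * (\<Sum>t\<in>UNIV. ?S t N)"
    by (intro mult_left_mono) auto
  then have "1 / ?r powr (?n - \<alpha>) \<le> 12 powr (?n - \<alpha>) * (\<Sum>t\<in>UNIV. ?S t N)"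
    by (simp add: powr_mult)
  then have "ennreal (1 / ?r powr (?n - \<alpha>)) \<le> ennreal (12 powr (?n - \<alpha>)) * ennreal (\<Sum>t\<in>UNIV. ?S t N)"
    by (simp add: ennreal_leI sum_nonneg flip: ennreal_mult)
  also have "\<dots> \<le> ennreal (12 powr (?n - \<alpha>)) * (SUP N. ennreal (\<Sum>t\<in>UNIV. ?S t N))"
    by (intro mult_left_mono SUP_upper) auto
  finally show ?thesis .
qed simp

section \<open>The Riesz potential\<close>

definition grid_potential ::
  "real \<Rightarrow> (real ^ 'n) measure \<Rightarrow> (real ^ 'n \<Rightarrow> real) \<Rightarrow> nat \<Rightarrow> real ^ 'n \<Rightarrow> real" where
  "grid_potential \<gamma> S f N x =
     (\<Sum>t\<in>UNIV. \<Sum>Q\<in>grid_family t N. measure lebesgue Q powr (- \<gamma>) * (LINT y:Q|S. f y) * indicator Q x)"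

lemma grid_family_sets: "Q \<in> grid_family t N \<Longrightarrow> (Q :: (real ^ 'n::finite) set) \<in> sets lebesgue"
  using dyadic_grid_family[of t N] by (auto simp: dyadic_family_def dyadic_family_axioms_def)

lemma grid_family_emeasure_finite:
  assumes "weight w" "(Q :: (real ^ 'n::finite) set) \<in> grid_family t N"
  shows "emeasure (density lebesgue w) Q < \<infinity>"
proof -
  obtain k j where "Q = cell t k j" using assms(2) by (auto simp: grid_family_def)
  then show ?thesis
    using assms(1) cell_subset grid_family_sets[OF assms(2)] by (intro emeasure_cell_finite[of w Q t k j]) auto
qed

lemma grid_sum_mono:
  fixes c :: "(real ^ 'n::finite) set \<Rightarrow> real"
  assumes "\<And>Q. 0 \<le> c Q" "N \<le> N'"
  shows "(\<Sum>t\<in>UNIV. \<Sum>Q\<in>grid_family t N. c Q) \<le> (\<Sum>t\<in>UNIV. \<Sum>Q\<in>grid_family t N'. c Q)"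
  using assms by (intro sum_mono sum_mono2 finite_grid_family grid_family_mono) auto

lemma grid_potential_nonneg:
  "(\<And>x. 0 \<le> f x) \<Longrightarrow> 0 \<le> grid_potential \<gamma> S f N x"
  unfolding grid_potential_def
  by (intro sum_nonneg mult_nonneg_nonneg) (auto simp: set_lebesgue_integral_def)

lemma grid_potential_mono:
  fixes f :: "real ^ 'n::finite \<Rightarrow> real"
  assumes "\<And>x. 0 \<le> f x" "N \<le> N'"
  shows "grid_potential \<gamma> S f N x \<le> grid_potential \<gamma> S f N' x"
  unfolding grid_potential_def using assms
  by (intro grid_sum_mono mult_nonneg_nonneg) (auto simp: set_lebesgue_integral_def)

lemma grid_potential_measurable:
  "grid_potential \<gamma> S f N \<in> borel_measurable (lebesgue :: (real ^ 'n::finite) measure)"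
  unfolding grid_potential_def
  by (intro borel_measurable_sum borel_measurable_times borel_measurable_const
      borel_measurable_indicator grid_family_sets)

text \<open>The kernel sums increase with \<open>N\<close>, so the supremum leaves the integral by
  monotone convergence; for fixed \<open>N\<close> the sums are finite and \<open>f\<close> is
  integrable over each cell.\<close>

lemma riesz_le_grid_potential:
  fixes f \<sigma> :: "real ^ 'n::finite \<Rightarrow> real"
  assumes \<alpha>: "\<alpha> < real CARD('n)" and p: "1 < p" and \<sigma>: "weight \<sigma>"
    and f: "f \<in> borel_measurable lebesgue" "\<And>x. 0 \<le> f x"
      "integrable (density lebesgue \<sigma>) (\<lambda>x. f x powr p)"
  defines "\<gamma> \<equiv> 1 - \<alpha> / real CARD('n)"
  shows "(\<integral>\<^sup>+y. ennreal (f y * \<sigma> y / norm (x - y) powr (real CARD('n) - \<alpha>)) \<partial>lebesgue)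
    \<le> ennreal (12 powr (real CARD('n) - \<alpha>)) * (SUP N. ennreal (grid_potential \<gamma> (density lebesgue \<sigma>) f N x))"
proof -
  let ?S = "density lebesgue \<sigma>" and ?C = "ennreal (12 powr (real CARD('n) - \<alpha>))"
  define \<kappa> where "\<kappa> N y = (\<Sum>t\<in>UNIV. \<Sum>Q\<in>grid_family t N.
    measure lebesgue Q powr (- \<gamma>) * indicator Q x * indicator Q y :: real)" for N y
  have [measurable]: "\<sigma> \<in> borel_measurable lebesgue" "f \<in> borel_measurable lebesgue"
    using weight_measurable[OF \<sigma>] f by auto
  have \<sigma>_nonneg: "0 \<le> \<sigma> y" for y using \<sigma> by (simp add: weight_def)
  have \<kappa>_meas [measurable]: "\<kappa> N \<in> borel_measurable lebesgue" for N
    unfolding \<kappa>_def by (intro borel_measurable_sum borel_measurable_times borel_measurable_const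
      borel_measurable_indicator grid_family_sets)
  have \<kappa>_nonneg: "0 \<le> \<kappa> N y" for N y unfolding \<kappa>_def by (intro sum_nonneg) auto
  have \<kappa>_mono: "\<kappa> N y \<le> \<kappa> N' y" if "N \<le> N'" for N N' y
    unfolding \<kappa>_def by (rule grid_sum_mono) (use that in auto)
  have "(\<integral>\<^sup>+y. ennreal (f y * \<sigma> y / norm (x - y) powr (real CARD('n) - \<alpha>)) \<partial>lebesgue)
      \<le> (\<integral>\<^sup>+y. ?C * (SUP N. ennreal (\<sigma> y) * ennreal (\<kappa> N y * f y)) \<partial>lebesgue)"
  proof (rule nn_integral_mono)
    fix y
    have "ennreal (f y * \<sigma> y / norm (x - y) powr (real CARD('n) - \<alpha>))
        = ennreal (1 / norm (x - y) powr (real CARD('n) - \<alpha>)) * ennreal (f y * \<sigma> y)"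
      using f \<sigma>_nonneg by (simp flip: ennreal_mult)
    also have "\<dots> \<le> (?C * (SUP N. ennreal (\<kappa> N y))) * ennreal (f y * \<sigma> y)"
      using riesz_kernel_le[OF \<alpha>, of x y] unfolding \<kappa>_def \<gamma>_def by (intro mult_right_mono) auto
    also have "\<dots> = ?C * (SUP N. ennreal (\<kappa> N y) * ennreal (f y * \<sigma> y))"
      by (simp add: mult.assoc SUP_mult_right_ennreal)
    also have "(\<lambda>N. ennreal (\<kappa> N y) * ennreal (f y * \<sigma> y)) = (\<lambda>N. ennreal (\<sigma> y) * ennreal (\<kappa> N y * f y))"
    proof
      fix N
      have comm: "ennreal k * ennreal (f y * \<sigma> y) = ennreal (\<sigma> y) * ennreal (k * f y)" if "0 \<le> k" for k
        using that f(2)[of y] \<sigma>_nonneg[of y] by (simp add: ennreal_mult mult_ac)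
      show "ennreal (\<kappa> N y) * ennreal (f y * \<sigma> y) = ennreal (\<sigma> y) * ennreal (\<kappa> N y * f y)"
        by (rule comm[OF \<kappa>_nonneg])
    qed
    finally show "ennreal (f y * \<sigma> y / norm (x - y) powr (real CARD('n) - \<alpha>))
        \<le> ?C * (SUP N. ennreal (\<sigma> y) * ennreal (\<kappa> N y * f y))" .
  qed
  also have "\<dots> = ?C * (\<integral>\<^sup>+y. (SUP N. ennreal (\<sigma> y) * ennreal (\<kappa> N y * f y)) \<partial>lebesgue)"
    by (rule nn_integral_cmult) measurable
  also have "(\<integral>\<^sup>+y. (SUP N. ennreal (\<sigma> y) * ennreal (\<kappa> N y * f y)) \<partial>lebesgue)
      = (SUP N. \<integral>\<^sup>+y. ennreal (\<sigma> y) * ennreal (\<kappa> N y * f y) \<partial>lebesgue)"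
  proof (rule nn_integral_monotone_convergence_SUP)
    show "incseq (\<lambda>N y. ennreal (\<sigma> y) * ennreal (\<kappa> N y * f y))"
      using \<kappa>_mono f by (intro incseq_SucI le_funI mult_left_mono ennreal_leI mult_right_mono) auto
  qed measurable
  also have "(\<lambda>N. \<integral>\<^sup>+y. ennreal (\<sigma> y) * ennreal (\<kappa> N y * f y) \<partial>lebesgue)
      = (\<lambda>N. ennreal (grid_potential \<gamma> ?S f N x))"
  proof
    fix N
    let ?c = "\<lambda>Q. measure lebesgue Q powr (- \<gamma>) * indicator Q x"
    have int: "integrable ?S (\<lambda>y. indicator Q y * f y)" if "Q \<in> grid_family t N" for Q t
      using that f grid_family_sets grid_family_emeasure_finite[OF \<sigma> that]
      by (intro set_integrable_powr[OF p]) auto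
    have eq: "\<kappa> N y * f y = (\<Sum>t\<in>UNIV. \<Sum>Q\<in>grid_family t N. ?c Q * (indicator Q y * f y))" for y
      by (simp add: \<kappa>_def sum_distrib_right mult.assoc)
    have "(\<integral>\<^sup>+y. ennreal (\<sigma> y) * ennreal (\<kappa> N y * f y) \<partial>lebesgue)
        = (\<integral>\<^sup>+y. ennreal (\<kappa> N y * f y) \<partial>?S)"
      by (rule nn_integral_density[symmetric]) measurable
    also have "\<dots> = ennreal (LINT y|?S. \<kappa> N y * f y)"
    proof (rule nn_integral_eq_integral)
      show "integrable ?S (\<lambda>y. \<kappa> N y * f y)"
        unfolding eq by (intro Bochner_Integration.integrable_sum integrable_mult_right int)
    qed (use \<kappa>_nonneg f in auto)
    also have "(LINT y|?S. \<kappa> N y * f y)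
        = (\<Sum>t\<in>UNIV. LINT y|?S. (\<Sum>Q\<in>grid_family t N. ?c Q * (indicator Q y * f y)))"
      unfolding eq
      by (intro Bochner_Integration.integral_sum Bochner_Integration.integrable_sum integrable_mult_right int)
    also have "\<dots> = (\<Sum>t\<in>UNIV. \<Sum>Q\<in>grid_family t N. LINT y|?S. ?c Q * (indicator Q y * f y))"
      by (intro sum.cong refl Bochner_Integration.integral_sum integrable_mult_right int)
    also have "\<dots> = (\<Sum>t\<in>UNIV. \<Sum>Q\<in>grid_family t N. ?c Q * (LINT y:Q|?S. f y))"
      by (simp add: set_lebesgue_integral_def)
    also have "\<dots> = grid_potential \<gamma> ?S f N x"
      by (simp add: grid_potential_def mult_ac)
    finally show "(\<integral>\<^sup>+y. ennreal (\<sigma> y) * ennreal (\<kappa> N y * f y) \<partial>lebesgue)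
        = ennreal (grid_potential \<gamma> ?S f N x)" .
  qed
  finally show ?thesis .
qed

text \<open>The dyadic bound is the same for every grid and every \<open>N\<close>, which allows
  monotone convergence. Splitting the power of the sum over grids costs the number of grids to the
  power \<open>q\<close>, and adding the equal bounds costs that number once more.\<close>

lemma grid_potential_norm:
  fixes f u \<sigma> :: "real ^ 'n::finite \<Rightarrow> real"
  assumes p: "1 < p" "1 / p + 1 / p' = 1" and q: "1 < q" and "p < q"
    and u: "weight u" and \<sigma>: "weight \<sigma>" and \<gamma>: "0 < \<gamma>" "\<gamma> < 1" and A: "0 \<le> A"
    and bump: "\<And>t N. bumped (grid_family t N) lebesgue (density lebesgue u) (density lebesgue \<sigma>) \<gamma> q p' A"
      "\<And>t N. bumped (grid_family t N) lebesgue (density lebesgue \<sigma>) (density lebesgue u) \<gamma> p' q A"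
    and f: "f \<in> borel_measurable lebesgue" "\<And>x. 0 \<le> f x"
      "integrable (density lebesgue \<sigma>) (\<lambda>x. f x powr p)"
  defines "c \<equiv> real CARD('n set) powr q * real CARD('n set)"
  shows "(\<integral>\<^sup>+x. (SUP N. ennreal (grid_potential \<gamma> (density lebesgue \<sigma>) f N x powr q)) \<partial>density lebesgue u)
    \<le> ennreal (c * ((dyadic_const \<gamma> p p' q (q / (q - 1)) * A) powr q
        * (LINT x|density lebesgue \<sigma>. f x powr p) powr (q / p)))"
proof -
  let ?S = "density lebesgue \<sigma>" and ?U = "density lebesgue u"
  let ?B = "(dyadic_const \<gamma> p p' q (q / (q - 1)) * A) powr q * (LINT x|?S. f x powr p) powr (q / p)"
  let ?T = "\<lambda>t N x. \<Sum>Q\<in>grid_family t N. measure lebesgue Q powr (- \<gamma>) * (LINT y:Q|?S. f y) * indicator Q x"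
  have nn: "0 \<le> ?T t N x" for t N x
    using f by (intro sum_nonneg mult_nonneg_nonneg) (auto simp: set_lebesgue_integral_def)
  have T_meas: "?T t N \<in> borel_measurable ?U" for t N
    using grid_family_sets
    by (intro borel_measurable_sum borel_measurable_times borel_measurable_const borel_measurable_indicator) auto
  have "(\<integral>\<^sup>+x. (SUP N. ennreal (grid_potential \<gamma> ?S f N x powr q)) \<partial>?U)
      = (SUP N. \<integral>\<^sup>+x. ennreal (grid_potential \<gamma> ?S f N x powr q) \<partial>?U)"
  proof (rule nn_integral_monotone_convergence_SUP)
    show "incseq (\<lambda>N x. ennreal (grid_potential \<gamma> ?S f N x powr q))"
      using f(2) q by (intro incseq_SucI le_funI ennreal_leI powr_mono2 grid_potential_mono grid_potential_nonneg) auto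
    have "grid_potential \<gamma> ?S f N \<in> borel_measurable ?U" for N
      using grid_potential_measurable by simp
    then show "(\<lambda>x. ennreal (grid_potential \<gamma> ?S f N x powr q)) \<in> borel_measurable ?U" for N
      by measurable
  qed
  also have "\<dots> \<le> ennreal (c * ?B)"
  proof (rule SUP_least)
    fix N
    have "(\<integral>\<^sup>+x. ennreal (grid_potential \<gamma> ?S f N x powr q) \<partial>?U)
        \<le> (\<integral>\<^sup>+x. ennreal (real CARD('n set) powr q) * (\<Sum>t\<in>UNIV. ennreal (?T t N x powr q)) \<partial>?U)"
    proof (rule nn_integral_mono)
      fix x
      have "grid_potential \<gamma> ?S f N x powr q \<le> real CARD('n set) powr q * (\<Sum>t\<in>UNIV. ?T t N x powr q)"
        unfolding grid_potential_def using nn q by (intro sum_powr_le_card) auto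
      then have "ennreal (grid_potential \<gamma> ?S f N x powr q) \<le> ennreal (real CARD('n set) powr q * (\<Sum>t\<in>UNIV. ?T t N x powr q))"
        by (rule ennreal_leI)
      also have "\<dots> = ennreal (real CARD('n set) powr q) * (\<Sum>t\<in>UNIV. ennreal (?T t N x powr q))"
        by (subst sum_ennreal) (auto intro!: ennreal_mult sum_nonneg)
      finally show "ennreal (grid_potential \<gamma> ?S f N x powr q)
          \<le> ennreal (real CARD('n set) powr q) * (\<Sum>t\<in>UNIV. ennreal (?T t N x powr q))" .
    qed
    also have "\<dots> = ennreal (real CARD('n set) powr q) * (\<Sum>t\<in>UNIV. \<integral>\<^sup>+x. ennreal (?T t N x powr q) \<partial>?U)"
    proof -
      have m: "(\<lambda>x. ennreal (?T t N x powr q)) \<in> borel_measurable ?U" for t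
        by (intro measurable_compose[OF _ measurable_ennreal] powr_real_measurable T_meas borel_measurable_const)
      show ?thesis
        by (subst nn_integral_cmult, intro borel_measurable_sum m, subst nn_integral_sum, rule m, rule refl)
    qed
    also have "\<dots> \<le> ennreal (real CARD('n set) powr q) * (\<Sum>t\<in>(UNIV :: 'n set set). ennreal ?B)"
    proof (intro mult_left_mono sum_mono)
      fix t :: "'n set"
      show "(\<integral>\<^sup>+x. ennreal (?T t N x powr q) \<partial>?U) \<le> ennreal ?B"
        by (rule dyadic_family.dyadic_norm[OF dyadic_grid_family p q \<open>p < q\<close>])
          (use grid_family_emeasure_finite u \<sigma> \<gamma> A bump f in auto)
    qed simp
    also have "\<dots> = ennreal (real CARD('n set) powr q) * ennreal (real CARD('n set) * ?B)"
      by (subst sum_ennreal) auto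
    also have "\<dots> = ennreal (c * ?B)" unfolding c_def by (subst ennreal_mult[symmetric]) (auto simp: mult.assoc)
    finally show "(\<integral>\<^sup>+x. ennreal (grid_potential \<gamma> ?S f N x powr q) \<partial>?U) \<le> ennreal (c * ?B)" .
  qed
  finally show ?thesis .
qed

lemma Lp_norm_eq_integral:
  fixes f \<sigma> :: "real ^ 'n \<Rightarrow> real"
  assumes \<sigma>: "weight \<sigma>" and f: "f \<in> Lp_space p \<sigma>"
  shows "integrable (density lebesgue \<sigma>) (\<lambda>x. \<bar>f x\<bar> powr p)"
    and "Lp_norm p \<sigma> f = ennreal ((LINT x|density lebesgue \<sigma>. \<bar>f x\<bar> powr p) powr (1 / p))"
proof -
  let ?S = "density lebesgue \<sigma>"
  have [measurable]: "f \<in> borel_measurable lebesgue" "\<sigma> \<in> borel_measurable lebesgue"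
    using f weight_measurable[OF \<sigma>] by (auto simp: Lp_space_def)
  have \<sigma>_nonneg: "0 \<le> \<sigma> x" for x using \<sigma> by (simp add: weight_def)
  let ?J = "\<integral>\<^sup>+x. ennreal (\<bar>f x\<bar> powr p * \<sigma> x) \<partial>lebesgue"
  have J: "?J = (\<integral>\<^sup>+x. ennreal (\<bar>f x\<bar> powr p) \<partial>?S)"
    by (subst nn_integral_density) (auto simp: ennreal_mult \<sigma>_nonneg mult.commute)
  have "?J \<noteq> \<infinity>" using f by (auto simp: Lp_space_def Lp_norm_def enn_powr_def)
  then show int: "integrable ?S (\<lambda>x. \<bar>f x\<bar> powr p)"
    unfolding J by (intro integrableI_bounded) (auto simp: less_top)
  have "?J = ennreal (LINT x|?S. \<bar>f x\<bar> powr p)"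
    unfolding J using int by (intro nn_integral_eq_integral) auto
  then show "Lp_norm p \<sigma> f = ennreal ((LINT x|?S. \<bar>f x\<bar> powr p) powr (1 / p))"
    by (simp add: Lp_norm_def enn_powr_ennreal)
qed

text \<open>The grid bound for the absolute value of \<open>f\<close> makes \<open>?Z\<close> finite
  almost everywhere with respect to \<open>u\<close>. At such points the integrand is absolutely
  integrable, so the Bochner integral is the true potential and obeys the same bound.\<close>

lemma riesz_potential_bound:
  fixes f u \<sigma> :: "real ^ 'n::finite \<Rightarrow> real"
  assumes \<alpha>: "0 < \<alpha>" "\<alpha> < real CARD('n)" and p: "1 < p" "1 / p + 1 / p' = 1" and q: "1 < q" and "p < q"
    and u: "weight u" and \<sigma>: "weight \<sigma>" and A: "0 \<le> A"
  defines "\<gamma> \<equiv> 1 - \<alpha> / real CARD('n)"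
  defines "K \<equiv> 12 powr (real CARD('n) - \<alpha>) * (real CARD('n set) powr q * real CARD('n set)) powr (1 / q)
    * (dyadic_const \<gamma> p p' q (q / (q - 1)) * A)"
  assumes bump: "\<And>t N. bumped (grid_family t N) lebesgue (density lebesgue u) (density lebesgue \<sigma>) \<gamma> q p' A"
      "\<And>t N. bumped (grid_family t N) lebesgue (density lebesgue \<sigma>) (density lebesgue u) \<gamma> p' q A"
    and f: "f \<in> Lp_space p \<sigma>"
  shows "AE x in density lebesgue u. integrable lebesgue (riesz_integrand \<alpha> (\<lambda>y. f y * \<sigma> y) x)"
    and "Lp_norm q u (riesz_potential \<alpha> (\<lambda>y. f y * \<sigma> y)) \<le> ennreal K * Lp_norm p \<sigma> f"
proof -
  let ?S = "density lebesgue \<sigma>" and ?U = "density lebesgue u" and ?e = "real CARD('n) - \<alpha>"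
  let ?c = "real CARD('n set) powr q * real CARD('n set)" and ?d = "dyadic_const \<gamma> p p' q (q / (q - 1)) * A"
  let ?X = "LINT x|?S. \<bar>f x\<bar> powr p"
  let ?G = "\<lambda>N x. grid_potential \<gamma> ?S (\<lambda>x. \<bar>f x\<bar>) N x"
  let ?I = "riesz_potential \<alpha> (\<lambda>y. f y * \<sigma> y)"
  have \<gamma>: "0 < \<gamma>" "\<gamma> < 1" using \<alpha> by (auto simp: \<gamma>_def)
  have [measurable]: "f \<in> borel_measurable lebesgue" "\<sigma> \<in> borel_measurable lebesgue" "u \<in> borel_measurable lebesgue"
    using f weight_measurable[OF \<sigma>] weight_measurable[OF u] by (auto simp: Lp_space_def)
  have nn: "0 \<le> \<sigma> x" "0 \<le> u x" for x using \<sigma> u by (auto simp: weight_def)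
  have d: "0 \<le> ?d" using dyadic_const_nonneg A by auto
  note int = Lp_norm_eq_integral(1)[OF \<sigma> f]
  let ?Z = "\<lambda>x. SUP N. ennreal (?G N x powr q)"
  have Z_le: "(\<integral>\<^sup>+x. ?Z x \<partial>?U) \<le> ennreal (?c * (?d powr q * ?X powr (q / p)))"
    by (rule grid_potential_norm[OF p q \<open>p < q\<close> u \<sigma> \<gamma> A bump]) (use int in auto)
  have Z_meas: "?Z \<in> borel_measurable ?U"
  proof -
    have "?G N \<in> borel_measurable ?U" for N using grid_potential_measurable by simp
    then show ?thesis by measurable
  qed
  have pointwise: "integrable lebesgue (riesz_integrand \<alpha> (\<lambda>y. f y * \<sigma> y) x)
      \<and> ennreal (\<bar>?I x\<bar> powr q) \<le> ennreal ((12 powr ?e) powr q) * ?Z x" if "?Z x \<noteq> \<infinity>" for x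
  proof -
    have "\<exists>z\<ge>0. y = ennreal z" if "y \<noteq> \<infinity>" for y :: ennreal using that by (cases y) auto
    from this[OF that] obtain z where z: "?Z x = ennreal z" "0 \<le> z" by blast
    have "?G N x \<le> z powr (1 / q)" for N
    proof -
      have "ennreal (?G N x powr q) \<le> ennreal z" unfolding z(1)[symmetric] by (rule SUP_upper) simp
      then have "?G N x powr q \<le> z" using z(2) by simp
      then have "(?G N x powr q) powr (1 / q) \<le> z powr (1 / q)" using q by (intro powr_mono2) auto
      then show ?thesis using q grid_potential_nonneg[of "\<lambda>x. \<bar>f x\<bar>" \<gamma> ?S N x] by (simp add: powr_powr)
    qed
    then have "(SUP N. ennreal (?G N x)) \<le> ennreal (z powr (1 / q))"
      by (intro SUP_least ennreal_leI)
    then have "(\<integral>\<^sup>+y. ennreal (\<bar>f y\<bar> * \<sigma> y / norm (x - y) powr ?e) \<partial>lebesgue)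
        \<le> ennreal (12 powr ?e) * ennreal (z powr (1 / q))"
      by (intro order_trans[OF riesz_le_grid_potential[OF \<alpha>(2) p(1) \<sigma>, folded \<gamma>_def]] mult_left_mono)
        (use int in auto)
    also have "\<dots> = ennreal (12 powr ?e * z powr (1 / q))" by (simp add: ennreal_mult)
    also have "(\<integral>\<^sup>+y. ennreal (\<bar>f y\<bar> * \<sigma> y / norm (x - y) powr ?e) \<partial>lebesgue)
        = (\<integral>\<^sup>+y. ennreal (norm (riesz_integrand \<alpha> (\<lambda>y. f y * \<sigma> y) x y)) \<partial>lebesgue)"
      using nn by (intro nn_integral_cong) (simp add: riesz_integrand_def abs_mult)
    finally have le: "(\<integral>\<^sup>+y. ennreal (norm (riesz_integrand \<alpha> (\<lambda>y. f y * \<sigma> y) x y)) \<partial>lebesgue)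
        \<le> ennreal (12 powr ?e * z powr (1 / q))" .
    have "(\<lambda>y. norm (x - y)) \<in> borel_measurable lebesgue"
      by (intro measurable_completion) measurable
    then have "riesz_integrand \<alpha> (\<lambda>y. f y * \<sigma> y) x \<in> borel_measurable lebesgue"
      unfolding riesz_integrand_def by measurable
    then have integrable: "integrable lebesgue (riesz_integrand \<alpha> (\<lambda>y. f y * \<sigma> y) x)"
      using le by (intro integrableI_bounded) (auto intro: le_less_trans)
    have "ennreal (norm (?I x)) \<le> ennreal (12 powr ?e * z powr (1 / q))"
      unfolding riesz_potential_def by (rule order_trans[OF integral_norm_bound_ennreal[OF integrable] le])
    then have "\<bar>?I x\<bar> \<le> 12 powr ?e * z powr (1 / q)" by (simp add: ennreal_le_iff)
    then have "\<bar>?I x\<bar> powr q \<le> (12 powr ?e * z powr (1 / q)) powr q" using q by (intro powr_mono2) auto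
    also have "\<dots> = (12 powr ?e) powr q * z" using q z by (simp only: powr_mult powr_powr) simp
    finally have "ennreal (\<bar>?I x\<bar> powr q) \<le> ennreal ((12 powr ?e) powr q) * ?Z x"
      unfolding z(1) using z(2) by (simp add: ennreal_leI flip: ennreal_mult)
    then show ?thesis using integrable by simp
  qed
  have "(\<integral>\<^sup>+x. ?Z x \<partial>?U) \<noteq> \<infinity>" using Z_le by (auto simp: top_unique)
  then have "AE x in ?U. ?Z x \<noteq> \<infinity>" using Z_meas by (intro nn_integral_PInf_AE) auto
  then have AE: "AE x in ?U. integrable lebesgue (riesz_integrand \<alpha> (\<lambda>y. f y * \<sigma> y) x)
      \<and> ennreal (\<bar>?I x\<bar> powr q) \<le> ennreal ((12 powr ?e) powr q) * ?Z x"
    by eventually_elim (rule pointwise)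
  then show "AE x in ?U. integrable lebesgue (riesz_integrand \<alpha> (\<lambda>y. f y * \<sigma> y) x)"
    by eventually_elim simp
  \<comment> \<open>A statement almost everywhere for the density says nothing where
    \<open>u\<close> vanishes, but there the integrand of the norm is zero.\<close>
  have "AE x in lebesgue. 0 < ennreal (u x) \<longrightarrow> ennreal (\<bar>?I x\<bar> powr q) \<le> ennreal ((12 powr ?e) powr q) * ?Z x"
    using AE by (subst (asm) AE_density) (auto elim!: eventually_mono)
  then have "AE x in lebesgue. ennreal (\<bar>?I x\<bar> powr q * u x) \<le> ennreal (u x) * (ennreal ((12 powr ?e) powr q) * ?Z x)"
  proof eventually_elim
    case (elim x)
    show ?case
    proof (cases "u x = 0")
      case False
      then have "ennreal (\<bar>?I x\<bar> powr q) \<le> ennreal ((12 powr ?e) powr q) * ?Z x"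
        using elim nn(2)[of x] by (auto simp: less_le)
      then have "ennreal (u x) * ennreal (\<bar>?I x\<bar> powr q) \<le> ennreal (u x) * (ennreal ((12 powr ?e) powr q) * ?Z x)"
        by (rule mult_left_mono) simp
      then show ?thesis using nn(2)[of x] by (simp add: ennreal_mult mult.commute)
    qed simp
  qed
  then have "(\<integral>\<^sup>+x. ennreal (\<bar>?I x\<bar> powr q * u x) \<partial>lebesgue)
      \<le> (\<integral>\<^sup>+x. ennreal (u x) * (ennreal ((12 powr ?e) powr q) * ?Z x) \<partial>lebesgue)"
    by (rule nn_integral_mono_AE)
  also have "\<dots> = (\<integral>\<^sup>+x. ennreal ((12 powr ?e) powr q) * ?Z x \<partial>?U)"
    using Z_meas by (intro nn_integral_density[symmetric]) auto
  also have "\<dots> = ennreal ((12 powr ?e) powr q) * (\<integral>\<^sup>+x. ?Z x \<partial>?U)"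
    using Z_meas by (rule nn_integral_cmult)
  also have "\<dots> \<le> ennreal ((12 powr ?e) powr q) * ennreal (?c * (?d powr q * ?X powr (q / p)))"
    by (intro mult_left_mono Z_le) auto
  also have "\<dots> = ennreal ((12 powr ?e) powr q * (?c * (?d powr q * ?X powr (q / p))))"
    by (rule ennreal_mult[symmetric]) auto
  finally have "Lp_norm q u ?I \<le> enn_powr (ennreal ((12 powr ?e) powr q * (?c * (?d powr q * ?X powr (q / p))))) (1 / q)"
    unfolding Lp_norm_def using q by (intro enn_powr_mono) auto
  also have "\<dots> = ennreal (((12 powr ?e) powr q * (?c * (?d powr q * ?X powr (q / p)))) powr (1 / q))"
    by (rule enn_powr_ennreal) auto
  also have "((12 powr ?e) powr q * (?c * (?d powr q * ?X powr (q / p)))) powr (1 / q) = K * ?X powr (1 / p)"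
  proof -
    have "(a powr q * (c * (b powr q * x powr (q / p)))) powr (1 / q) = a * c powr (1 / q) * b * x powr (1 / p)"
      if "0 \<le> a" "0 \<le> b" for a b c x :: real
      using that q by (simp add: powr_mult powr_powr)
    then show ?thesis unfolding K_def using d by simp
  qed
  also have "ennreal (K * ?X powr (1 / p)) = ennreal K * Lp_norm p \<sigma> f"
    unfolding Lp_norm_eq_integral(2)[OF \<sigma> f] K_def using d by (intro ennreal_mult) auto
  finally show "Lp_norm q u ?I \<le> ennreal K * Lp_norm p \<sigma> f" .
qed

theorem theorem1p15:
  fixes \<alpha> p q :: real
  assumes "0 < \<alpha>" and "\<alpha> < real CARD('n::finite)"
    and "1 < p" and "p \<le> q"
    and "min (q / p) (conj_exp p / conj_exp q) * (1 - \<alpha> / real CARD('n)) \<ge> 1"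
  shows "\<exists>\<delta>\<^sub>0>0. \<forall>\<delta>>\<delta>\<^sub>0. \<forall>u \<sigma> :: real ^ 'n \<Rightarrow> real.
    weight u \<and> weight \<sigma> \<and>
    (SUP Q\<in>cubes. ennreal (measure lebesgue Q powr (\<alpha> / real CARD('n) + 1 / q - 1 / p))
       * luxemburg_norm (loglog_bump q \<delta>) (\<lambda>x. u x powr (1 / q)) Q
       * avg_norm (conj_exp p) (\<lambda>x. \<sigma> x powr (1 / conj_exp p)) Q) < \<infinity> \<and>
    (SUP Q\<in>cubes. ennreal (measure lebesgue Q powr (\<alpha> / real CARD('n) + 1 / q - 1 / p))
       * avg_norm q (\<lambda>x. u x powr (1 / q)) Q
       * luxemburg_norm (loglog_bump (conj_exp p) \<delta>) (\<lambda>x. \<sigma> x powr (1 / conj_exp p)) Q) < \<infinity>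
    \<longrightarrow> (\<exists>C::real. C \<ge> 0 \<and> (\<forall>f\<in>Lp_space p \<sigma>.
          (AE x in density lebesgue (\<lambda>x. ennreal (u x)).
             integrable lebesgue (riesz_integrand \<alpha> (\<lambda>y. f y * \<sigma> y) x)) \<and>
          Lp_norm q u (riesz_potential \<alpha> (\<lambda>y. f y * \<sigma> y)) \<le> ennreal C * Lp_norm p \<sigma> f))"
\<comment> \<open>\<open>loglog_bump_ge\<close> asks for a nonnegative \<delta>, which the threshold
  1 grants.\<close>
proof (rule exI[of _ 1], intro conjI allI impI)
  fix \<delta> :: real and u \<sigma> :: "real ^ 'n \<Rightarrow> real"
  let ?p' = "conj_exp p" and ?e = "\<alpha> / real CARD('n) + 1 / q - 1 / p" and ?\<gamma> = "1 - \<alpha> / real CARD('n)"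
  let ?s1 = "\<lambda>Q. ennreal (measure lebesgue Q powr ?e) * luxemburg_norm (loglog_bump q \<delta>) (\<lambda>x. u x powr (1 / q)) Q
       * avg_norm ?p' (\<lambda>x. \<sigma> x powr (1 / ?p')) Q"
  let ?s2 = "\<lambda>Q. ennreal (measure lebesgue Q powr ?e) * avg_norm q (\<lambda>x. u x powr (1 / q)) Q
       * luxemburg_norm (loglog_bump ?p' \<delta>) (\<lambda>x. \<sigma> x powr (1 / ?p')) Q"
  assume \<delta>: "1 < \<delta>" and H: "weight u \<and> weight \<sigma> \<and> (SUP Q\<in>cubes. ?s1 Q) < \<infinity> \<and> (SUP Q\<in>cubes. ?s2 Q) < \<infinity>"
  then have u: "weight u" and \<sigma>: "weight \<sigma>" by auto
  have \<gamma>: "0 < ?\<gamma>" "?\<gamma> < 1" using assms(1,2) by auto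
  have p': "1 / p + 1 / ?p' = 1" "1 < ?p'" using assms(3) by (auto simp: conj_exp_def field_simps)
  \<comment> \<open>Since \<open>?\<gamma> < 1\<close>, a product with \<open>q / p\<close> of at
    least 1 forces \<open>q / p > 1\<close>.\<close>
  have "1 \<le> q / p * ?\<gamma>"
  proof -
    have "min (q / p) (?p' / conj_exp q) * ?\<gamma> \<le> q / p * ?\<gamma>" using \<gamma> by (intro mult_right_mono) auto
    then show ?thesis using assms(5) by linarith
  qed
  moreover have "q / p * ?\<gamma> < q / p * 1" using \<gamma> assms(3,4) by (intro mult_strict_left_mono) auto
  ultimately have "p < q" using assms(3) by (simp add: less_divide_eq)
  then have q: "1 < q" using assms(3) by simp
  obtain B1 where B1: "0 \<le> B1" "(SUP Q\<in>cubes. ?s1 Q) = ennreal B1" using H by (cases "SUP Q\<in>cubes. ?s1 Q") auto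
  obtain B2 where B2: "0 \<le> B2" "(SUP Q\<in>cubes. ?s2 Q) = ennreal B2" using H by (cases "SUP Q\<in>cubes. ?s2 Q") auto
  obtain c1 where c1: "0 < c1" "\<And>d :: nat. 2 * (1 / 2) ^ d * 2 powr (d / 2)
      + 1 / ln (exp 1 + 2 powr (d / 2 / q)) powr (q - 1) \<le> c1 * (1 + real d) powr (- (q - 1))"
    using bump_decay[OF q] by blast
  obtain c2 where c2: "0 < c2" "\<And>d :: nat. 2 * (1 / 2) ^ d * 2 powr (d / 2)
      + 1 / ln (exp 1 + 2 powr (d / 2 / ?p')) powr (?p' - 1) \<le> c2 * (1 + real d) powr (- (?p' - 1))"
    using bump_decay[OF p'(2)] by blast
  define A where "A = max (B1 * (2 * c1) powr (1 / q)) (B2 * (2 * c2) powr (1 / ?p'))"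
  have A: "0 \<le> A" using B1 by (simp add: A_def le_max_iff_disj)
  \<comment> \<open>By \<open>1 / p + 1 / ?p' = 1\<close> the terms in \<open>p\<close> and
    \<open>q\<close> cancel up to \<open>- 1\<close>, leaving
    \<open>\<alpha> / n - 1\<close>.\<close>
  have e: "?e - 1 / q - 1 / ?p' = - ?\<gamma>" "?e - 1 / ?p' - 1 / q = - ?\<gamma>" using p'(1) by linarith+
  have bump1: "bumped (grid_family t N) lebesgue (density lebesgue u) (density lebesgue \<sigma>) ?\<gamma> q ?p' A" for t N
  proof (rule bumped_mono)
    show "bumped (grid_family t N) lebesgue (density lebesgue u) (density lebesgue \<sigma>) ?\<gamma> q ?p'
        (B1 * (2 * c1) powr (1 / q))"
    proof (rule bumped_grid_family[OF q p'(2) _ c1 u \<sigma> e(1) B1(1)])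
      show "?s1 Q \<le> ennreal B1" if "Q \<in> cubes" for Q unfolding B1(2)[symmetric] using that by (rule SUP_upper)
    qed (use \<delta> in simp)
  qed (simp add: A_def)
  have bump2: "bumped (grid_family t N) lebesgue (density lebesgue \<sigma>) (density lebesgue u) ?\<gamma> ?p' q A" for t N
  proof (rule bumped_mono)
    show "bumped (grid_family t N) lebesgue (density lebesgue \<sigma>) (density lebesgue u) ?\<gamma> ?p' q
        (B2 * (2 * c2) powr (1 / ?p'))"
    proof (rule bumped_grid_family[OF p'(2) q _ c2 \<sigma> u e(2) B2(1)])
      fix Q :: "(real ^ 'n) set" assume "Q \<in> cubes"
      then have "?s2 Q \<le> ennreal B2" unfolding B2(2)[symmetric] by (rule SUP_upper)
      then show "ennreal (measure lebesgue Q powr ?e) * luxemburg_norm (loglog_bump ?p' \<delta>) (\<lambda>x. \<sigma> x powr (1 / ?p')) Q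
          * avg_norm q (\<lambda>x. u x powr (1 / q)) Q \<le> ennreal B2"
        by (simp add: mult_ac)
    qed (use \<delta> in simp)
  qed (simp add: A_def)
  let ?K = "12 powr (real CARD('n) - \<alpha>) * (real CARD('n set) powr q * real CARD('n set)) powr (1 / q)
    * (dyadic_const ?\<gamma> p ?p' q (q / (q - 1)) * A)"
  show "\<exists>C::real. C \<ge> 0 \<and> (\<forall>f\<in>Lp_space p \<sigma>.
      (AE x in density lebesgue (\<lambda>x. ennreal (u x)).
         integrable lebesgue (riesz_integrand \<alpha> (\<lambda>y. f y * \<sigma> y) x)) \<and>
      Lp_norm q u (riesz_potential \<alpha> (\<lambda>y. f y * \<sigma> y)) \<le> ennreal C * Lp_norm p \<sigma> f)"
  proof (intro exI[of _ ?K] conjI ballI)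
    show "0 \<le> ?K" using A dyadic_const_nonneg by (intro mult_nonneg_nonneg) auto
    fix f assume f: "f \<in> Lp_space p \<sigma>"
    note * = riesz_potential_bound[OF assms(1,2,3) p'(1) q \<open>p < q\<close> u \<sigma> A bump1 bump2 f]
    show "AE x in density lebesgue (\<lambda>x. ennreal (u x)).
         integrable lebesgue (riesz_integrand \<alpha> (\<lambda>y. f y * \<sigma> y) x)" by (rule *(1))
    show "Lp_norm q u (riesz_potential \<alpha> (\<lambda>y. f y * \<sigma> y)) \<le> ennreal ?K * Lp_norm p \<sigma> f" by (rule *(2))
  qed
qed simp

end
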